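(* Let $X$ and $Y$ be locally simple $\mathfrak{g}_\infty$-modules with nonzero annihilators in $U(\mathfrak{g}_\infty)$, with associated point data sequences $(\lambda_\bullet, x_\bullet)$ and $(\mu_\bullet, y_\bullet)$, respectively. Then $X \cong Y$ if and only if $(\lambda_\bullet, x_\bullet) \sim (\mu_\bullet, y_\bullet)$, that is, if and only if $\lambda_k = \mu_k$ and $[x_k] = [y_k]$ for all $k \gg 0$.
   Context: $\mathbb{F}$ is an algebraically closed field of characteristic $0$ and $n \geq 2$ is an integer, which is even in the symplectic case. $\mathfrak{g}_\infty$ is $\mathfrak{sl}(n^\infty)$, $\mathfrak{sp}(n^\infty)$ or $\mathfrak{so}(n^\infty)$, i.e. the direct limit of $\mathfrak{g}_k = \mathfrak{sl}(n^k)$, $\mathfrak{sp}(n^k)$ or $\mathfrak{so}(n^k)$ respectively, along the embeddings $M \mapsto \operatorname{diag}(M,\dots,M)$ ($n$ copies). A locally simple $\mathfrak{g}_\infty$-module is a direct limit $X = \varinjlim_{x_k} X_k$, where each $X_k$ is a finite dimensional simple $\mathfrak{g}_k$-module and each $x_k : X_k \to X_{k+1}$ is a nonzero $\mathfrak{g}_k$-homomorphism. If $X$ has nonzero annihilator, there is a finite set $\Lambda$ of partitions (for $\mathfrak{sp}$, $\mathfrak{so}$) or pairs of partitions (for $\mathfrak{sl}$), depending only on the annihilator, such that for $k \gg 0$ we have $X_k \cong V_{\lambda_k}^{n^k}$ for a unique $\lambda_k \in \Lambda$. Here, for $m$ large, $V^m_\lambda$ denotes: for $\mathfrak{sl}(m)$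 and a pair $\lambda = (\alpha,\beta)$ of partitions, the restriction to $\mathfrak{sl}(m)$ of the irreducible $\mathfrak{gl}(m)$-module of highest weight $(\alpha_1,\alpha_2,\dots,0,\dots,0,\dots,-\beta_2,-\beta_1)$; for $\mathfrak{sp}(m)$ and $\mathfrak{so}(m)$, the irreducible module with highest weight given by the partition $\lambda$. The sequence $(\lambda_\bullet)$ is the $\Lambda$-sequence of $X$. Identifying $X_k$ with $V_{\lambda_k}^{n^k}$ (unique up to scalar by Schur's lemma), put $H_k = \operatorname{Hom}_{\mathfrak{g}_k}(X_k, X_{k+1})$, a finite-dimensional vector space. The point data sequence of $X$ is $(\lambda_\bullet, x_\bullet)$ with $x_k \in H_k \setminus \{0\}$, and $[x_k]$ denotes the associated point of $\mathbb{P}(H_k)$. *)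

theory Defs
  imports
    "Jordan_Normal_Form.VS_Connect"
    "HOL-Algebra.QuotRing"
begin

section \<open>Lie algebras and their modules\<close>

text \<open>Scalars are a type \<open>'a\<close> of class \<open>field\<close>, used as the ring record \<^term>\<open>class_ring\<close>.
  The fields \<open>mult\<close> and \<open>one\<close>, which module records inherit from ring records, carry no meaning
  and are left undefined, as in \<^const>\<open>module_vec\<close>.\<close>

record ('a, 'g) lie_alg = "('a, 'g) module" +
  lbr :: "'g \<Rightarrow> 'g \<Rightarrow> 'g"

record ('a, 'v, 'g) lie_mod = "('a, 'v) module" +
  act :: "'g \<Rightarrow> 'v \<Rightarrow> 'v"

definition lie_module :: "('a::field, 'g) lie_alg \<Rightarrow> ('a, 'v, 'g) lie_mod \<Rightarrow> bool" where
  "lie_module L M \<longleftrightarrow>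
     vectorspace class_ring M \<and>
     (\<forall>x\<in>carrier L. \<forall>v\<in>carrier M. act M x v \<in> carrier M) \<and>
     (\<forall>x\<in>carrier L. \<forall>v\<in>carrier M. \<forall>w\<in>carrier M.
        act M x (v \<oplus>\<^bsub>M\<^esub> w) = act M x v \<oplus>\<^bsub>M\<^esub> act M x w) \<and>
     (\<forall>x\<in>carrier L. \<forall>c. \<forall>v\<in>carrier M. act M x (c \<odot>\<^bsub>M\<^esub> v) = c \<odot>\<^bsub>M\<^esub> act M x v) \<and>
     (\<forall>x\<in>carrier L. \<forall>y\<in>carrier L. \<forall>v\<in>carrier M.
        act M (x \<oplus>\<^bsub>L\<^esub> y) v = act M x v \<oplus>\<^bsub>M\<^esub> act M y v) \<and>
     (\<forall>x\<in>carrier L. \<forall>c. \<forall>v\<in>carrier M. act M (c \<odot>\<^bsub>L\<^esub> x) v = c \<odot>\<^bsub>M\<^esub> act M x v) \<and>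
     (\<forall>x\<in>carrier L. \<forall>y\<in>carrier L. \<forall>v\<in>carrier M.
        act M (lbr L x y) v = act M x (act M y v) \<ominus>\<^bsub>M\<^esub> act M y (act M x v))"

definition lie_submodule :: "('a::field, 'g) lie_alg \<Rightarrow> 'v set \<Rightarrow> ('a, 'v, 'g) lie_mod \<Rightarrow> bool" where
  "lie_submodule L W M \<longleftrightarrow>
     subspace class_ring W M \<and> (\<forall>x\<in>carrier L. \<forall>v\<in>W. act M x v \<in> W)"

definition lie_simple :: "('a::field, 'g) lie_alg \<Rightarrow> ('a, 'v, 'g) lie_mod \<Rightarrow> bool" where
  "lie_simple L M \<longleftrightarrow>
     lie_module L M \<and> carrier M \<noteq> {\<zero>\<^bsub>M\<^esub>} \<and>
     (\<forall>W. lie_submodule L W M \<longrightarrow> W = {\<zero>\<^bsub>M\<^esub>} \<or> W = carrier M)"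

abbreviation fin_dim_mod :: "('a::field, 'v, 'g) lie_mod \<Rightarrow> bool" where
  "fin_dim_mod M \<equiv> vectorspace.fin_dim class_ring M"

definition lie_hom ::
    "('a::field, 'g) lie_alg \<Rightarrow> ('a, 'v, 'g) lie_mod \<Rightarrow> ('a, 'w, 'g) lie_mod \<Rightarrow> ('v \<Rightarrow> 'w) set" where
  "lie_hom L M N = {f. linear_map class_ring M N f \<and>
     (\<forall>x\<in>carrier L. \<forall>v\<in>carrier M. f (act M x v) = act N x (f v))}"

definition lie_iso ::
    "('a::field, 'g) lie_alg \<Rightarrow> ('a, 'v, 'g) lie_mod \<Rightarrow> ('a, 'w, 'g) lie_mod \<Rightarrow> ('v \<Rightarrow> 'w) set" where
  "lie_iso L M N = {f \<in> lie_hom L M N. bij_betw f (carrier M) (carrier N)}"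

definition lie_isomorphic ::
    "('a::field, 'g) lie_alg \<Rightarrow> ('a, 'v, 'g) lie_mod \<Rightarrow> ('a, 'w, 'g) lie_mod \<Rightarrow> bool" where
  "lie_isomorphic L M N \<longleftrightarrow> lie_iso L M N \<noteq> {}"

definition lie_pullback :: "('g \<Rightarrow> 'g) \<Rightarrow> ('a, 'v, 'g) lie_mod \<Rightarrow> ('a, 'v, 'g) lie_mod" where
  "lie_pullback f M = M\<lparr>act := (\<lambda>x. act M (f x))\<rparr>"


section \<open>The universal enveloping algebra and annihilators\<close>

text \<open>The free associative unital algebra on the underlying set of \<open>L\<close>: finitely supported
  coefficient functions on words, with the convolution product over all splittings of a word.\<close>

definition free_alg :: "('a::field, 'g) lie_alg \<Rightarrow> ('g list \<Rightarrow> 'a) ring" where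
  "free_alg L =
     \<lparr> carrier = {f. finite {w. f w \<noteq> 0} \<and> {w. f w \<noteq> 0} \<subseteq> lists (carrier L)},
       mult = (\<lambda>f g w. \<Sum>i\<le>length w. f (take i w) * g (drop i w)),
       one = (\<lambda>w. if w = [] then 1 else 0),
       zero = (\<lambda>w. 0),
       add = (\<lambda>f g w. f w + g w) \<rparr>"

definition fmon :: "'a::field \<Rightarrow> 'g list \<Rightarrow> ('g list \<Rightarrow> 'a)" where
  "fmon c u = (\<lambda>w. if w = u then c else 0)"

text \<open>The first two families of relations make the generators linear, so that the quotient by
  them alone is the tensor algebra \<open>T(L)\<close>; the third family is the usual one defining \<open>U(L)\<close>.\<close>

definition uea_rels :: "('a::field, 'g) lie_alg \<Rightarrow> ('g list \<Rightarrow> 'a) set" where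
  "uea_rels L =
     {\<lambda>w. fmon 1 [x \<oplus>\<^bsub>L\<^esub> y] w - fmon 1 [x] w - fmon 1 [y] w | x y. x \<in> carrier L \<and> y \<in> carrier L} \<union>
     {\<lambda>w. fmon 1 [c \<odot>\<^bsub>L\<^esub> x] w - fmon c [x] w | c x. x \<in> carrier L} \<union>
     {\<lambda>w. fmon 1 [x, y] w - fmon 1 [y, x] w - fmon 1 [lbr L x y] w
        | x y. x \<in> carrier L \<and> y \<in> carrier L}"

definition uea :: "('a::field, 'g) lie_alg \<Rightarrow> ('g list \<Rightarrow> 'a) set ring" where
  "uea L = free_alg L Quot (Idl\<^bsub>free_alg L\<^esub> (uea_rels L))"

definition free_act :: "('a::field, 'v, 'g) lie_mod \<Rightarrow> ('g list \<Rightarrow> 'a) \<Rightarrow> 'v \<Rightarrow> 'v" where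
  "free_act M f v = (\<Oplus>\<^bsub>M\<^esub> w\<in>{w. f w \<noteq> 0}. f w \<odot>\<^bsub>M\<^esub> foldr (act M) w v)"

text \<open>An element of \<^const>\<open>uea\<close> is a coset, acting through any of its representatives.\<close>

definition annihilator ::
    "('a::field, 'g) lie_alg \<Rightarrow> ('a, 'v, 'g) lie_mod \<Rightarrow> ('g list \<Rightarrow> 'a) set set" where
  "annihilator L M =
     {u \<in> carrier (uea L). \<forall>f\<in>u. \<forall>v\<in>carrier M. free_act M f v = \<zero>\<^bsub>M\<^esub>}"


section \<open>Direct limits of sequences\<close>

text \<open>All sequences \<open>S\<^sub>1 \<rightarrow> S\<^sub>2 \<rightarrow> \<dots>\<close> are indexed by \<open>k \<ge> 1\<close>: for \<open>k = 0\<close> there is no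
  symplectic algebra of size \<open>n ^ k\<close>. The limit is the set of classes of pairs \<open>(k, a)\<close>,
  \<open>a \<in> S k\<close>, where two pairs are identified when their images agree at some later stage.\<close>

primrec dl_iter :: "(nat \<Rightarrow> 'b \<Rightarrow> 'b) \<Rightarrow> nat \<Rightarrow> nat \<Rightarrow> 'b \<Rightarrow> 'b" where
  "dl_iter f k 0 a = a"
| "dl_iter f k (Suc d) a = f (k + d) (dl_iter f k d a)"

definition dl_trans :: "(nat \<Rightarrow> 'b \<Rightarrow> 'b) \<Rightarrow> nat \<Rightarrow> nat \<Rightarrow> 'b \<Rightarrow> 'b" where
  "dl_trans f k l = dl_iter f k (l - k)"

definition dl_rel :: "(nat \<Rightarrow> 'b set) \<Rightarrow> (nat \<Rightarrow> 'b \<Rightarrow> 'b) \<Rightarrow> ((nat \<times> 'b) \<times> (nat \<times> 'b)) set" where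
  "dl_rel S f = {((k, a), (l, b)). k \<ge> 1 \<and> a \<in> S k \<and> l \<ge> 1 \<and> b \<in> S l \<and>
     (\<exists>p. k \<le> p \<and> l \<le> p \<and> dl_trans f k p a = dl_trans f l p b)}"

definition dl_set :: "(nat \<Rightarrow> 'b set) \<Rightarrow> (nat \<Rightarrow> 'b \<Rightarrow> 'b) \<Rightarrow> (nat \<times> 'b) set set" where
  "dl_set S f = (SIGMA k:{1..}. S k) // dl_rel S f"

definition dl_cls :: "(nat \<Rightarrow> 'b set) \<Rightarrow> (nat \<Rightarrow> 'b \<Rightarrow> 'b) \<Rightarrow> nat \<Rightarrow> 'b \<Rightarrow> (nat \<times> 'b) set" where
  "dl_cls S f k a = dl_rel S f `` {(k, a)}"

text \<open>Operations induced on the limit by operations \<open>h k\<close> at each stage: apply \<open>h\<close> to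
  representatives living at a common stage. For operations compatible with the transition maps the
  class obtained does not depend on the representatives, so the union is that single class.\<close>

definition dl_op1 ::
    "(nat \<Rightarrow> 'c set) \<Rightarrow> (nat \<Rightarrow> 'c \<Rightarrow> 'c) \<Rightarrow> (nat \<Rightarrow> 'b \<Rightarrow> 'c) \<Rightarrow>
     (nat \<times> 'b) set \<Rightarrow> (nat \<times> 'c) set" where
  "dl_op1 S f h P = \<Union>{dl_cls S f p (h p a) | p a. (p, a) \<in> P}"

definition dl_op2 ::
    "(nat \<Rightarrow> 'd set) \<Rightarrow> (nat \<Rightarrow> 'd \<Rightarrow> 'd) \<Rightarrow> (nat \<Rightarrow> 'b \<Rightarrow> 'c \<Rightarrow> 'd) \<Rightarrow>
     (nat \<times> 'b) set \<Rightarrow> (nat \<times> 'c) set \<Rightarrow> (nat \<times> 'd) set" where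
  "dl_op2 S f h P Q = \<Union>{dl_cls S f p (h p a b) | p a b. (p, a) \<in> P \<and> (p, b) \<in> Q}"

definition lim_alg ::
    "(nat \<Rightarrow> ('a, 'g) lie_alg) \<Rightarrow> (nat \<Rightarrow> 'g \<Rightarrow> 'g) \<Rightarrow> ('a, (nat \<times> 'g) set) lie_alg" where
  "lim_alg L f = (let S = (\<lambda>k. carrier (L k)) in
     \<lparr> carrier = dl_set S f,
       mult = undefined, one = undefined,
       zero = dl_cls S f 1 (\<zero>\<^bsub>L 1\<^esub>),
       add = dl_op2 S f (\<lambda>k. add (L k)),
       smult = (\<lambda>c. dl_op1 S f (\<lambda>k. smult (L k) c)),
       lbr = dl_op2 S f (\<lambda>k. lbr (L k)) \<rparr>)"

definition lim_mod ::
    "(nat \<Rightarrow> ('a, 'v, 'g) lie_mod) \<Rightarrow> (nat \<Rightarrow> 'v \<Rightarrow> 'v) \<Rightarrow> ('a, (nat \<times> 'v) set, (nat \<times> 'g) set) lie_mod" where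
  "lim_mod X x = (let S = (\<lambda>k. carrier (X k)) in
     \<lparr> carrier = dl_set S x,
       mult = undefined, one = undefined,
       zero = dl_cls S x 1 (\<zero>\<^bsub>X 1\<^esub>),
       add = dl_op2 S x (\<lambda>k. add (X k)),
       smult = (\<lambda>c. dl_op1 S x (\<lambda>k. smult (X k) c)),
       act = dl_op2 S x (\<lambda>k. act (X k)) \<rparr>)"


section \<open>The classical Lie algebras and their diagonal limits\<close>

datatype classical = SL | SP | SO

definition matrix_lie :: "nat \<Rightarrow> 'a::field mat set \<Rightarrow> ('a, 'a mat) lie_alg" where
  "matrix_lie m S =
     \<lparr> carrier = S, mult = undefined, one = undefined, zero = 0\<^sub>m m m, add = (+),
       smult = (\<cdot>\<^sub>m), lbr = (\<lambda>A B. A * B - B * A) \<rparr>"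

text \<open>The symplectic form is the orthogonal sum of hyperbolic planes spanned by
  \<open>e\<^bsub>2i\<^esub>, e\<^bsub>2i+1\<^esub>\<close>, and the symmetric form is the standard one with orthonormal basis \<open>e\<^sub>i\<close>.
  For these choices the form of size \<open>n * m\<close> is the orthogonal sum of \<open>n\<close> copies of the form of
  size \<open>m\<close>, so that \<open>A \<mapsto> diag(A, \<dots>, A)\<close> maps \<open>sp(m)\<close> (\<open>m\<close> even) to \<open>sp(n * m)\<close> and \<open>so(m)\<close>
  to \<open>so(n * m)\<close>.\<close>

definition symp_form :: "nat \<Rightarrow> 'a::field mat" where
  "symp_form m = mat m m (\<lambda>(i, j).
     if even i \<and> j = i + 1 then 1 else if odd i \<and> i = j + 1 then - 1 else 0)"

definition gl_alg :: "nat \<Rightarrow> ('a::field, 'a mat) lie_alg" where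
  "gl_alg m = matrix_lie m (carrier_mat m m)"

fun classical_alg :: "classical \<Rightarrow> nat \<Rightarrow> ('a::field, 'a mat) lie_alg" where
  "classical_alg SL m = matrix_lie m {A \<in> carrier_mat m m. (\<Sum>i<m. A $$ (i, i)) = 0}"
| "classical_alg SP m = matrix_lie m {A \<in> carrier_mat m m.
     transpose_mat A * symp_form m + symp_form m * A = 0\<^sub>m m m}"
| "classical_alg SO m = matrix_lie m {A \<in> carrier_mat m m. transpose_mat A + A = 0\<^sub>m m m}"

definition diag_emb :: "nat \<Rightarrow> 'a::field mat \<Rightarrow> 'a mat" where
  "diag_emb n A = diag_block_mat (replicate n A)"

abbreviation g_fin :: "classical \<Rightarrow> nat \<Rightarrow> nat \<Rightarrow> ('a::field, 'a mat) lie_alg" where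
  "g_fin K n k \<equiv> classical_alg K (n ^ k)"

definition g_inf :: "classical \<Rightarrow> nat \<Rightarrow> ('a::field, (nat \<times> 'a mat) set) lie_alg" where
  "g_inf K n = lim_alg (g_fin K n) (\<lambda>_. diag_emb n)"

text \<open>A locally simple module is \<^term>\<open>lim_mod X x\<close> for a system \<open>(X, x)\<close> as follows.\<close>

definition locally_simple_system ::
    "classical \<Rightarrow> nat \<Rightarrow> (nat \<Rightarrow> ('a::field, 'v, 'a mat) lie_mod) \<Rightarrow> (nat \<Rightarrow> 'v \<Rightarrow> 'v) \<Rightarrow> bool" where
  "locally_simple_system K n X x \<longleftrightarrow> (\<forall>k\<ge>1.
     lie_simple (g_fin K n k) (X k) \<and> fin_dim_mod (X k) \<and>
     x k \<in> lie_hom (g_fin K n k) (X k) (lie_pullback (diag_emb n) (X (k + 1))) \<and>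
     (\<exists>v\<in>carrier (X k). x k v \<noteq> \<zero>\<^bsub>X (k + 1)\<^esub>))"


section \<open>The modules \<open>V\<^sub>\<lambda>\<^sup>m\<close>\<close>

definition is_partition :: "nat list \<Rightarrow> bool" where
  "is_partition p \<longleftrightarrow> sorted_wrt (\<ge>) p \<and> 0 \<notin> set p"

text \<open>Labels are pairs of partitions for \<open>sl\<close>; a partition labelling a module over \<open>sp\<close> or \<open>so\<close>
  is encoded as a pair with empty second component.\<close>

type_synonym label = "nat list \<times> nat list"

fun labels :: "classical \<Rightarrow> label set" where
  "labels SL = {(\<alpha>, \<beta>). is_partition \<alpha> \<and> is_partition \<beta>}"
| "labels _ = {(\<alpha>, \<beta>). is_partition \<alpha> \<and> \<beta> = []}"

fun label_fits :: "classical \<Rightarrow> nat \<Rightarrow> label \<Rightarrow> bool" where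
  "label_fits SL m (\<alpha>, \<beta>) \<longleftrightarrow> length \<alpha> + length \<beta> \<le> m"
| "label_fits _ m (\<alpha>, \<beta>) \<longleftrightarrow> 2 * length \<alpha> \<le> m"

text \<open>The weight \<open>(\<alpha>\<^sub>1, \<alpha>\<^sub>2, \<dots>, 0, \<dots>, 0, \<dots>, -\<beta>\<^sub>2, -\<beta>\<^sub>1)\<close> of length \<open>m\<close>.\<close>

fun label_weight :: "nat \<Rightarrow> label \<Rightarrow> nat \<Rightarrow> int" where
  "label_weight m (\<alpha>, \<beta>) i =
     (if i < length \<alpha> then int (\<alpha> ! i) else 0) -
     (if m - 1 - i < length \<beta> then int (\<beta> ! (m - 1 - i)) else 0)"

text \<open>The columns \<open>b\<^sub>0, \<dots>, b\<^bsub>m-1\<^esub>\<close> of \<^term>\<open>borel_basis K m\<close> form a basis such that the elements of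
  \<^term>\<open>classical_alg K m\<close> which are diagonal, respectively upper triangular, with respect to this
  basis form a Cartan, respectively Borel, subalgebra. For \<open>sp\<close> and \<open>so\<close> this is a basis with
  \<open>(b\<^sub>i, b\<^sub>j) = 0\<close> unless \<open>i + j = m - 1\<close>, built from the isotropic vectors \<open>e\<^bsub>2j\<^esub>\<close>, \<open>e\<^bsub>2j+1\<^esub>\<close>,
  respectively \<open>e\<^bsub>2j\<^esub> + \<i> e\<^bsub>2j+1\<^esub>\<close>, \<open>e\<^bsub>2j\<^esub> - \<i> e\<^bsub>2j+1\<^esub>\<close>; the diagonal entries then have the form
  \<open>(t\<^sub>1, \<dots>, t\<^sub>r, (0,) -t\<^sub>r, \<dots>, -t\<^sub>1)\<close> with \<open>r = m div 2\<close>, and the positive roots are the usual ones,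
  \<open>t\<^sub>i \<plusminus> t\<^sub>j\<close> for \<open>i < j\<close> together with \<open>2 t\<^sub>i\<close> (\<open>sp\<close>) or, for \<open>m\<close> odd, \<open>t\<^sub>i\<close> (\<open>so\<close>).\<close>

definition imag_unit :: "'a::field" where
  "imag_unit = (SOME c. c * c = - 1)"

fun borel_basis :: "classical \<Rightarrow> nat \<Rightarrow> 'a::field mat" where
  "borel_basis SL m = 1\<^sub>m m"
| "borel_basis SP m = mat m m (\<lambda>(i, j).
     if j < m div 2 then (if i = 2 * j then 1 else 0)
     else (if i = 2 * (m - 1 - j) + 1 then 1 else 0))"
| "borel_basis SO m = mat m m (\<lambda>(i, j).
     if j < m div 2 then
       (if i = 2 * j then 1 else if i = 2 * j + 1 then imag_unit else 0)
     else if m - 1 - j < m div 2 then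
       (if i = 2 * (m - 1 - j) then 1 else if i = 2 * (m - 1 - j) + 1 then - imag_unit else 0)
     else (if i = m - 1 then 1 else 0))"

text \<open>\<open>M\<close> is a finite dimensional simple module over the matrix Lie algebra \<open>L\<close> of size \<open>m\<close>, with
  a highest weight vector \<open>v\<close> of weight \<open>wt\<close>. Here \<open>T\<close> is the matrix of \<open>A\<close> in the basis \<open>B\<close>; the
  condition says that strictly upper triangular elements annihilate \<open>v\<close> and that diagonal ones act
  on it by the weight.\<close>

definition hw_module ::
    "('a::field, 'a mat) lie_alg \<Rightarrow> nat \<Rightarrow> 'a mat \<Rightarrow> (nat \<Rightarrow> int) \<Rightarrow> ('a, 'v, 'a mat) lie_mod \<Rightarrow> bool" where
  "hw_module L m B wt M \<longleftrightarrow>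
     lie_simple L M \<and> fin_dim_mod M \<and>
     (\<exists>v\<in>carrier M. v \<noteq> \<zero>\<^bsub>M\<^esub> \<and>
       (\<forall>A\<in>carrier L. \<forall>T\<in>carrier_mat m m. A * B = B * T \<and> upper_triangular T \<longrightarrow>
          act M A v = (\<Sum>i<m. of_int (wt i) * T $$ (i, i)) \<odot>\<^bsub>M\<^esub> v))"

text \<open>\<^term>\<open>is_V K m lam M\<close>: \<open>M\<close> is a copy of \<open>V\<^sub>\<lambda>\<^sup>m\<close>. For \<open>sl\<close> this means that the action on \<open>M\<close>
  is the restriction of an irreducible \<open>gl\<close>-action \<open>\<rho>\<close> with the given highest weight.\<close>

definition is_V ::
    "classical \<Rightarrow> nat \<Rightarrow> label \<Rightarrow> ('a::field, 'v, 'a mat) lie_mod \<Rightarrow> bool" where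
  "is_V K m lam M \<longleftrightarrow> lam \<in> labels K \<and> label_fits K m lam \<and>
     (if K = SL then
        \<exists>\<rho>. hw_module (gl_alg m) m (borel_basis SL m) (label_weight m lam) (M\<lparr>act := \<rho>\<rparr>) \<and>
            (\<forall>A\<in>carrier (classical_alg SL m). \<forall>v\<in>carrier M. act M A v = \<rho> A v)
      else hw_module (classical_alg K m) m (borel_basis K m) (label_weight m lam) M)"

text \<open>A fixed representative of the isomorphism class, realised on some \<open>\<bbbF>\<^sup>d\<close>. Every finite
  dimensional module has a copy of this kind, so nothing is lost by choosing it there.\<close>

definition V_mod :: "classical \<Rightarrow> nat \<Rightarrow> label \<Rightarrow> ('a::field, 'a vec, 'a mat) lie_mod" where
  "V_mod K m lam = (SOME V. is_V K m lam V)"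


section \<open>Point data sequences\<close>

text \<open>\<open>\<lambda>\<^sub>k\<close> matters only for large \<open>k\<close>. For \<open>\<Lambda>\<close> finite and \<open>k\<close> large, distinct elements of \<open>\<Lambda>\<close> label
  non-isomorphic modules, so \<open>\<lambda>\<^sub>k\<close> is determined by \<open>X\<^sub>k\<close>; enlarging \<open>\<Lambda>\<close> changes \<open>(\<lambda>\<^sub>k)\<close> in at most
  finitely many places.\<close>

definition Lambda_sequence ::
    "classical \<Rightarrow> nat \<Rightarrow> (nat \<Rightarrow> ('a::field, 'v, 'a mat) lie_mod) \<Rightarrow> (nat \<Rightarrow> label) \<Rightarrow> bool" where
  "Lambda_sequence K n X lam \<longleftrightarrow>
     (\<exists>\<Lambda>. finite \<Lambda> \<and> \<Lambda> \<subseteq> labels K \<and>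
       (\<forall>\<^sub>F k in sequentially. lam k \<in> \<Lambda> \<and> is_V K (n ^ k) (lam k) (X k)))"

text \<open>Besides the \<open>\<Lambda>\<close>-sequence, the data consist of the maps \<open>x\<^sub>k\<close> read, through identifications
  \<open>\<theta>\<^sub>k\<close> of \<open>X\<^sub>k\<close> with the fixed module \<open>V\<close> labelled by \<open>\<lambda>\<^sub>k\<close>, as maps
  \<open>\<xi>\<^sub>k = \<theta>\<^bsub>k+1\<^esub> \<circ> x\<^sub>k \<circ> \<theta>\<^sub>k\<^sup>-\<^sup>1\<close> between these fixed modules.\<close>

definition point_data ::
    "classical \<Rightarrow> nat \<Rightarrow> (nat \<Rightarrow> ('a::field, 'v, 'a mat) lie_mod) \<Rightarrow> (nat \<Rightarrow> 'v \<Rightarrow> 'v) \<Rightarrow>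
     (nat \<Rightarrow> label) \<Rightarrow> (nat \<Rightarrow> 'a vec \<Rightarrow> 'a vec) \<Rightarrow> bool" where
  "point_data K n X x lam \<xi> \<longleftrightarrow>
     Lambda_sequence K n X lam \<and>
     (\<exists>\<theta>. \<forall>\<^sub>F k in sequentially.
        \<theta> k \<in> lie_iso (g_fin K n k) (X k) (V_mod K (n ^ k) (lam k)) \<and>
        (\<forall>v\<in>carrier (X k). \<xi> k (\<theta> k v) = \<theta> (k + 1) (x k v)))"

text \<open>The point of \<open>\<bbbP>(Hom(M, N))\<close> of a nonzero \<open>f\<close>: its set of nonzero scalar multiples,
  as functions on the carrier of \<open>M\<close>.\<close>

definition proj_point ::
    "('a::field, 'v, 'g) lie_mod \<Rightarrow> ('a, 'w, 'g) lie_mod \<Rightarrow> ('v \<Rightarrow> 'w) \<Rightarrow> ('v \<Rightarrow> 'w) set" where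
  "proj_point M N f = {restrict (\<lambda>v. c \<odot>\<^bsub>N\<^esub> f v) (carrier M) | c. c \<noteq> 0}"

definition H_point ::
    "classical \<Rightarrow> nat \<Rightarrow> (nat \<Rightarrow> label) \<Rightarrow> nat \<Rightarrow> ('a::field vec \<Rightarrow> 'a vec) \<Rightarrow> ('a vec \<Rightarrow> 'a vec) set" where
  "H_point K n lam k f =
     proj_point (V_mod K (n ^ k) (lam k)) (V_mod K (n ^ (k + 1)) (lam (k + 1))) f"

definition point_data_equiv ::
    "classical \<Rightarrow> nat \<Rightarrow> (nat \<Rightarrow> label) \<times> (nat \<Rightarrow> 'a::field vec \<Rightarrow> 'a vec) \<Rightarrow>
     (nat \<Rightarrow> label) \<times> (nat \<Rightarrow> 'a vec \<Rightarrow> 'a vec) \<Rightarrow> bool" where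
  "point_data_equiv K n = (\<lambda>(lam, \<xi>) (mu, \<eta>).
     \<forall>\<^sub>F k in sequentially. lam k = mu k \<and> H_point K n lam k (\<xi> k) = H_point K n mu k (\<eta> k))"

end

theory Submission
  imports Defs
begin

text \<open>An isomorphism \<open>\<Phi>\<close> of the two limits is compatible with the stages from some point on. A nonzero
vector \<open>v\<close> of \<open>X\<^sub>1\<close> is sent to a class that is represented in some \<open>Y\<^sub>l\<close>. For \<open>k \<ge> l\<close> the elements of
\<open>X\<^sub>k\<close> whose image is represented in \<open>Y\<^sub>k\<close> form a submodule; it contains the image of \<open>v\<close> and so is
all of \<open>X\<^sub>k\<close>. Hence \<open>\<Phi>\<close> restricts to injective homomorphisms \<open>\<phi>\<^sub>k : X\<^sub>k \<rightarrow> Y\<^sub>k\<close> that commute with the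
transition maps (\<open>lim_iso_imp_stage_homs\<close>). Conversely, stagewise isomorphisms that commute with the
transition maps induce an isomorphism of the limits (\<open>stages_iso_imp_lim_iso\<close>). What remains is a
comparison, for large \<open>k\<close>, of simple modules over one classical Lie algebra.

That comparison rests on one fact: in a simple module, any two nonzero vectors that are eigenvectors
for a Borel subalgebra are proportional (\<open>eigenvector_on_unique\<close>). Since \<open>\<phi>\<^sub>k\<close> maps highest weight
vectors to highest weight vectors, it forces \<open>X\<^sub>k\<close> and \<open>Y\<^sub>k\<close> to have the same weight on the Cartan
subalgebra. The labels lie in a finite set, so for large \<open>k\<close> this weight determines the label
(\<open>label_determined\<close>) and \<open>\<lambda>\<^sub>k = \<mu>\<^sub>k\<close>. The same fact yields Schur's lemma in the form that is used here
(\<open>lie_hom_proportional\<close>): two homomorphisms between simple modules are proportional, because they are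
so on a highest weight vector, and the vectors on which they are proportional form a submodule.

Let \<open>h\<^sub>k : X\<^sub>k \<rightarrow> Y\<^sub>k\<close> be the isomorphism obtained from the two identifications with the fixed module
\<open>V\<close>. In terms of \<open>h\<close>, equality of the points of \<open>\<xi>\<^sub>k\<close> and \<open>\<eta>\<^sub>k\<close> says that \<open>h\<^bsub>k+1\<^esub> \<circ> x\<^sub>k\<close> and \<open>y\<^sub>k \<circ> h\<^sub>k\<close>
agree up to a nonzero scalar (\<open>transition_scalar_iff\<close>). If \<open>\<phi>\<close> is given, then \<open>\<phi>\<^sub>k\<close> is a multiple of
\<open>h\<^sub>k\<close> and the scalars exist; if the scalars are given, the \<open>h\<^sub>k\<close> can be rescaled one after the other
to commute with the transition maps.\<close>

section \<open>Modules over a Lie algebra\<close>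

text \<open>The laws are restated with the operations of the scalar type, so that the ring record of the scalars
does not appear in rewriting.\<close>

locale class_vectorspace =
  fixes M :: "('a::field, 'v, 'b) module_scheme"
  assumes vectorspace: "vectorspace class_ring M"
begin

sublocale abelian_group M
proof -
  interpret vectorspace class_ring M by (rule vectorspace)
  show "abelian_group M" by (rule M.abelian_group_axioms)
qed

lemma scale_closed [simp, intro]: "v \<in> carrier M \<Longrightarrow> c \<odot>\<^bsub>M\<^esub> v \<in> carrier M"
  and scale_add_left: "v \<in> carrier M \<Longrightarrow> (c + d) \<odot>\<^bsub>M\<^esub> v = c \<odot>\<^bsub>M\<^esub> v \<oplus>\<^bsub>M\<^esub> d \<odot>\<^bsub>M\<^esub> v"
  and scale_add_right: "v \<in> carrier M \<Longrightarrow> w \<in> carrier M \<Longrightarrow>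
         c \<odot>\<^bsub>M\<^esub> (v \<oplus>\<^bsub>M\<^esub> w) = c \<odot>\<^bsub>M\<^esub> v \<oplus>\<^bsub>M\<^esub> c \<odot>\<^bsub>M\<^esub> w"
  and scale_scale [simp]: "v \<in> carrier M \<Longrightarrow> c \<odot>\<^bsub>M\<^esub> (d \<odot>\<^bsub>M\<^esub> v) = (c * d) \<odot>\<^bsub>M\<^esub> v"
  and scale_one [simp]: "v \<in> carrier M \<Longrightarrow> 1 \<odot>\<^bsub>M\<^esub> v = v"
  and scale_zero_left [simp]: "v \<in> carrier M \<Longrightarrow> 0 \<odot>\<^bsub>M\<^esub> v = \<zero>\<^bsub>M\<^esub>"
  and scale_zero_right [simp]: "c \<odot>\<^bsub>M\<^esub> \<zero>\<^bsub>M\<^esub> = \<zero>\<^bsub>M\<^esub>"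
proof -
  interpret vectorspace class_ring M by (rule vectorspace)
  show "v \<in> carrier M \<Longrightarrow> c \<odot>\<^bsub>M\<^esub> v \<in> carrier M" by simp
  show "v \<in> carrier M \<Longrightarrow> (c + d) \<odot>\<^bsub>M\<^esub> v = c \<odot>\<^bsub>M\<^esub> v \<oplus>\<^bsub>M\<^esub> d \<odot>\<^bsub>M\<^esub> v"
    using smult_l_distr[of c d v] by simp
  show "v \<in> carrier M \<Longrightarrow> w \<in> carrier M \<Longrightarrow>
      c \<odot>\<^bsub>M\<^esub> (v \<oplus>\<^bsub>M\<^esub> w) = c \<odot>\<^bsub>M\<^esub> v \<oplus>\<^bsub>M\<^esub> c \<odot>\<^bsub>M\<^esub> w"
    using smult_r_distr[of c v w] by simp
  show "v \<in> carrier M \<Longrightarrow> c \<odot>\<^bsub>M\<^esub> (d \<odot>\<^bsub>M\<^esub> v) = (c * d) \<odot>\<^bsub>M\<^esub> v"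
    using smult_assoc1[of c d v] by simp
  show "v \<in> carrier M \<Longrightarrow> 1 \<odot>\<^bsub>M\<^esub> v = v" using smult_one[of v] by simp
  show "v \<in> carrier M \<Longrightarrow> 0 \<odot>\<^bsub>M\<^esub> v = \<zero>\<^bsub>M\<^esub>" using smult_l_null[of v] by simp
  show "c \<odot>\<^bsub>M\<^esub> \<zero>\<^bsub>M\<^esub> = \<zero>\<^bsub>M\<^esub>" using smult_r_null[of c] by simp
qed

lemma minus_eq_scale: "v \<in> carrier M \<Longrightarrow> \<ominus>\<^bsub>M\<^esub> v = (- 1) \<odot>\<^bsub>M\<^esub> v"
  using scale_add_left[of v "- 1" 1] by (intro minus_equality) auto

lemma diff_eq_scale:
  "v \<in> carrier M \<Longrightarrow> w \<in> carrier M \<Longrightarrow> v \<ominus>\<^bsub>M\<^esub> w = v \<oplus>\<^bsub>M\<^esub> (- 1) \<odot>\<^bsub>M\<^esub> w"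
  by (simp add: a_minus_def minus_eq_scale)

lemma scale_eq_zeroD: "v \<in> carrier M \<Longrightarrow> c \<odot>\<^bsub>M\<^esub> v = \<zero>\<^bsub>M\<^esub> \<Longrightarrow> c = 0 \<or> v = \<zero>\<^bsub>M\<^esub>"
  using scale_scale[of v "inverse c" c] by (cases "c = 0") auto

lemma scale_cancel:
  assumes "v \<in> carrier M" "v \<noteq> \<zero>\<^bsub>M\<^esub>" "c \<odot>\<^bsub>M\<^esub> v = d \<odot>\<^bsub>M\<^esub> v"
  shows "c = d"
proof -
  have "(c - d) \<odot>\<^bsub>M\<^esub> v = (c + (- d)) \<odot>\<^bsub>M\<^esub> v" by simp
  also have "\<dots> = (d + (- d)) \<odot>\<^bsub>M\<^esub> v" using assms by (simp only: scale_add_left)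
  also have "\<dots> = \<zero>\<^bsub>M\<^esub>" using assms by simp
  finally show ?thesis using scale_eq_zeroD[of v "c - d"] assms by auto
qed

end

locale lie_rep =
  fixes L :: "('a::field, 'g) lie_alg" and M :: "('a, 'v, 'g) lie_mod"
  assumes lie_module: "lie_module L M"
begin

sublocale class_vectorspace M
  using lie_module by (intro class_vectorspace.intro) (simp add: lie_module_def)

lemma act_closed [simp, intro]: "x \<in> carrier L \<Longrightarrow> v \<in> carrier M \<Longrightarrow> act M x v \<in> carrier M"
  and act_add: "x \<in> carrier L \<Longrightarrow> v \<in> carrier M \<Longrightarrow> w \<in> carrier M \<Longrightarrow>
        act M x (v \<oplus>\<^bsub>M\<^esub> w) = act M x v \<oplus>\<^bsub>M\<^esub> act M x w"
  and act_scale: "x \<in> carrier L \<Longrightarrow> v \<in> carrier M \<Longrightarrow> act M x (c \<odot>\<^bsub>M\<^esub> v) = c \<odot>\<^bsub>M\<^esub> act M x v"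
  and add_act: "x \<in> carrier L \<Longrightarrow> y \<in> carrier L \<Longrightarrow> v \<in> carrier M \<Longrightarrow>
        act M (x \<oplus>\<^bsub>L\<^esub> y) v = act M x v \<oplus>\<^bsub>M\<^esub> act M y v"
  and scale_act: "x \<in> carrier L \<Longrightarrow> v \<in> carrier M \<Longrightarrow> act M (c \<odot>\<^bsub>L\<^esub> x) v = c \<odot>\<^bsub>M\<^esub> act M x v"
  and lbr_act: "x \<in> carrier L \<Longrightarrow> y \<in> carrier L \<Longrightarrow> v \<in> carrier M \<Longrightarrow>
        act M (lbr L x y) v = act M x (act M y v) \<ominus>\<^bsub>M\<^esub> act M y (act M x v)"
  using lie_module by (auto simp: lie_module_def)

lemma act_zero [simp]: "x \<in> carrier L \<Longrightarrow> act M x \<zero>\<^bsub>M\<^esub> = \<zero>\<^bsub>M\<^esub>"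
  using act_scale[of x "\<zero>\<^bsub>M\<^esub>" 0] by simp

lemma lie_submoduleI:
  assumes "W \<subseteq> carrier M" "\<zero>\<^bsub>M\<^esub> \<in> W"
    and "\<And>u v. u \<in> W \<Longrightarrow> v \<in> W \<Longrightarrow> u \<oplus>\<^bsub>M\<^esub> v \<in> W"
    and "\<And>c v. v \<in> W \<Longrightarrow> c \<odot>\<^bsub>M\<^esub> v \<in> W"
    and "\<And>x v. x \<in> carrier L \<Longrightarrow> v \<in> W \<Longrightarrow> act M x v \<in> W"
  shows "lie_submodule L W M"
proof -
  have "LinearCombinations.submodule class_ring W M"
    using assms vectorspace
    by (intro LinearCombinations.submodule.intro) (auto simp: vectorspace_def)
  then show ?thesis
    unfolding lie_submodule_def using assms vectorspace by (auto intro: subspace.intro)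
qed

lemma act_swap:
  assumes "x \<in> carrier L" "y \<in> carrier L" "lbr L x y \<in> carrier L" "v \<in> carrier M"
  shows "act M x (act M y v) = act M (lbr L x y) v \<oplus>\<^bsub>M\<^esub> act M y (act M x v)"
  using assms by (simp add: lbr_act a_minus_def a_assoc l_neg)

end

locale simple_lie_rep = lie_rep +
  assumes lie_simple: "lie_simple L M"
begin

lemma simple_eqI:
  assumes "lie_submodule L W M" "v \<in> W" "v \<noteq> \<zero>\<^bsub>M\<^esub>"
  shows "W = carrier M"
  using assms lie_simple unfolding lie_simple_def by auto

end

lemma simple_lie_repI: "lie_simple L M \<Longrightarrow> simple_lie_rep L M"
  by (simp add: lie_simple_def simple_lie_rep_def lie_rep_def simple_lie_rep_axioms_def)

lemma lie_homI:
  assumes "class_vectorspace M" "class_vectorspace N"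
    and "\<And>u. u \<in> carrier M \<Longrightarrow> f u \<in> carrier N"
    and "\<And>u v. u \<in> carrier M \<Longrightarrow> v \<in> carrier M \<Longrightarrow> f (u \<oplus>\<^bsub>M\<^esub> v) = f u \<oplus>\<^bsub>N\<^esub> f v"
    and "\<And>c u. u \<in> carrier M \<Longrightarrow> f (c \<odot>\<^bsub>M\<^esub> u) = c \<odot>\<^bsub>N\<^esub> f u"
    and "\<And>x u. x \<in> carrier L \<Longrightarrow> u \<in> carrier M \<Longrightarrow> f (act M x u) = act N x (f u)"
  shows "f \<in> lie_hom L M N"
proof -
  have vs: "vectorspace class_ring M" "vectorspace class_ring N"
    using assms(1,2) by (simp_all add: class_vectorspace_def)
  have "mod_hom class_ring M N f"
    using vs assms(3-5)
    by (intro mod_hom.intro mod_hom_axioms.intro) (auto simp: vectorspace_def LinearCombinations.module_hom_def)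
  then show ?thesis
    using vs assms(6) by (simp add: lie_hom_def linear_map_def)
qed

lemma lie_hom_facts:
  assumes "f \<in> lie_hom L M N"
  shows "class_vectorspace M" "class_vectorspace N"
    and "\<And>u. u \<in> carrier M \<Longrightarrow> f u \<in> carrier N"
    and "\<And>u v. u \<in> carrier M \<Longrightarrow> v \<in> carrier M \<Longrightarrow> f (u \<oplus>\<^bsub>M\<^esub> v) = f u \<oplus>\<^bsub>N\<^esub> f v"
    and "\<And>c u. u \<in> carrier M \<Longrightarrow> f (c \<odot>\<^bsub>M\<^esub> u) = c \<odot>\<^bsub>N\<^esub> f u"
    and "\<And>x u. x \<in> carrier L \<Longrightarrow> u \<in> carrier M \<Longrightarrow> f (act M x u) = act N x (f u)"
    and "f \<zero>\<^bsub>M\<^esub> = \<zero>\<^bsub>N\<^esub>"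
proof -
  have lm: "linear_map class_ring M N f"
    and act: "\<And>x u. x \<in> carrier L \<Longrightarrow> u \<in> carrier M \<Longrightarrow> f (act M x u) = act N x (f u)"
    using assms by (auto simp: lie_hom_def)
  then have mh: "f \<in> LinearCombinations.module_hom class_ring M N"
    by (simp add: linear_map_def mod_hom_def mod_hom_axioms_def)
  show M: "class_vectorspace M" and N: "class_vectorspace N"
    using lm by (simp_all add: linear_map_def class_vectorspace_def)
  show cl: "\<And>u. u \<in> carrier M \<Longrightarrow> f u \<in> carrier N"
    and "\<And>u v. u \<in> carrier M \<Longrightarrow> v \<in> carrier M \<Longrightarrow> f (u \<oplus>\<^bsub>M\<^esub> v) = f u \<oplus>\<^bsub>N\<^esub> f v"
    and sc: "\<And>c u. u \<in> carrier M \<Longrightarrow> f (c \<odot>\<^bsub>M\<^esub> u) = c \<odot>\<^bsub>N\<^esub> f u"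
    using mh by (auto simp: LinearCombinations.module_hom_def)
  show "\<And>x u. x \<in> carrier L \<Longrightarrow> u \<in> carrier M \<Longrightarrow> f (act M x u) = act N x (f u)" by (fact act)
  interpret M: class_vectorspace M by (rule M)
  interpret N: class_vectorspace N by (rule N)
  show "f \<zero>\<^bsub>M\<^esub> = \<zero>\<^bsub>N\<^esub>"
    using sc[of "\<zero>\<^bsub>M\<^esub>" 0] cl[of "\<zero>\<^bsub>M\<^esub>"] by simp
qed

text \<open>The kernel is a submodule. The lemma is meant for pullbacks \<open>N\<close> along a map \<open>e\<close> of Lie algebras: there
\<open>act N x 0 = 0\<close> is immediate, whereas the laws of a Lie module would ask for the linearity of \<open>e\<close> and
its compatibility with brackets.\<close>

lemma lie_hom_inj:
  assumes "lie_simple L M" "f \<in> lie_hom L M N" "\<And>x. x \<in> carrier L \<Longrightarrow> act N x \<zero>\<^bsub>N\<^esub> = \<zero>\<^bsub>N\<^esub>"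
    and "u0 \<in> carrier M" "f u0 \<noteq> \<zero>\<^bsub>N\<^esub>" "u \<in> carrier M" "f u = \<zero>\<^bsub>N\<^esub>"
  shows "u = \<zero>\<^bsub>M\<^esub>"
proof (rule ccontr)
  assume u: "u \<noteq> \<zero>\<^bsub>M\<^esub>"
  interpret M: simple_lie_rep L M using assms(1) by (rule simple_lie_repI)
  note f = lie_hom_facts[OF assms(2)]
  interpret N: class_vectorspace N by (rule f(2))
  let ?W = "{u \<in> carrier M. f u = \<zero>\<^bsub>N\<^esub>}"
  have "lie_submodule L ?W M"
    by (rule M.lie_submoduleI) (auto simp: f assms(3))
  then have "?W = carrier M" using assms(6,7) u by (intro M.simple_eqI) auto
  then show False using assms(4,5) by auto
qed

lemma lie_hom_inj_on:
  assumes "lie_simple L M" "f \<in> lie_hom L M N" "\<And>x. x \<in> carrier L \<Longrightarrow> act N x \<zero>\<^bsub>N\<^esub> = \<zero>\<^bsub>N\<^esub>"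
    and "u0 \<in> carrier M" "f u0 \<noteq> \<zero>\<^bsub>N\<^esub>"
  shows "inj_on f (carrier M)"
proof (rule inj_onI)
  interpret M: simple_lie_rep L M using assms(1) by (rule simple_lie_repI)
  note f = lie_hom_facts[OF assms(2)]
  interpret N: class_vectorspace N by (rule f(2))
  fix u v assume uv: "u \<in> carrier M" "v \<in> carrier M" "f u = f v"
  have "f (u \<oplus>\<^bsub>M\<^esub> (- 1) \<odot>\<^bsub>M\<^esub> v) = f v \<ominus>\<^bsub>N\<^esub> f v"
    using uv by (simp add: f N.diff_eq_scale)
  also have "\<dots> = \<zero>\<^bsub>N\<^esub>" using uv f by (simp add: N.minus_eq N.r_neg)
  finally have "u \<ominus>\<^bsub>M\<^esub> v = \<zero>\<^bsub>M\<^esub>"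
    using lie_hom_inj[OF assms] uv by (simp add: M.diff_eq_scale)
  then have "\<ominus>\<^bsub>M\<^esub> (\<ominus>\<^bsub>M\<^esub> v) = u" using uv by (intro M.minus_equality) (auto simp: M.minus_eq)
  then show "u = v" using uv by simp
qed

section \<open>Highest weight vectors in simple modules\<close>

text \<open>The additive closure is enough to describe a sum of subspaces, and its induction rule replaces
manipulations of finite sums of operators.\<close>

inductive_set additive_span :: "('a, 'g) lie_alg \<Rightarrow> 'g set \<Rightarrow> 'g set" for L :: "('a, 'g) lie_alg" and S where
  base: "x \<in> S \<Longrightarrow> x \<in> additive_span L S"
| add: "x \<in> additive_span L S \<Longrightarrow> y \<in> additive_span L S \<Longrightarrow> x \<oplus>\<^bsub>L\<^esub> y \<in> additive_span L S"

text \<open>An abstract triangular decomposition \<open>L = U + (\<Sum>d\<ge>1. G d)\<close>: \<open>U\<close> plays the role of the Borel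
subalgebra, \<open>G d\<close> that of the lowering operators of degree \<open>d\<close>, and \<open>D \<in> U\<close> is an element whose adjoint
action measures this degree.\<close>

locale triangular =
  fixes L :: "('a::field_char_0, 'g) lie_alg" and D :: 'g and U :: "'g set" and G :: "nat \<Rightarrow> 'g set"
  assumes D_in: "D \<in> U" and U_sub: "U \<subseteq> carrier L" and G_sub: "d \<ge> 1 \<Longrightarrow> G d \<subseteq> carrier L"
    and lbr_closed: "x \<in> carrier L \<Longrightarrow> y \<in> carrier L \<Longrightarrow> lbr L x y \<in> carrier L"
    and add_closed: "x \<in> carrier L \<Longrightarrow> y \<in> carrier L \<Longrightarrow> x \<oplus>\<^bsub>L\<^esub> y \<in> carrier L"
    and lbr_D: "d \<ge> 1 \<Longrightarrow> x \<in> G d \<Longrightarrow> lbr L D x = (- of_nat d) \<odot>\<^bsub>L\<^esub> x"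
    and decomposition: "carrier L \<subseteq> additive_span L (U \<union> (\<Union>d\<in>{1..}. G d))"

text \<open>The eigenvalues are left unspecified: the uniqueness statement below compares vectors whose weights
are not known to agree.\<close>

definition eigenvector_on :: "'g set \<Rightarrow> ('a, 'v, 'g) lie_mod \<Rightarrow> 'v \<Rightarrow> bool" where
  "eigenvector_on U M v \<longleftrightarrow> v \<in> carrier M \<and> v \<noteq> \<zero>\<^bsub>M\<^esub> \<and> (\<forall>x\<in>U. \<exists>c. act M x v = c \<odot>\<^bsub>M\<^esub> v)"

locale hw_rep = triangular L D U G + simple_lie_rep L M
  for L :: "('a::field_char_0, 'g) lie_alg" and D U G and M :: "('a, 'v, 'g) lie_mod"
begin

text \<open>The index counts by how many units the eigenvalue of \<open>D\<close> has dropped.\<close>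

inductive lowered :: "'v \<Rightarrow> nat \<Rightarrow> 'v \<Rightarrow> bool" for v where
  start: "lowered v 0 v"
| lower: "lowered v j u \<Longrightarrow> d \<ge> 1 \<Longrightarrow> x \<in> G d \<Longrightarrow> lowered v (j + d) (act M x u)"

inductive_set generated :: "'v \<Rightarrow> 'v set" for v where
  lowered: "lowered v j u \<Longrightarrow> u \<in> generated v"
| zero: "\<zero>\<^bsub>M\<^esub> \<in> generated v"
| add: "u \<in> generated v \<Longrightarrow> u' \<in> generated v \<Longrightarrow> u \<oplus>\<^bsub>M\<^esub> u' \<in> generated v"
| scale: "u \<in> generated v \<Longrightarrow> c \<odot>\<^bsub>M\<^esub> u \<in> generated v"

context
  fixes v assumes v: "eigenvector_on U M v"
begin

lemma v_in [simp]: "v \<in> carrier M" and v_nz: "v \<noteq> \<zero>\<^bsub>M\<^esub>"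
  using v by (auto simp: eigenvector_on_def)

lemma lowered_in: "lowered v j u \<Longrightarrow> u \<in> carrier M"
  by (induction rule: lowered.induct) (use G_sub in auto)

lemma generated_in: "u \<in> generated v \<Longrightarrow> u \<in> carrier M"
  by (induction rule: generated.induct) (auto intro: lowered_in)

lemma generated_lower:
  assumes "u \<in> generated v" "d \<ge> 1" "x \<in> G d"
  shows "act M x u \<in> generated v"
  using assms(1)
proof (induction rule: generated.induct)
  case (lowered j u)
  show ?case by (rule generated.lowered[OF lowered.lower[OF lowered assms(2,3)]])
next
  case zero
  show ?case using G_sub[OF assms(2)] assms(3) by (simp add: subset_iff generated.zero)
next
  case (add u u')
  then show ?case using G_sub[OF assms(2)] assms(3)
    by (simp add: subset_iff act_add generated_in generated.add)
next
  case (scale u c)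
  then show ?case using G_sub[OF assms(2)] assms(3)
    by (simp add: subset_iff act_scale generated_in generated.scale)
qed

lemma start_generated: "v \<in> generated v"
  by (rule generated.lowered[OF lowered.start])

text \<open>An upper element multiplies \<open>v\<close> by a scalar and a lowering operator keeps it in the span; the
decomposition of \<open>L\<close> gives the rest.\<close>

lemma act_start:
  assumes "x \<in> carrier L"
  shows "act M x v \<in> generated v"
proof -
  have "x \<in> carrier L \<and> act M x v \<in> generated v"
    if "x \<in> additive_span L (U \<union> (\<Union>d\<in>{1..}. G d))" for x
    using that
  proof (induction rule: additive_span.induct)
    case (base x)
    then consider "x \<in> U" | d where "d \<ge> 1" "x \<in> G d" by auto
    then show ?case
    proof cases
      case 1
      then obtain c where "act M x v = c \<odot>\<^bsub>M\<^esub> v" using v by (auto simp: eigenvector_on_def)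
      then show ?thesis using 1 U_sub by (auto intro: generated.scale start_generated)
    next
      case 2
      then show ?thesis using G_sub[OF 2(1)] generated_lower[OF start_generated 2] by auto
    qed
  next
    case (add x y)
    then show ?case by (auto simp: add_act add_closed intro: generated.add)
  qed
  then show ?thesis using assms decomposition by blast
qed

text \<open>For \<open>y \<in> G d\<close>, an element \<open>x\<close> is moved past \<open>y\<close> by \<open>x y u = [x, y] u + y (x u)\<close>. Both terms are covered
by the induction hypothesis for \<open>u\<close>, provided that it is stated for all elements of \<open>L\<close> at once, so that
it applies to \<open>[x, y]\<close> as well as to \<open>x\<close>.\<close>

lemma generated_act:
  assumes "x \<in> carrier L" "u \<in> generated v"
  shows "act M x u \<in> generated v"
proof -
  have low: "act M x u \<in> generated v" if "lowered v j u" "x \<in> carrier L" for j u x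
    using that
  proof (induction arbitrary: x rule: lowered.induct)
    case start
    then show ?case by (rule act_start)
  next
    case (lower j u d y)
    then have y: "y \<in> carrier L" using G_sub[of d] by auto
    with lower have "act M x (act M y u) = act M (lbr L x y) u \<oplus>\<^bsub>M\<^esub> act M y (act M x u)"
      by (intro act_swap lbr_closed) (auto intro: lowered_in)
    moreover have "act M (lbr L x y) u \<in> generated v" "act M y (act M x u) \<in> generated v"
      using lower y lbr_closed[of x y] generated_lower[of "act M x u" d y] by auto
    ultimately show ?case by (simp add: generated.add)
  qed
  show ?thesis
    using assms(2)
  proof (induction rule: generated.induct)
    case (lowered j u)
    then show ?case using low assms by blast
  next
    case zero
    then show ?case using assms by (auto intro: generated.zero)
  next
    case (add u u')
    then show ?case using assms by (subst act_add) (auto intro: generated.add generated_in)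
  next
    case (scale u c)
    then show ?case using assms by (subst act_scale) (auto intro: generated.scale generated_in)
  qed
qed

lemma generated_eq: "generated v = carrier M"
proof (rule simple_eqI)
  show "lie_submodule L (generated v) M"
    by (intro lie_submoduleI)
       (auto intro: generated_in generated.zero generated.add generated.scale generated_act)
  show "v \<in> generated v" by (rule start_generated)
qed (fact v_nz)

lemma lowered_eigen:
  assumes "act M D v = a \<odot>\<^bsub>M\<^esub> v" "lowered v j u"
  shows "act M D u = (a - of_nat j) \<odot>\<^bsub>M\<^esub> u"
  using assms(2)
proof (induction rule: lowered.induct)
  case start
  then show ?case using assms(1) by simp
next
  case (lower j u d x)
  have D: "D \<in> carrier L" using D_in U_sub by auto
  have x: "x \<in> carrier L" using lower G_sub[of d] by auto
  have u: "u \<in> carrier M" using lower lowered_in by auto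
  have "act M D (act M x u) = act M (lbr L D x) u \<oplus>\<^bsub>M\<^esub> act M x (act M D u)"
    using D x u by (intro act_swap lbr_closed) auto
  also have "\<dots> = (- of_nat d) \<odot>\<^bsub>M\<^esub> act M x u \<oplus>\<^bsub>M\<^esub> (a - of_nat j) \<odot>\<^bsub>M\<^esub> act M x u"
    using lower x u by (simp add: lbr_D scale_act act_scale)
  also have "\<dots> = (- of_nat d + (a - of_nat j)) \<odot>\<^bsub>M\<^esub> act M x u"
    using x u by (simp only: scale_add_left act_closed)
  finally show ?case by (simp add: algebra_simps)
qed

text \<open>The product of the operators \<open>D - (a - i)\<close> for \<open>1 \<le> i \<le> n\<close>. If \<open>v\<close> has eigenvalue \<open>a\<close>, then it kills
the vectors that lie \<open>1, \<dots>, n\<close> steps below \<open>v\<close> and multiplies \<open>v\<close> by a nonzero scalar.\<close>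

primrec remove_lower :: "'a \<Rightarrow> nat \<Rightarrow> 'v \<Rightarrow> 'v" where
  "remove_lower a 0 u = u"
| "remove_lower a (Suc n) u =
     act M D (remove_lower a n u) \<oplus>\<^bsub>M\<^esub> (of_nat (Suc n) - a) \<odot>\<^bsub>M\<^esub> remove_lower a n u"

lemma remove_lower_in [simp]: "u \<in> carrier M \<Longrightarrow> remove_lower a n u \<in> carrier M"
  by (induction n) (use D_in U_sub in auto)

lemma remove_lower_add:
  "u \<in> carrier M \<Longrightarrow> u' \<in> carrier M \<Longrightarrow>
     remove_lower a n (u \<oplus>\<^bsub>M\<^esub> u') = remove_lower a n u \<oplus>\<^bsub>M\<^esub> remove_lower a n u'"
proof (induction n)
  case (Suc n)
  have D: "D \<in> carrier L" using D_in U_sub by auto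
  show ?case using Suc D by (simp add: act_add scale_add_right a_ac del: of_nat_Suc)
qed simp

lemma remove_lower_scale:
  "u \<in> carrier M \<Longrightarrow> remove_lower a n (c \<odot>\<^bsub>M\<^esub> u) = c \<odot>\<^bsub>M\<^esub> remove_lower a n u"
proof (induction n)
  case (Suc n)
  have D: "D \<in> carrier L" using D_in U_sub by auto
  show ?case using Suc D by (simp add: act_scale scale_add_right mult.commute del: of_nat_Suc)
qed simp

lemma remove_lower_eigen:
  assumes "u \<in> carrier M" "act M D u = b \<odot>\<^bsub>M\<^esub> u"
  shows "remove_lower a n u = (\<Prod>i=1..n. b - a + of_nat i) \<odot>\<^bsub>M\<^esub> u"
proof (induction n)
  case (Suc n)
  have D: "D \<in> carrier L" using D_in U_sub by auto
  let ?p = "\<Prod>i=1..n. b - a + of_nat i"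
  have "remove_lower a (Suc n) u =
          (?p * b) \<odot>\<^bsub>M\<^esub> u \<oplus>\<^bsub>M\<^esub> ((of_nat (Suc n) - a) * ?p) \<odot>\<^bsub>M\<^esub> u"
    using assms D by (simp add: Suc act_scale del: of_nat_Suc)
  also have "\<dots> = (?p * b + (of_nat (Suc n) - a) * ?p) \<odot>\<^bsub>M\<^esub> u"
    using assms by (simp only: scale_add_left)
  also have "?p * b + (of_nat (Suc n) - a) * ?p = (\<Prod>i=1..Suc n. b - a + of_nat i)"
    by (simp add: algebra_simps)
  finally show ?case .
qed (use assms in simp)

text \<open>Every vector of the module is a combination of finitely many lowered vectors, hence a long enough
product removes all components but the one along \<open>v\<close>.\<close>

lemma remove_lower_generated:
  assumes "act M D v = a \<odot>\<^bsub>M\<^esub> v" "u \<in> generated v"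
  shows "\<exists>n0. \<forall>n\<ge>n0. \<exists>c. remove_lower a n u = c \<odot>\<^bsub>M\<^esub> v"
  using assms(2)
proof (induction rule: generated.induct)
  case (lowered j u)
  have u: "u \<in> carrier M" using lowered lowered_in by auto
  show ?case
  proof (cases "j = 0")
    case True
    have "u = v" using lowered True by (cases rule: lowered.cases) auto
    then show ?thesis using remove_lower_eigen[OF u lowered_eigen[OF assms(1) lowered]] by auto
  next
    case False
    have "remove_lower a n u = 0 \<odot>\<^bsub>M\<^esub> v" if "n \<ge> j" for n
    proof -
      have "(\<Prod>i=1..n. (a - of_nat j) - a + of_nat i) = (0::'a)"
        using that False by (intro prod_zero) (auto intro!: bexI[of _ j])
      then show ?thesis
        by (simp only: remove_lower_eigen[OF u lowered_eigen[OF assms(1) lowered]]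
              scale_zero_left[OF u] scale_zero_left[OF v_in])
    qed
    then show ?thesis by blast
  qed
next
  case zero
  have "remove_lower a n \<zero>\<^bsub>M\<^esub> = 0 \<odot>\<^bsub>M\<^esub> v" for n
    using remove_lower_scale[of "\<zero>\<^bsub>M\<^esub>" a n 0] by simp
  then show ?case by blast
next
  case (add u u')
  then obtain n0 n1 where "\<forall>n\<ge>n0. \<exists>c. remove_lower a n u = c \<odot>\<^bsub>M\<^esub> v"
    "\<forall>n\<ge>n1. \<exists>c. remove_lower a n u' = c \<odot>\<^bsub>M\<^esub> v" by blast
  then have "\<exists>c. remove_lower a n (u \<oplus>\<^bsub>M\<^esub> u') = c \<odot>\<^bsub>M\<^esub> v" if "n \<ge> max n0 n1" for n
    using that add by (metis generated_in remove_lower_add scale_add_left v_in max.bounded_iff)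
  then show ?case by blast
next
  case (scale u c)
  then show ?case by (metis generated_in remove_lower_scale scale_scale v_in)
qed

text \<open>On an eigenvector \<open>w\<close> the product acts by a scalar. If that scalar vanishes, then the eigenvalue of \<open>w\<close>
is one of the \<open>a - j\<close>; otherwise \<open>w\<close> can be recovered from a multiple of \<open>v\<close>.\<close>

lemma eigenvalue_or_multiple:
  assumes "act M D v = a \<odot>\<^bsub>M\<^esub> v" "w \<in> carrier M" "act M D w = b \<odot>\<^bsub>M\<^esub> w"
  shows "(\<exists>j\<ge>1. b = a - of_nat j) \<or> (\<exists>c. w = c \<odot>\<^bsub>M\<^esub> v)"
proof -
  obtain n c where nc: "remove_lower a n w = c \<odot>\<^bsub>M\<^esub> v"
    using remove_lower_generated[OF assms(1)] generated_eq assms(2) by blast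
  let ?p = "\<Prod>i=1..n. b - a + of_nat i"
  have p: "?p \<odot>\<^bsub>M\<^esub> w = c \<odot>\<^bsub>M\<^esub> v" using nc remove_lower_eigen[OF assms(2,3)] by simp
  show ?thesis
  proof (cases "?p = 0")
    case True
    then obtain i where "i \<ge> 1" "b - a + of_nat i = 0" by auto
    then have "b = a - of_nat i" by (simp add: algebra_simps)
    with \<open>i \<ge> 1\<close> show ?thesis by blast
  next
    case False
    have "w = inverse ?p \<odot>\<^bsub>M\<^esub> (?p \<odot>\<^bsub>M\<^esub> w)" using assms False by simp
    then show ?thesis unfolding p by auto
  qed
qed

end

text \<open>If \<open>v\<close> and \<open>w\<close> were not proportional, each would have an eigenvalue for \<open>D\<close> that lies strictly below
the other one by a positive integer, which is absurd in characteristic \<open>0\<close>.\<close>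

theorem eigenvector_on_unique:
  assumes v: "eigenvector_on U M v" and w: "eigenvector_on U M w"
  shows "\<exists>c. c \<noteq> 0 \<and> w = c \<odot>\<^bsub>M\<^esub> v"
proof -
  have vw: "v \<in> carrier M" "w \<in> carrier M" "v \<noteq> \<zero>\<^bsub>M\<^esub>" "w \<noteq> \<zero>\<^bsub>M\<^esub>"
    using v w by (auto simp: eigenvector_on_def)
  obtain a b where ab: "act M D v = a \<odot>\<^bsub>M\<^esub> v" "act M D w = b \<odot>\<^bsub>M\<^esub> w"
    using v w D_in unfolding eigenvector_on_def by blast
  have "\<exists>c. w = c \<odot>\<^bsub>M\<^esub> v"
  proof (rule ccontr)
    assume nm: "\<nexists>c. w = c \<odot>\<^bsub>M\<^esub> v"
    then obtain i where i: "i \<ge> 1" "b = a - of_nat i"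
      using eigenvalue_or_multiple[OF v ab(1) vw(2) ab(2)] by blast
    consider j where "j \<ge> 1" "a = b - of_nat j" | c where "v = c \<odot>\<^bsub>M\<^esub> w"
      using eigenvalue_or_multiple[OF w ab(2) vw(1) ab(1)] by blast
    then show False
    proof cases
      case 1
      have "of_nat (i + j) = (a - b) + (b - a)" using 1 i by simp
      then have "of_nat (i + j) = (0::'a)" by simp
      then have "i + j = 0" by (simp only: of_nat_eq_0_iff)
      then show False using i by simp
    next
      case 2
      then have "c \<noteq> 0" using vw by auto
      then have "w = inverse c \<odot>\<^bsub>M\<^esub> v" using 2 vw by simp
      then show False using nm by blast
    qed
  qed
  then obtain c where "w = c \<odot>\<^bsub>M\<^esub> v" by blast
  moreover from this have "c \<noteq> 0" using vw by auto
  ultimately show ?thesis by blast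
qed

end

lemma eigenvector_on_image:
  assumes "f \<in> lie_hom L M N" "U \<subseteq> carrier L" "eigenvector_on U M v" "f v \<noteq> \<zero>\<^bsub>N\<^esub>"
  shows "eigenvector_on U N (f v)"
  unfolding eigenvector_on_def
proof (intro conjI ballI)
  note f = lie_hom_facts[OF assms(1)]
  have v: "v \<in> carrier M" using assms(3) by (simp add: eigenvector_on_def)
  then show "f v \<in> carrier N" by (rule f)
  fix x assume x: "x \<in> U"
  then obtain c where "act M x v = c \<odot>\<^bsub>M\<^esub> v" using assms(3) by (auto simp: eigenvector_on_def)
  then have "act N x (f v) = c \<odot>\<^bsub>N\<^esub> f v" using f(5)[OF v, of c] f(6)[of x v] x assms(2) v by auto
  then show "\<exists>c. act N x (f v) = c \<odot>\<^bsub>N\<^esub> f v" ..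
qed (fact assms(4))

text \<open>Schur's lemma without a search for an eigenvalue: \<open>f v\<close> and \<open>g v\<close> are proportional by
\<open>eigenvector_on_unique\<close>, and the vectors where \<open>g = c f\<close> form a submodule.\<close>

lemma (in triangular) lie_hom_proportional:
  assumes M: "lie_simple L M" and N: "lie_simple L N"
    and f: "f \<in> lie_hom L M N" and g: "g \<in> lie_hom L M N"
    and v: "eigenvector_on U M v" and fv: "f v \<noteq> \<zero>\<^bsub>N\<^esub>"
  shows "\<exists>c. \<forall>u\<in>carrier M. g u = c \<odot>\<^bsub>N\<^esub> f u"
proof -
  interpret M: simple_lie_rep L M using M by (rule simple_lie_repI)
  interpret N: simple_lie_rep L N using N by (rule simple_lie_repI)
  interpret N: hw_rep L D U G N by intro_locales
  note f' = lie_hom_facts[OF f] and g' = lie_hom_facts[OF g]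
  have v': "v \<in> carrier M" "v \<noteq> \<zero>\<^bsub>M\<^esub>" using v by (auto simp: eigenvector_on_def)
  have efv: "eigenvector_on U N (f v)" using eigenvector_on_image[OF f U_sub v fv] .
  have "\<exists>c. g v = c \<odot>\<^bsub>N\<^esub> f v"
  proof (cases "g v = \<zero>\<^bsub>N\<^esub>")
    case True
    then have "g v = 0 \<odot>\<^bsub>N\<^esub> f v" using f' v' by simp
    then show ?thesis ..
  next
    case False
    then show ?thesis
      using N.eigenvector_on_unique[OF efv eigenvector_on_image[OF g U_sub v False]] by blast
  qed
  then obtain c where c: "g v = c \<odot>\<^bsub>N\<^esub> f v" ..
  let ?W = "{u \<in> carrier M. g u = c \<odot>\<^bsub>N\<^esub> f u}"
  have "lie_submodule L ?W M"
    by (rule M.lie_submoduleI)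
       (auto simp: f' g' N.scale_add_right N.act_scale mult.commute)
  then have "?W = carrier M" using c v' by (intro M.simple_eqI) auto
  then show ?thesis by blast
qed

section \<open>Matrix Lie algebras in a basis adapted to a Borel subalgebra\<close>

definition subdiagonal :: "nat \<Rightarrow> 'a::zero mat \<Rightarrow> 'a mat" where
  "subdiagonal d T = mat (dim_row T) (dim_col T) (\<lambda>(i, j). if i = j + d then T $$ (i, j) else 0)"

text \<open>The matrix \<open>diag((m-1)/2, (m-3)/2, \<dots>, -(m-1)/2)\<close>. Its entries decrease in steps of \<open>1\<close>, so that its
adjoint action multiplies a matrix on the \<open>d\<close>-th subdiagonal by \<open>-d\<close>; they have sum \<open>0\<close> and are
antisymmetric under \<open>i \<mapsto> m - 1 - i\<close>, so that it belongs to all classical algebras in coordinates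
with respect to \<^const>\<open>borel_basis\<close>.\<close>

definition half_sum_diag :: "nat \<Rightarrow> 'a::field_char_0 mat" where
  "half_sum_diag m = mat_diag m (\<lambda>i. of_nat (m - 1) / 2 - of_nat i)"

lemma mult_inverse_left:
  fixes B B' X :: "'a::semiring_1 mat"
  assumes "B \<in> carrier_mat m m" "B' \<in> carrier_mat m m" "X \<in> carrier_mat m k" "B * B' = 1\<^sub>m m"
  shows "B * (B' * X) = X"
  using assoc_mult_mat[OF assms(1-3)] assms(3,4) by simp

text \<open>\<open>R\<close> is a Lie algebra of matrices in coordinates with respect to the columns of \<open>B\<close>, and \<open>B'\<close> is the
inverse of \<open>B\<close>. The conditions on subdiagonals say that \<open>R\<close> is graded by the distance from the
diagonal, as far as the strictly lower part is concerned.\<close>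

locale graded_matrices =
  fixes m :: nat and B B' :: "'a::field_char_0 mat" and R :: "'a mat set"
  assumes B: "B \<in> carrier_mat m m" and B': "B' \<in> carrier_mat m m"
    and BB': "B * B' = 1\<^sub>m m" and B'B: "B' * B = 1\<^sub>m m"
    and R_sub: "R \<subseteq> carrier_mat m m"
    and R_add: "S \<in> R \<Longrightarrow> T \<in> R \<Longrightarrow> S + T \<in> R"
    and R_scale: "T \<in> R \<Longrightarrow> c \<cdot>\<^sub>m T \<in> R"
    and R_lbr: "S \<in> R \<Longrightarrow> T \<in> R \<Longrightarrow> S * T - T * S \<in> R"
    and R_subdiagonal: "T \<in> R \<Longrightarrow> d \<ge> 1 \<Longrightarrow> subdiagonal d T \<in> R"
    and R_half_sum: "half_sum_diag m \<in> R"
begin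

definition from_basis :: "'a mat \<Rightarrow> 'a mat" where "from_basis T = B * T * B'"

lemma from_basis_carrier [simp]: "T \<in> carrier_mat m m \<Longrightarrow> from_basis T \<in> carrier_mat m m"
  using B B' by (simp add: from_basis_def)

lemma from_basis_add:
  assumes "S \<in> carrier_mat m m" "T \<in> carrier_mat m m"
  shows "from_basis (S + T) = from_basis S + from_basis T"
proof -
  have "B * (S + T) = B * S + B * T" by (rule mult_add_distrib_mat[OF B assms])
  then show ?thesis
    unfolding from_basis_def
    using add_mult_distrib_mat[of "B * S" m m "B * T" B' m] B B' assms by simp
qed

lemma from_basis_minus:
  assumes "S \<in> carrier_mat m m" "T \<in> carrier_mat m m"
  shows "from_basis (S - T) = from_basis S - from_basis T"
proof -
  have "B * (S - T) = B * S - B * T" by (rule mult_minus_distrib_mat[OF B assms])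
  then show ?thesis
    unfolding from_basis_def
    using minus_mult_distrib_mat[of "B * S" m m "B * T" B' m] B B' assms by simp
qed

lemma from_basis_scale:
  assumes "T \<in> carrier_mat m m"
  shows "from_basis (c \<cdot>\<^sub>m T) = c \<cdot>\<^sub>m from_basis T"
proof -
  have "B * (c \<cdot>\<^sub>m T) = c \<cdot>\<^sub>m (B * T)" by (rule mult_smult_distrib[OF B assms])
  then show ?thesis
    unfolding from_basis_def
    using mult_smult_assoc_mat[of "B * T" m m B' m c] B B' assms by simp
qed

lemma from_basis_mult:
  assumes "S \<in> carrier_mat m m" "T \<in> carrier_mat m m"
  shows "from_basis S * from_basis T = from_basis (S * T)"
proof -
  have "from_basis S * from_basis T = B * (S * (B' * (B * (T * B'))))"
    using B B' assms by (simp add: from_basis_def assoc_mult_mat[of _ m m _ m _ m])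
  also have "B' * (B * (T * B')) = T * B'"
    using B B' B'B assms by (intro mult_inverse_left[of _ m]) auto
  finally show ?thesis
    using B B' assms by (simp add: from_basis_def assoc_mult_mat[of _ m m _ m _ m])
qed

lemma from_basis_mult_basis:
  assumes "T \<in> carrier_mat m m"
  shows "from_basis T * B = B * T"
  using B B' B'B assms by (simp add: from_basis_def assoc_mult_mat[of _ m m _ m _ m])

lemma from_basis_unique:
  assumes "A \<in> carrier_mat m m" "T \<in> carrier_mat m m" "A * B = B * T"
  shows "A = from_basis T"
proof -
  have "from_basis T = A * B * B'" by (simp add: from_basis_def assms)
  also have "\<dots> = A * (B * B')" by (rule assoc_mult_mat[OF assms(1) B B'])
  also have "\<dots> = A" using BB' assms by simp
  finally show ?thesis ..
qed

definition lie :: "('a, 'a mat) lie_alg" where "lie = matrix_lie m (from_basis ` R)"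

definition upper :: "'a mat set" where
  "upper = {A \<in> carrier lie. \<exists>T\<in>carrier_mat m m. A * B = B * T \<and> upper_triangular T}"

definition lower :: "nat \<Rightarrow> 'a mat set" where
  "lower d = from_basis ` {T \<in> R. \<forall>i<m. \<forall>j<m. i \<noteq> j + d \<longrightarrow> T $$ (i, j) = 0}"

lemma from_basis_upper:
  assumes "T \<in> R" "upper_triangular T"
  shows "from_basis T \<in> upper"
  using assms R_sub from_basis_mult_basis[of T]
  by (auto simp: upper_def lie_def matrix_lie_def)

text \<open>Subdiagonals are split off one after the other, starting with the lowest one, until an upper
triangular matrix remains.\<close>

lemma from_basis_in_span:
  assumes "T \<in> R" "\<And>i j. i < m \<Longrightarrow> j < m \<Longrightarrow> j + d < i \<Longrightarrow> T $$ (i, j) = 0"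
  shows "from_basis T \<in> additive_span lie (upper \<union> (\<Union>d\<in>{1..}. lower d))"
  using assms
proof (induction d arbitrary: T)
  case 0
  then have "upper_triangular T" using R_sub by (intro upper_triangularI) auto
  then show ?case using 0 by (intro additive_span.base UnI1 from_basis_upper)
next
  case (Suc d)
  let ?S = "subdiagonal (Suc d) T"
  have T: "T \<in> carrier_mat m m" and S: "?S \<in> carrier_mat m m"
    using Suc.prems(1) R_sub by (auto simp: subdiagonal_def)
  have SR: "?S \<in> R" using Suc.prems(1) by (intro R_subdiagonal) auto
  have TS: "T - ?S \<in> R"
  proof -
    have "T - ?S = T + (- 1) \<cdot>\<^sub>m ?S" using T S by (intro eq_matI) auto
    then show ?thesis using Suc.prems(1) SR by (simp add: R_add R_scale)
  qed
  have "from_basis (T - ?S) \<in> additive_span lie (upper \<union> (\<Union>d\<in>{1..}. lower d))"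
  proof (rule Suc.IH[OF TS])
    fix i j assume ij: "i < m" "j < m" "j + d < i"
    then show "(T - ?S) $$ (i, j) = 0"
      using Suc.prems(2)[of i j] T by (cases "i = j + Suc d") (auto simp: subdiagonal_def)
  qed
  moreover have "from_basis ?S \<in> lower (Suc d)"
    unfolding lower_def by (rule imageI) (use SR T in \<open>auto simp: subdiagonal_def\<close>)
  ultimately have "from_basis (T - ?S) \<oplus>\<^bsub>lie\<^esub> from_basis ?S
      \<in> additive_span lie (upper \<union> (\<Union>d\<in>{1..}. lower d))"
    by (intro additive_span.add additive_span.base[of "from_basis ?S"]) auto
  also have "from_basis (T - ?S) \<oplus>\<^bsub>lie\<^esub> from_basis ?S = from_basis (T - ?S + ?S)"
    using S T from_basis_add[OF minus_carrier_mat[OF S] S, of T] by (simp add: lie_def matrix_lie_def)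
  also have "T - ?S + ?S = T" using S T by (intro eq_matI) auto
  finally show ?case .
qed

lemma half_sum_commutator:
  assumes "T \<in> carrier_mat m m" "\<And>i j. i < m \<Longrightarrow> j < m \<Longrightarrow> i \<noteq> j + d \<Longrightarrow> T $$ (i, j) = 0"
  shows "half_sum_diag m * T - T * half_sum_diag m = (- of_nat d) \<cdot>\<^sub>m T"
proof -
  have "half_sum_diag m * T - T * half_sum_diag m =
      mat m m (\<lambda>(i, j). (of_nat j - of_nat i) * T $$ (i, j))"
    unfolding half_sum_diag_def mat_diag_mult_left[OF assms(1)] mat_diag_mult_right[OF assms(1)]
    by (intro eq_matI) (auto simp: algebra_simps)
  also have "\<dots> = (- of_nat d) \<cdot>\<^sub>m T"
  proof (rule eq_matI)
    fix i j assume "i < dim_row ((- of_nat d) \<cdot>\<^sub>m T)" "j < dim_col ((- of_nat d) \<cdot>\<^sub>m T)"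
    then have ij: "i < m" "j < m" using assms(1) by auto
    then show "mat m m (\<lambda>(i, j). (of_nat j - of_nat i) * T $$ (i, j)) $$ (i, j) =
        ((- of_nat d) \<cdot>\<^sub>m T) $$ (i, j)"
      using assms(1) assms(2)[OF ij] by (cases "i = j + d") auto
  qed (use assms(1) in auto)
  finally show ?thesis .
qed

sublocale triangular lie "from_basis (half_sum_diag m)" upper lower
proof
  have "upper_triangular (half_sum_diag m :: 'a mat)"
    by (intro upper_triangularI) (auto simp: half_sum_diag_def mat_diag_def)
  then show "from_basis (half_sum_diag m) \<in> upper" by (rule from_basis_upper[OF R_half_sum])
  show "upper \<subseteq> carrier lie" by (auto simp: upper_def)
  show "lower d \<subseteq> carrier lie" for d by (auto simp: lower_def lie_def matrix_lie_def)
  show "lbr lie x y \<in> carrier lie" if "x \<in> carrier lie" "y \<in> carrier lie" for x y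
  proof -
    obtain S T where ST: "S \<in> R" "T \<in> R" "x = from_basis S" "y = from_basis T"
      using \<open>x \<in> carrier lie\<close> \<open>y \<in> carrier lie\<close> by (auto simp: lie_def matrix_lie_def)
    then have c: "S \<in> carrier_mat m m" "T \<in> carrier_mat m m" using R_sub by auto
    have "lbr lie x y = from_basis (S * T - T * S)"
      using c ST by (simp add: lie_def matrix_lie_def from_basis_mult from_basis_minus)
    then show ?thesis using R_lbr[OF ST(1,2)] by (simp add: lie_def matrix_lie_def)
  qed
  show "x \<oplus>\<^bsub>lie\<^esub> y \<in> carrier lie" if xy: "x \<in> carrier lie" "y \<in> carrier lie" for x y
  proof -
    obtain S T where ST: "S \<in> R" "T \<in> R" "x = from_basis S" "y = from_basis T"
      using xy by (auto simp: lie_def matrix_lie_def)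
    then have c: "S \<in> carrier_mat m m" "T \<in> carrier_mat m m" using R_sub by auto
    have "x \<oplus>\<^bsub>lie\<^esub> y = from_basis (S + T)"
      using c ST by (simp add: lie_def matrix_lie_def from_basis_add)
    then show ?thesis using R_add[OF ST(1,2)] by (simp add: lie_def matrix_lie_def)
  qed
  show "lbr lie (from_basis (half_sum_diag m)) x = (- of_nat d) \<odot>\<^bsub>lie\<^esub> x"
    if "1 \<le> d" "x \<in> lower d" for d x
  proof -
    obtain T where T: "T \<in> R" "x = from_basis T" "\<And>i j. i < m \<Longrightarrow> j < m \<Longrightarrow> i \<noteq> j + d \<Longrightarrow> T $$ (i, j) = 0"
      using \<open>x \<in> lower d\<close> by (auto simp: lower_def)
    have c: "T \<in> carrier_mat m m" "(half_sum_diag m :: 'a mat) \<in> carrier_mat m m"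
      using T R_sub by (auto simp: half_sum_diag_def)
    have "lbr lie (from_basis (half_sum_diag m)) x = from_basis (half_sum_diag m * T - T * half_sum_diag m)"
      using c T(2) by (simp add: lie_def matrix_lie_def from_basis_mult from_basis_minus)
    also have "\<dots> = (- of_nat d) \<odot>\<^bsub>lie\<^esub> x"
      using half_sum_commutator[of T d, OF c(1) T(3)] c T(2)
      by (simp add: lie_def matrix_lie_def from_basis_scale)
    finally show ?thesis .
  qed
  show "carrier lie \<subseteq> additive_span lie (upper \<union> (\<Union>d\<in>{1..}. lower d))"
  proof
    fix x assume "x \<in> carrier lie"
    then obtain T where "T \<in> R" "x = from_basis T" by (auto simp: lie_def matrix_lie_def)
    then show "x \<in> additive_span lie (upper \<union> (\<Union>d\<in>{1..}. lower d))"
      using from_basis_in_span[of T m] by simp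
  qed
qed

end

section \<open>Special linear algebras\<close>

lemma subdiagonal_carrier [simp]: "T \<in> carrier_mat m m \<Longrightarrow> subdiagonal d T \<in> carrier_mat m m"
  by (auto simp: subdiagonal_def)

lemma half_sum_diag_carrier [simp]: "half_sum_diag m \<in> carrier_mat m m"
  by (simp add: half_sum_diag_def)

definition borel_upper :: "classical \<Rightarrow> nat \<Rightarrow> 'a::field mat set" where
  "borel_upper K m = {A \<in> carrier (classical_alg K m).
     \<exists>T\<in>carrier_mat m m. A * borel_basis K m = borel_basis K m * T \<and> upper_triangular T}"

definition traceless :: "nat \<Rightarrow> 'a::field mat set" where
  "traceless m = {T \<in> carrier_mat m m. (\<Sum>i<m. T $$ (i, i)) = 0}"

lemma trace_mult_commute:
  fixes S T :: "'a::comm_ring_1 mat"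
  assumes "S \<in> carrier_mat m m" "T \<in> carrier_mat m m"
  shows "(\<Sum>i<m. (S * T) $$ (i, i)) = (\<Sum>i<m. (T * S) $$ (i, i))"
proof -
  have "(\<Sum>i<m. (S * T) $$ (i, i)) = (\<Sum>i<m. \<Sum>k<m. S $$ (i, k) * T $$ (k, i))"
    using assms by (intro sum.cong) (auto simp: scalar_prod_def atLeast0LessThan)
  also have "\<dots> = (\<Sum>k<m. \<Sum>i<m. T $$ (k, i) * S $$ (i, k))"
    by (subst sum.swap) (simp add: mult.commute)
  also have "\<dots> = (\<Sum>k<m. (T * S) $$ (k, k))"
    using assms by (intro sum.cong) (auto simp: scalar_prod_def atLeast0LessThan)
  finally show ?thesis .
qed

lemma half_sum_trace: "(\<Sum>i<m. of_nat (m - 1) / 2 - of_nat i) = (0::'a::field_char_0)"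
proof -
  have "2 * (\<Sum>i<m. of_nat i) = (of_nat m * of_nat (m - 1) :: 'a)"
  proof (induction m)
    case (Suc m)
    then show ?case by (cases m) (auto simp: algebra_simps)
  qed simp
  then have "(\<Sum>i<m. of_nat i) = (of_nat m * of_nat (m - 1) / 2 :: 'a)"
    by (metis mult.commute nonzero_mult_div_cancel_right zero_neq_numeral)
  then show ?thesis
    by (simp only: sum_subtractf sum_constant card_lessThan times_divide_eq_right diff_self)
qed

lemma graded_traceless: "graded_matrices m (1\<^sub>m m) (1\<^sub>m m) (traceless m :: 'a::field_char_0 mat set)"
proof
  fix S T :: "'a mat" and c :: 'a and d :: nat
  assume T: "T \<in> traceless m"
  then have Tc: "T \<in> carrier_mat m m" by (simp add: traceless_def)
  have "(\<Sum>i<m. (c \<cdot>\<^sub>m T) $$ (i, i)) = c * (\<Sum>i<m. T $$ (i, i))"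
    using Tc by (simp add: sum_distrib_left)
  then show "c \<cdot>\<^sub>m T \<in> traceless m" using T by (simp add: traceless_def)
  show "subdiagonal d T \<in> traceless m" if "d \<ge> 1"
    using that Tc by (auto simp: traceless_def subdiagonal_def)
  assume S: "S \<in> traceless m"
  then have Sc: "S \<in> carrier_mat m m" by (simp add: traceless_def)
  show "S + T \<in> traceless m" using S T Sc Tc by (simp add: traceless_def sum.distrib)
  have "(\<Sum>i<m. (S * T - T * S) $$ (i, i)) = (\<Sum>i<m. (S * T) $$ (i, i)) - (\<Sum>i<m. (T * S) $$ (i, i))"
    using Sc Tc by (simp add: sum_subtractf del: index_mult_mat(1))
  then have "(\<Sum>i<m. (S * T - T * S) $$ (i, i)) = 0"
    using trace_mult_commute[OF Sc Tc] by simp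
  moreover have "S * T - T * S \<in> carrier_mat m m"
    using Sc Tc by (intro minus_carrier_mat mult_carrier_mat)
  ultimately show "S * T - T * S \<in> traceless m"
    by (simp only: traceless_def mem_Collect_eq)
next
  have "(\<Sum>i<m. half_sum_diag m $$ (i, i)) = (\<Sum>i<m. of_nat (m - 1) / 2 - of_nat i :: 'a)"
    by (intro sum.cong) (auto simp: half_sum_diag_def mat_diag_def)
  then show "half_sum_diag m \<in> (traceless m :: 'a mat set)"
    using half_sum_trace[of m, where 'a='a] by (simp add: traceless_def)
qed (auto simp: traceless_def)

lemma sl_triangular:
  "\<exists>D G. triangular (classical_alg SL m :: ('a::field_char_0, 'a mat) lie_alg) D (borel_upper SL m) G"
proof -
  interpret graded_matrices m "1\<^sub>m m" "1\<^sub>m m" "traceless m :: 'a mat set"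
    by (rule graded_traceless)
  have "from_basis T = T" if "T \<in> traceless m" for T
    using that R_sub by (auto simp: from_basis_def)
  then have "from_basis ` traceless m = (\<lambda>T. T) ` traceless m" by (intro image_cong refl)
  then have img: "from_basis ` traceless m = traceless m" by simp
  have lie: "lie = classical_alg SL m" unfolding lie_def img by (simp add: traceless_def)
  have upper: "upper = borel_upper SL m" by (simp only: upper_def borel_upper_def lie borel_basis.simps)
  show ?thesis using triangular_axioms unfolding lie upper by blast
qed

lemma sl_cartan:
  assumes "(\<Sum>i<m. t i) = (0::'a::field)"
  shows "\<exists>A\<in>carrier (classical_alg SL m). A * borel_basis SL m = borel_basis SL m * mat_diag m t"
proof -
  have "(\<Sum>i<m. mat_diag m t $$ (i, i)) = (\<Sum>i<m. t i)"
    by (intro sum.cong) (auto simp: mat_diag_def)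
  then have "mat_diag m t \<in> carrier (classical_alg SL m)"
    using assms by (simp add: matrix_lie_def)
  moreover have "mat_diag m t * borel_basis SL m = borel_basis SL m * mat_diag m t"
    using mat_diag_dim[of m t] by (simp del: mat_diag_dim)
  ultimately show ?thesis by blast
qed

section \<open>Lie algebras that preserve a bilinear form\<close>

definition form_matrices :: "nat \<Rightarrow> 'a::field mat \<Rightarrow> 'a mat set" where
  "form_matrices m G = {T \<in> carrier_mat m m. transpose_mat T * G + G * T = 0\<^sub>m m m}"

lemma form_matrices_sum_iff:
  assumes "G \<in> carrier_mat m m" "T \<in> carrier_mat m m"
  shows "T \<in> form_matrices m G \<longleftrightarrow>
    (\<forall>i<m. \<forall>j<m. (\<Sum>k<m. T $$ (k, i) * G $$ (k, j) + G $$ (i, k) * T $$ (k, j)) = 0)"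
proof -
  have "(transpose_mat T * G + G * T) $$ (i, j) =
      (\<Sum>k<m. T $$ (k, i) * G $$ (k, j) + G $$ (i, k) * T $$ (k, j))" if "i < m" "j < m" for i j
    using assms that by (simp add: scalar_prod_def sum.distrib atLeast0LessThan)
  moreover have "transpose_mat T * G + G * T = 0\<^sub>m m m \<longleftrightarrow>
      (\<forall>i<m. \<forall>j<m. (transpose_mat T * G + G * T) $$ (i, j) = 0)"
    using assms by (auto simp: mat_eq_iff)
  ultimately show ?thesis using assms by (simp add: form_matrices_def)
qed

definition antidiagonal :: "nat \<Rightarrow> 'a::zero mat \<Rightarrow> bool" where
  "antidiagonal m G \<longleftrightarrow> G \<in> carrier_mat m m \<and>
     (\<forall>i<m. \<forall>j<m. G $$ (i, j) \<noteq> 0 \<longleftrightarrow> i + j = m - 1)"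

text \<open>For an antidiagonal Gram matrix \<open>G\<close> each entry of \<open>T\<^sup>t G + G T\<close> involves only two entries of \<open>T\<close>, and
these lie on the same diagonal. So the condition can be checked on each diagonal separately.\<close>

lemma form_matrices_antidiagonal_iff:
  assumes "antidiagonal m G" "T \<in> carrier_mat m m"
  shows "T \<in> form_matrices m G \<longleftrightarrow>
    (\<forall>i<m. \<forall>j<m. T $$ (m - 1 - j, i) * G $$ (m - 1 - j, j) + G $$ (i, m - 1 - i) * T $$ (m - 1 - i, j) = 0)"
proof -
  have G: "G \<in> carrier_mat m m" "\<And>i j. i < m \<Longrightarrow> j < m \<Longrightarrow> i + j \<noteq> m - 1 \<Longrightarrow> G $$ (i, j) = 0"
    using assms(1) by (auto simp: antidiagonal_def)
  have "(\<Sum>k<m. T $$ (k, i) * G $$ (k, j) + G $$ (i, k) * T $$ (k, j)) =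
      T $$ (m - 1 - j, i) * G $$ (m - 1 - j, j) + G $$ (i, m - 1 - i) * T $$ (m - 1 - i, j)"
    if ij: "i < m" "j < m" for i j
  proof -
    have "(\<Sum>k<m. T $$ (k, i) * G $$ (k, j)) = (\<Sum>k\<in>{m - 1 - j}. T $$ (k, i) * G $$ (k, j))"
      using ij G(2)[of _ j] by (intro sum.mono_neutral_right) fastforce+
    moreover have "(\<Sum>k<m. G $$ (i, k) * T $$ (k, j)) = (\<Sum>k\<in>{m - 1 - i}. G $$ (i, k) * T $$ (k, j))"
      using ij G(2)[of i] by (intro sum.mono_neutral_right) fastforce+
    ultimately show ?thesis by (simp add: sum.distrib)
  qed
  then show ?thesis using form_matrices_sum_iff[OF G(1) assms(2)] by simp
qed

lemma diag_in_form_matrices: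
  assumes G: "antidiagonal m G" and t: "\<And>i. i < m \<Longrightarrow> t i + t (m - 1 - i) = 0"
  shows "mat_diag m t \<in> form_matrices m G"
proof -
  have "mat_diag m t $$ (m - 1 - j, i) * G $$ (m - 1 - j, j) +
      G $$ (i, m - 1 - i) * mat_diag m t $$ (m - 1 - i, j) = 0" if ij: "i < m" "j < m" for i j
  proof (cases "i + j = m - 1")
    case True
    then have "m - 1 - j = i" "m - 1 - i = j" by auto
    then have "mat_diag m t $$ (m - 1 - j, i) * G $$ (m - 1 - j, j) +
        G $$ (i, m - 1 - i) * mat_diag m t $$ (m - 1 - i, j) = (t i + t (m - 1 - i)) * G $$ (i, j)"
      using ij by (simp add: mat_diag_def algebra_simps)
    then show ?thesis using t[OF ij(1)] by simp
  next
    case False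
    then have "m - 1 - j \<noteq> i" "m - 1 - i \<noteq> j" using ij by auto
    then show ?thesis using ij by (simp add: mat_diag_def)
  qed
  then show ?thesis by (simp add: form_matrices_antidiagonal_iff[OF G])
qed

lemma subdiagonal_in_form_matrices:
  assumes G: "antidiagonal m G" and T: "T \<in> form_matrices m G"
  shows "subdiagonal d T \<in> form_matrices m G"
proof -
  have Tc: "T \<in> carrier_mat m m" using T by (simp add: form_matrices_def)
  have "subdiagonal d T $$ (m - 1 - j, i) * G $$ (m - 1 - j, j) +
      G $$ (i, m - 1 - i) * subdiagonal d T $$ (m - 1 - i, j) = 0" if ij: "i < m" "j < m" for i j
  proof (cases "i + j + d = m - 1")
    case True
    then have "m - 1 - j = i + d" "m - 1 - i = j + d" by auto
    then show ?thesis
      using ij Tc T[unfolded form_matrices_antidiagonal_iff[OF G Tc], rule_format, OF ij]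
      by (simp add: subdiagonal_def)
  next
    case False
    then have "m - 1 - j \<noteq> i + d" "m - 1 - i \<noteq> j + d" using ij by auto
    then show ?thesis using ij Tc by (simp add: subdiagonal_def)
  qed
  then show ?thesis using Tc by (simp add: form_matrices_antidiagonal_iff[OF G])
qed

text \<open>Moving \<open>G\<close> to the left across a transpose produces a sign, so \<open>(X Y)\<^sup>t G = G (Y X)\<close>.\<close>

lemma form_matrices_commutator:
  assumes G: "G \<in> carrier_mat m m" and S: "S \<in> form_matrices m G" and T: "T \<in> form_matrices m G"
  shows "S * T - T * S \<in> form_matrices m G"
proof -
  have c: "S \<in> carrier_mat m m" "T \<in> carrier_mat m m"
    using S T by (auto simp: form_matrices_def)
  have skew: "transpose_mat X * G = - (G * X)" if "X \<in> form_matrices m G" for X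
  proof -
    have X: "X \<in> carrier_mat m m" "transpose_mat X * G + G * X = 0\<^sub>m m m"
      using that by (auto simp: form_matrices_def)
    have "(transpose_mat X * G) $$ (i, j) = (- (G * X)) $$ (i, j)" if "i < m" "j < m" for i j
    proof -
      have "(transpose_mat X * G + G * X) $$ (i, j) = 0" using X(2) that by simp
      then have "(transpose_mat X * G) $$ (i, j) + (G * X) $$ (i, j) = 0"
        using X(1) G that by (simp del: index_mult_mat(1))
      then have "(transpose_mat X * G) $$ (i, j) = - (G * X) $$ (i, j)"
        by (simp only: eq_neg_iff_add_eq_0)
      then show ?thesis using X(1) G that by (simp del: index_mult_mat(1))
    qed
    then show ?thesis using X(1) G by (intro eq_matI) auto
  qed
  have product: "transpose_mat (X * Y) * G = G * (Y * X)"
    if X: "X \<in> form_matrices m G" and Y: "Y \<in> form_matrices m G" for X Y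
  proof -
    have XY: "X \<in> carrier_mat m m" "Y \<in> carrier_mat m m"
      using X Y by (auto simp: form_matrices_def)
    have "transpose_mat (X * Y) * G = transpose_mat Y * (transpose_mat X * G)"
      using XY G by (simp add: transpose_mult[of X m m] assoc_mult_mat[of _ m m _ m _ m])
    also have "\<dots> = - (transpose_mat Y * (G * X))"
      unfolding skew[OF X] using XY G by simp
    also have "transpose_mat Y * (G * X) = transpose_mat Y * G * X"
      using XY G by (simp add: assoc_mult_mat[of _ m m _ m _ m])
    also have "\<dots> = - (G * (Y * X))"
      unfolding skew[OF Y] using XY G by (simp add: assoc_mult_mat[of _ m m _ m _ m])
    finally show ?thesis by simp
  qed
  have "transpose_mat (S * T - T * S) * G + G * (S * T - T * S)
      = (transpose_mat (S * T) * G - transpose_mat (T * S) * G) + (G * (S * T) - G * (T * S))"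
    using c G by (simp add: transpose_minus[of _ m m] minus_mult_distrib_mat[of _ m m _ _ m] mult_minus_distrib_mat[of _ m m _ m])
  also have "\<dots> = 0\<^sub>m m m"
    unfolding product[OF S T] product[OF T S] using c G
    by (intro eq_matI) (auto simp del: index_mult_mat(1))
  finally have "transpose_mat (S * T - T * S) * G + G * (S * T - T * S) = 0\<^sub>m m m" .
  moreover have "S * T - T * S \<in> carrier_mat m m"
    using c by (intro minus_carrier_mat mult_carrier_mat)
  ultimately show ?thesis by (simp only: form_matrices_def mem_Collect_eq)
qed

definition gram :: "'a::field mat \<Rightarrow> 'a mat \<Rightarrow> 'a mat" where
  "gram F B = transpose_mat B * F * B"

lemma gram_carrier [simp]:
  "F \<in> carrier_mat m m \<Longrightarrow> B \<in> carrier_mat m m \<Longrightarrow> gram F B \<in> carrier_mat m m"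
  by (auto simp: gram_def)

text \<open>The identity \<open>T\<^sup>t (B\<^sup>t F B) + (B\<^sup>t F B) T = B\<^sup>t (A\<^sup>t F + F A) B\<close>. For invertible \<open>B\<close> the converse is the same
statement for the inverse matrix.\<close>

lemma form_matrices_transfer:
  assumes F: "F \<in> carrier_mat m m" and B: "B \<in> carrier_mat m m"
    and A: "A \<in> form_matrices m F" and T: "T \<in> carrier_mat m m" and AB: "A * B = B * T"
  shows "T \<in> form_matrices m (gram F B)"
proof -
  have Ac: "A \<in> carrier_mat m m" and A0: "transpose_mat A * F + F * A = 0\<^sub>m m m"
    using A by (auto simp: form_matrices_def)
  have Bt: "transpose_mat B \<in> carrier_mat m m" "transpose_mat A \<in> carrier_mat m m"
    "transpose_mat T \<in> carrier_mat m m" using B Ac T by auto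
  have 1: "transpose_mat T * gram F B = transpose_mat B * (transpose_mat A * F) * B"
  proof -
    have "transpose_mat T * gram F B = (transpose_mat T * transpose_mat B) * (F * B)"
      using Bt F B by (simp add: gram_def assoc_mult_mat[of _ m m _ m _ m])
    also have "transpose_mat T * transpose_mat B = transpose_mat (A * B)"
      unfolding AB using B T by (simp add: transpose_mult[of B m m])
    also have "\<dots> = transpose_mat B * transpose_mat A"
      using B Ac by (simp add: transpose_mult[of A m m])
    finally show ?thesis using Bt F B by (simp add: assoc_mult_mat[of _ m m _ m _ m])
  qed
  have 2: "gram F B * T = transpose_mat B * (F * A) * B"
  proof -
    have "gram F B * T = transpose_mat B * F * (B * T)"
      using Bt F B T by (simp add: gram_def assoc_mult_mat[of _ m m _ m _ m])
    also have "\<dots> = transpose_mat B * (F * A) * B"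
      unfolding AB[symmetric] using Bt F B Ac by (simp add: assoc_mult_mat[of _ m m _ m _ m])
    finally show ?thesis .
  qed
  have "transpose_mat B * (transpose_mat A * F + F * A) * B =
      (transpose_mat B * (transpose_mat A * F) + transpose_mat B * (F * A)) * B"
    using mult_add_distrib_mat[OF Bt(1), of "transpose_mat A * F" m "F * A"] Bt F Ac by simp
  also have "\<dots> = transpose_mat T * gram F B + gram F B * T"
    unfolding 1 2 using Bt F Ac B by (intro add_mult_distrib_mat[of _ m m _ _ m]) auto
  finally have "transpose_mat T * gram F B + gram F B * T = transpose_mat B * 0\<^sub>m m m * B"
    unfolding A0 by simp
  then show ?thesis using Bt B T by (simp add: form_matrices_def)
qed

lemma antidiagonal_invertible:
  fixes G :: "'a::field mat"
  assumes "antidiagonal m G"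
  shows "\<exists>P\<in>carrier_mat m m. P * G = 1\<^sub>m m"
proof
  \<comment> \<open>the inverse of an antidiagonal matrix is the antidiagonal matrix of the inverse entries, transposed\<close>
  let ?P = "mat m m (\<lambda>(i, j). if i + j = m - 1 then inverse (G $$ (j, i)) else 0)"
  show "?P \<in> carrier_mat m m" by simp
  have G: "G \<in> carrier_mat m m" "\<And>i j. i < m \<Longrightarrow> j < m \<Longrightarrow> G $$ (i, j) \<noteq> 0 \<longleftrightarrow> i + j = m - 1"
    using assms by (auto simp: antidiagonal_def)
  show "?P * G = 1\<^sub>m m"
  proof (rule eq_matI)
    fix i j assume "i < dim_row (1\<^sub>m m :: 'a mat)" "j < dim_col (1\<^sub>m m :: 'a mat)"
    then have ij: "i < m" "j < m" by auto
    have "(?P * G) $$ (i, j) = (\<Sum>k<m. ?P $$ (i, k) * G $$ (k, j))"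
      using ij G(1) by (simp add: scalar_prod_def atLeast0LessThan)
    also have "\<dots> = (\<Sum>k\<in>{m - 1 - i}. ?P $$ (i, k) * G $$ (k, j))"
      using ij by (intro sum.mono_neutral_right) auto
    also have "\<dots> = (1\<^sub>m m) $$ (i, j)"
      using ij G(2)[of "m - 1 - i" j] by (cases "i = j") auto
    finally show "(?P * G) $$ (i, j) = (1\<^sub>m m) $$ (i, j)" .
  qed (use G in auto)
qed

text \<open>If the Gram matrix of a basis is antidiagonal, then its inverse, which is explicit, yields the inverse
of the basis matrix, and both the grading and the Cartan subalgebra can be read off in coordinates.\<close>

lemma form_triangular:
  fixes F B :: "'a::field_char_0 mat"
  assumes F: "F \<in> carrier_mat m m" and B: "B \<in> carrier_mat m m" and G: "antidiagonal m (gram F B)"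
  defines "L \<equiv> matrix_lie m (form_matrices m F)"
  shows "\<exists>D G. triangular L D
      {A \<in> carrier L. \<exists>T\<in>carrier_mat m m. A * B = B * T \<and> upper_triangular T} G"
    and "(\<And>i. i < m \<Longrightarrow> t i + t (m - 1 - i) = 0) \<Longrightarrow>
      \<exists>A\<in>carrier L. A * B = B * mat_diag m t"
proof -
  obtain P where P: "P \<in> carrier_mat m m" "P * gram F B = 1\<^sub>m m"
    using antidiagonal_invertible[OF G] by blast
  \<comment> \<open>the inverse of \<open>B\<close>, as \<open>P * (B\<^sup>t * F * B) = 1\<close>\<close>
  let ?B' = "P * (transpose_mat B * F)"
  have Bt: "transpose_mat B \<in> carrier_mat m m" using B by simp
  have B': "?B' \<in> carrier_mat m m" using P F Bt by auto
  have "?B' * B = P * gram F B"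
    using P F B Bt by (simp add: gram_def assoc_mult_mat[of _ m m _ m _ m])
  then have B'B: "?B' * B = 1\<^sub>m m" using P by simp
  then have BB': "B * ?B' = 1\<^sub>m m" using mat_mult_left_right_inverse[OF B' B] by simp
  let ?R = "form_matrices m (gram F B)"
  have Gc: "gram F B \<in> carrier_mat m m" using F B by simp
  interpret graded_matrices m B ?B' ?R
  proof
    fix S T c d
    assume T: "T \<in> ?R"
    then have Tc: "T \<in> carrier_mat m m" by (simp add: form_matrices_def)
    show "c \<cdot>\<^sub>m T \<in> ?R"
      using T Tc by (simp add: form_matrices_antidiagonal_iff[OF G] mult.left_commute[of _ c] mult.assoc flip: distrib_left)
    show "subdiagonal d T \<in> ?R" by (rule subdiagonal_in_form_matrices[OF G T])
    assume S: "S \<in> ?R"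
    then have Sc: "S \<in> carrier_mat m m" by (simp add: form_matrices_def)
    show "S * T - T * S \<in> ?R" by (rule form_matrices_commutator[OF Gc S T])
    have "(S + T) $$ (m - 1 - j, i) * gram F B $$ (m - 1 - j, j) +
          gram F B $$ (i, m - 1 - i) * (S + T) $$ (m - 1 - i, j) = 0" if ij: "i < m" "j < m" for i j
    proof -
      let ?f = "\<lambda>X. X $$ (m - 1 - j, i) * gram F B $$ (m - 1 - j, j) +
          gram F B $$ (i, m - 1 - i) * X $$ (m - 1 - i, j)"
      have "?f (S + T) = ?f S + ?f T" using ij Sc Tc by (simp add: algebra_simps)
      also have "\<dots> = 0"
        using S T ij unfolding form_matrices_antidiagonal_iff[OF G Sc] form_matrices_antidiagonal_iff[OF G Tc]
        by simp
      finally show ?thesis .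
    qed
    then show "S + T \<in> ?R"
      using Sc Tc by (simp add: form_matrices_antidiagonal_iff[OF G])
  next
    show "half_sum_diag m \<in> ?R"
      unfolding half_sum_diag_def
    proof (rule diag_in_form_matrices[OF G])
      fix i assume "i < m"
      then have e: "(of_nat (m - 1) :: 'a) = of_nat i + of_nat (m - 1 - i)"
        by (simp flip: of_nat_add)
      show "of_nat (m - 1) / 2 - of_nat i + (of_nat (m - 1) / 2 - of_nat (m - 1 - i)) = (0 :: 'a)"
        unfolding e by (simp add: field_simps del: of_nat_diff)
    qed
  qed (use B B' BB' B'B in \<open>auto simp: form_matrices_def\<close>)
  have "from_basis ` ?R = form_matrices m F"
  proof (intro equalityI subsetI)
    fix A assume A: "A \<in> form_matrices m F"
    then have Ac: "A \<in> carrier_mat m m" by (simp add: form_matrices_def)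
    let ?T = "?B' * (A * B)"
    have T: "?T \<in> carrier_mat m m" using Ac B B' by auto
    have AB: "A * B = B * ?T" using mult_inverse_left[OF B B' _ BB', of "A * B" m] Ac B by simp
    then have "A = from_basis ?T" by (rule from_basis_unique[OF Ac T])
    then show "A \<in> from_basis ` ?R" using form_matrices_transfer[OF F B A T AB] by blast
  next
    fix A assume "A \<in> from_basis ` ?R"
    then obtain T where T: "T \<in> ?R" "A = from_basis T" by blast
    then have Tc: "T \<in> carrier_mat m m" by (simp add: form_matrices_def)
    then have Ac: "A \<in> carrier_mat m m" using T by simp
    have "T * ?B' = ?B' * A"
      using mult_inverse_left[OF B' B _ B'B, of "T * ?B'" m] Tc B B' T(2)
      by (simp add: from_basis_def assoc_mult_mat[OF B Tc B'])
    then have "A \<in> form_matrices m (gram (gram F B) ?B')"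
      by (rule form_matrices_transfer[OF Gc B' T(1) Ac])
    moreover have "gram (gram F B) ?B' = F"
    proof -
      have Bt': "transpose_mat ?B' \<in> carrier_mat m m" using B' by simp
      have "gram (gram F B) ?B' = (transpose_mat ?B' * transpose_mat B) * (F * (B * ?B'))"
        unfolding gram_def
        using assoc_mult_mat[of "transpose_mat ?B'" m m "transpose_mat B" m "F * (B * ?B')" m]
          assoc_mult_mat[of "transpose_mat ?B'" m m "transpose_mat B * F * B" m "?B'" m]
          assoc_mult_mat[of "transpose_mat B * F" m m B m "?B'" m]
          assoc_mult_mat[of "transpose_mat B" m m F m "B * ?B'" m] Bt Bt' B B' F by simp
      also have "transpose_mat ?B' * transpose_mat B = transpose_mat (B * ?B')"
        by (rule transpose_mult[OF B B', symmetric])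
      finally show ?thesis unfolding BB' using F by simp
    qed
    ultimately show "A \<in> form_matrices m F" by simp
  qed
  then have lie: "lie = L" by (simp add: lie_def L_def)
  show "\<exists>D G. triangular L D
      {A \<in> carrier L. \<exists>T\<in>carrier_mat m m. A * B = B * T \<and> upper_triangular T} G"
    using triangular_axioms unfolding upper_def lie by blast
  show "\<exists>A\<in>carrier L. A * B = B * mat_diag m t" if t: "\<And>i. i < m \<Longrightarrow> t i + t (m - 1 - i) = 0"
  proof
    have "mat_diag m t \<in> ?R" by (rule diag_in_form_matrices[OF G, of t]) (rule t)
    then show "from_basis (mat_diag m t) \<in> carrier L" unfolding lie[symmetric]
      by (simp add: lie_def matrix_lie_def)
    show "from_basis (mat_diag m t) * B = B * mat_diag m t" by (rule from_basis_mult_basis) simp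
  qed
qed

section \<open>The symplectic and orthogonal bases\<close>

lemma gram_index:
  assumes "F \<in> carrier_mat m m" "B \<in> carrier_mat m m" "i < m" "j < m"
  shows "gram F B $$ (i, j) = (\<Sum>k<m. B $$ (k, i) * (\<Sum>l<m. F $$ (k, l) * B $$ (l, j)))"
proof -
  have "gram F B = transpose_mat B * (F * B)"
    using assms by (simp add: gram_def assoc_mult_mat[of _ m m _ m _ m])
  then show ?thesis using assms by (simp add: scalar_prod_def atLeast0LessThan)
qed

lemma gram_one_index:
  assumes "B \<in> carrier_mat m m" "i < m" "j < m"
  shows "gram (1\<^sub>m m) B $$ (i, j) = (\<Sum>k<m. B $$ (k, i) * B $$ (k, j))"
proof -
  have "gram (1\<^sub>m m) B = transpose_mat B * B" using assms(1) by (simp add: gram_def)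
  then show ?thesis using assms by (simp add: scalar_prod_def atLeast0LessThan)
qed

lemma sum_indicator:
  fixes f :: "nat \<Rightarrow> 'a::comm_ring_1"
  assumes "p < m"
  shows "(\<Sum>k<m. (if k = p then c else 0) * f k) = c * f p"
    and "(\<Sum>k<m. f k * (if k = p then c else 0)) = c * f p"
  using assms by (simp_all add: if_distrib[of "\<lambda>x. x * _"] if_distrib[of "\<lambda>x. _ * x"] mult.commute cong: if_cong)

text \<open>The columns of the symplectic basis are unit vectors, so that the Gram matrix is a permutation of the
entries of the form.\<close>

lemma symp_antidiagonal:
  assumes "even m"
  shows "antidiagonal m (gram (symp_form m) (borel_basis SP m :: 'a::field mat))"
proof -
  let ?p = "\<lambda>i. if i < m div 2 then 2 * i else 2 * (m - 1 - i) + 1"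
  have F: "(symp_form m :: 'a mat) \<in> carrier_mat m m" by (simp add: symp_form_def)
  have B: "(borel_basis SP m :: 'a mat) \<in> carrier_mat m m" by simp
  obtain r where r: "m = 2 * r" using assms by blast
  have p: "?p i < m" if "i < m" for i using that r by auto
  have Bp: "(borel_basis SP m :: 'a mat) $$ (k, i) = (if k = ?p i then 1 else 0)" if "i < m" "k < m" for i k
    using that by simp
  have "gram (symp_form m) (borel_basis SP m) $$ (i, j) = (symp_form m :: 'a mat) $$ (?p i, ?p j)"
    if ij: "i < m" "j < m" for i j
  proof -
    have "(\<Sum>l<m. symp_form m $$ (k, l) * (borel_basis SP m :: 'a mat) $$ (l, j)) =
        (\<Sum>l<m. symp_form m $$ (k, l) * (if l = ?p j then 1 else 0))" for k
      using ij by (intro sum.cong) (auto simp only: Bp lessThan_iff)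
    then have inner: "(\<Sum>l<m. symp_form m $$ (k, l) * (borel_basis SP m :: 'a mat) $$ (l, j)) =
        symp_form m $$ (k, ?p j)" for k
      using sum_indicator(2)[OF p[OF ij(2)], of "\<lambda>l. symp_form m $$ (k, l)" 1] by simp
    have "gram (symp_form m) (borel_basis SP m) $$ (i, j) =
        (\<Sum>k<m. (if k = ?p i then 1 else 0) * (symp_form m :: 'a mat) $$ (k, ?p j))"
      unfolding gram_index[OF F B ij] inner using ij
      by (intro sum.cong) (auto simp only: Bp lessThan_iff)
    also have "\<dots> = symp_form m $$ (?p i, ?p j)"
      using sum_indicator(1)[OF p[OF ij(1)], of 1 "\<lambda>k. (symp_form m :: 'a mat) $$ (k, ?p j)"] by simp
    finally show ?thesis .
  qed
  moreover have "(symp_form m :: 'a mat) $$ (?p i, ?p j) \<noteq> 0 \<longleftrightarrow> i + j = m - 1"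
    if ij: "i < m" "j < m" for i j
  proof -
    have "(symp_form m :: 'a mat) $$ (?p i, ?p j) \<noteq> 0 \<longleftrightarrow>
        (even (?p i) \<and> ?p j = ?p i + 1) \<or> (odd (?p i) \<and> ?p i = ?p j + 1)"
      using p[OF ij(1)] p[OF ij(2)] by (simp only: symp_form_def index_mat) simp
    also have "\<dots> \<longleftrightarrow> i + j = m - 1"
    proof -
      have half: "m div 2 = r" "m - 1 = 2 * r - 1" using r by auto
      have parity: "2 * a \<noteq> 2 * b + 1" "2 * a + 1 \<noteq> 2 * b" for a b :: nat by presburger+
      show ?thesis
      proof (cases "i < r")
        case i: True
        show ?thesis
        proof (cases "j < r")
          case True
          then have "i + j \<noteq> m - 1" using i r by linarith
          then show ?thesis using True i parity by (simp add: half)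
        next
          case False
          then show ?thesis using i ij r by (simp add: half) linarith
        qed
      next
        case i: False
        show ?thesis
        proof (cases "j < r")
          case True
          then show ?thesis using i ij r by (simp add: half) linarith
        next
          case False
          then show ?thesis using i ij r parity by (simp add: half)
        qed
      qed
    qed
    finally show ?thesis .
  qed
  ultimately show ?thesis using F B unfolding antidiagonal_def by simp
qed

lemma imag_unit_square: "imag_unit * imag_unit = (- 1 :: 'a::alg_closed_field)"
proof -
  have "\<exists>c::'a. c * c = - 1"
    using nth_root_exists[of 2 "- 1 :: 'a"] by (auto simp: power2_eq_square)
  then show ?thesis unfolding imag_unit_def by (rule someI_ex)
qed

text \<open>The columns are supported on the coordinate pairs \<open>{2i, 2i + 1}\<close>. Within such a pair the vectors
\<open>e + \<i> e'\<close> and \<open>e - \<i> e'\<close> are isotropic, since \<open>1 + \<i>\<^sup>2 = 0\<close>, and their product is \<open>1 - \<i>\<^sup>2 = 2\<close>.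
For odd \<open>m\<close> the middle column is a unit vector outside of all pairs.\<close>

lemma orth_antidiagonal:
  "antidiagonal m (gram (1\<^sub>m m) (borel_basis SO m :: 'a::{alg_closed_field, field_char_0} mat))"
proof -
  let ?B = "borel_basis SO m :: 'a mat" and ?r = "m div 2" and ?I = "imag_unit :: 'a"
  note I = imag_unit_square[where 'a='a]
  have B: "?B \<in> carrier_mat m m" by simp
  have pair: "(\<Sum>k<m. ?B $$ (k, i) * f k) = f (2 * i) + ?I * f (2 * i + 1)"
    if "i < ?r" for i and f :: "nat \<Rightarrow> 'a"
  proof -
    have bounds: "2 * i < m" "2 * i + 1 < m" using that by auto
    have "?B $$ (k, i) = (if k = 2 * i then 1 else 0) + (if k = 2 * i + 1 then ?I else 0)"
      if "k < m" for k
      using \<open>i < ?r\<close> that by simp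
    then have "(\<Sum>k<m. ?B $$ (k, i) * f k) =
        (\<Sum>k<m. (if k = 2 * i then 1 else 0) * f k + (if k = 2 * i + 1 then ?I else 0) * f k)"
      by (intro sum.cong refl) (simp only: lessThan_iff distrib_right)
    also have "\<dots> = f (2 * i) + ?I * f (2 * i + 1)"
      using sum_indicator(1)[of "2 * i" m 1 f] sum_indicator(1)[of "2 * i + 1" m ?I f] bounds
      by (simp only: sum.distrib mult_1_left mult_minus_left diff_conv_add_uminus)
    finally show ?thesis .
  qed
  have pair': "(\<Sum>k<m. ?B $$ (k, i) * f k) = f (2 * (m - 1 - i)) - ?I * f (2 * (m - 1 - i) + 1)"
    if "i < m" "m - 1 - i < ?r" for i and f :: "nat \<Rightarrow> 'a"
  proof -
    let ?i = "m - 1 - i"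
    have bounds: "2 * ?i < m" "2 * ?i + 1 < m" using that by linarith+
    have "\<not> i < ?r" using that by linarith
    then have "?B $$ (k, i) = (if k = 2 * ?i then 1 else 0) + (if k = 2 * ?i + 1 then - ?I else 0)"
      if "k < m" for k
      using \<open>i < m\<close> \<open>?i < ?r\<close> that by simp
    then have "(\<Sum>k<m. ?B $$ (k, i) * f k) =
        (\<Sum>k<m. (if k = 2 * ?i then 1 else 0) * f k + (if k = 2 * ?i + 1 then - ?I else 0) * f k)"
      by (intro sum.cong refl) (simp only: lessThan_iff distrib_right)
    also have "\<dots> = f (2 * ?i) - ?I * f (2 * ?i + 1)"
      using sum_indicator(1)[of "2 * ?i" m 1 f] sum_indicator(1)[of "2 * ?i + 1" m "- ?I" f] bounds
      by (simp only: sum.distrib mult_1_left mult_minus_left diff_conv_add_uminus)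
    finally show ?thesis .
  qed
  have mid: "(\<Sum>k<m. ?B $$ (k, i) * f k) = f (m - 1)"
    if "i < m" "\<not> i < ?r" "\<not> m - 1 - i < ?r" for i and f :: "nat \<Rightarrow> 'a"
  proof -
    have "?B $$ (k, i) = (if k = m - 1 then 1 else 0)" if "k < m" for k
      using \<open>i < m\<close> \<open>\<not> i < ?r\<close> \<open>\<not> m - 1 - i < ?r\<close> that by simp
    then have "(\<Sum>k<m. ?B $$ (k, i) * f k) = (\<Sum>k<m. (if k = m - 1 then 1 else 0) * f k)"
      by (intro sum.cong refl) (simp only: lessThan_iff)
    also have "\<dots> = f (m - 1)"
      using that sum_indicator(1)[of "m - 1" m 1 f] by simp
    finally show ?thesis .
  qed
  have gram: "gram (1\<^sub>m m) ?B $$ (i, j) = (\<Sum>k<m. ?B $$ (k, i) * ?B $$ (k, j))" if "i < m" "j < m" for i j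
    by (rule gram_one_index[OF B that])
  have "gram (1\<^sub>m m) ?B $$ (i, j) \<noteq> 0 \<longleftrightarrow> i + j = m - 1" if ij: "i < m" "j < m" for i j
  proof -
    have j1: "?B $$ (2 * k, j) = (if k = j then 1 else 0)"
      "?B $$ (2 * k + 1, j) = (if k = j then ?I else 0)" if "j < ?r" "k < ?r" for k
      using that ij by auto
    have j2: "?B $$ (2 * k, j) = (if k = m - 1 - j then 1 else 0)"
      "?B $$ (2 * k + 1, j) = (if k = m - 1 - j then - ?I else 0)" if "m - 1 - j < ?r" "k < ?r" for k
    proof -
      have "\<not> j < ?r" using that ij by auto
      then show "?B $$ (2 * k, j) = (if k = m - 1 - j then 1 else 0)"
        "?B $$ (2 * k + 1, j) = (if k = m - 1 - j then - ?I else 0)"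
        using that ij by auto
    qed
    have j3: "?B $$ (2 * k, j) = 0" "?B $$ (2 * k + 1, j) = 0"
      if "\<not> j < ?r" "\<not> m - 1 - j < ?r" "k < ?r" for k
      using that ij by auto
    consider (lo) "j < ?r" | (hi) "m - 1 - j < ?r" "\<not> j < ?r" | (mid) "\<not> j < ?r" "\<not> m - 1 - j < ?r"
      by blast
    note j_cases = this
    consider "i < ?r" | "m - 1 - i < ?r" "\<not> i < ?r" | "\<not> i < ?r" "\<not> m - 1 - i < ?r" by blast
    then show ?thesis
    proof cases
      case 1
      have g: "gram (1\<^sub>m m) ?B $$ (i, j) = ?B $$ (2 * i, j) + ?I * ?B $$ (2 * i + 1, j)"
        unfolding gram[OF ij] by (rule pair[OF 1])
      show ?thesis
      proof (cases rule: j_cases)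
        case lo
        then show ?thesis unfolding g j1[OF lo 1] using 1 I by auto
      next
        case hi
        then show ?thesis unfolding g j2[OF hi(1) 1] using 1 I ij by auto
      next
        case mid
        then show ?thesis unfolding g j3[OF mid 1] using 1 ij by auto
      qed
    next
      case 2
      have g: "gram (1\<^sub>m m) ?B $$ (i, j) =
          ?B $$ (2 * (m - 1 - i), j) - ?I * ?B $$ (2 * (m - 1 - i) + 1, j)"
        unfolding gram[OF ij] by (rule pair'[OF ij(1) 2(1)])
      have e: "m - 1 - i = j \<longleftrightarrow> i + j = m - 1" "m - 1 - i = m - 1 - j \<longleftrightarrow> i = j"
        using ij by linarith+
      show ?thesis
      proof (cases rule: j_cases)
        case lo
        then show ?thesis unfolding g j1[OF lo 2(1)] e using I by (simp del: borel_basis.simps)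
      next
        case hi
        then have "i + j \<noteq> m - 1" using 2 by linarith
        then show ?thesis unfolding g j2[OF hi(1) 2(1)] e using I by (simp del: borel_basis.simps)
      next
        case mid
        then have "i + j \<noteq> m - 1" using 2 by linarith
        then show ?thesis unfolding g j3[OF mid 2(1)] by (simp del: borel_basis.simps)
      qed
    next
      case 3
      have g: "gram (1\<^sub>m m) ?B $$ (i, j) = ?B $$ (m - 1, j)"
        unfolding gram[OF ij] by (rule mid[OF ij(1) 3])
      have m: "m div 2 = i" "m = Suc (2 * i)" using 3 ij by linarith+
      show ?thesis
      proof (cases rule: j_cases)
        case lo
        then have "j < i" using m by simp
        then have "?B $$ (m - 1, j) = 0" "i + j \<noteq> m - 1" using m by simp_all
        then show ?thesis unfolding g by (simp only:) simp
      next
        case hi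
        then have "\<not> j < i" "2 * i - j < i" using m by simp_all
        then have "?B $$ (m - 1, j) = 0" "i + j \<noteq> m - 1" using m ij by simp_all
        then show ?thesis unfolding g by (simp only:) simp
      next
        case mid
        then have "j = i" using m ij by simp
        then have "?B $$ (m - 1, j) = 1" "i + j = m - 1" using m by simp_all
        then show ?thesis unfolding g by (simp only:) simp
      qed
    qed
  qed
  then show ?thesis using B unfolding antidiagonal_def by simp
qed

lemma classical_alg_form:
  shows "classical_alg SP m = matrix_lie m (form_matrices m (symp_form m :: 'a::field mat))"
    and "classical_alg SO m = matrix_lie m (form_matrices m (1\<^sub>m m :: 'a mat))"
proof -
  show "classical_alg SP m = matrix_lie m (form_matrices m (symp_form m :: 'a mat))"
    by (simp add: form_matrices_def)
  have "form_matrices m (1\<^sub>m m :: 'a mat) = {A \<in> carrier_mat m m. transpose_mat A + A = 0\<^sub>m m m}"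
    by (auto simp: form_matrices_def)
  then show "classical_alg SO m = matrix_lie m (form_matrices m (1\<^sub>m m :: 'a mat))" by simp
qed

lemma classical_triangular:
  assumes "K = SP \<Longrightarrow> even m"
  shows "\<exists>D G. triangular (classical_alg K m :: ('a::{alg_closed_field, field_char_0}, 'a mat) lie_alg)
           D (borel_upper K m) G"
proof (cases K)
  case SL
  then show ?thesis using sl_triangular by simp
next
  case SP
  have "symp_form m \<in> carrier_mat m m" "borel_basis SP m \<in> carrier_mat m m"
    by (simp_all add: symp_form_def)
  then show ?thesis
    using form_triangular(1)[OF _ _ symp_antidiagonal] assms SP
    unfolding borel_upper_def SP classical_alg_form by blast
next
  case SO
  have "1\<^sub>m m \<in> carrier_mat m m" "borel_basis SO m \<in> carrier_mat m m" by simp_all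
  then show ?thesis
    using form_triangular(1)[OF _ _ orth_antidiagonal] unfolding borel_upper_def SO classical_alg_form
    by blast
qed

text \<open>The diagonal matrices, in coordinates, that belong to the algebra. They serve to read off weights.\<close>

lemma classical_cartan:
  fixes t :: "nat \<Rightarrow> 'a::{alg_closed_field, field_char_0}"
  assumes "K = SP \<Longrightarrow> even m" "K = SL \<Longrightarrow> (\<Sum>i<m. t i) = 0"
    and "\<And>i. K \<noteq> SL \<Longrightarrow> i < m \<Longrightarrow> t i + t (m - 1 - i) = 0"
  shows "\<exists>A\<in>carrier (classical_alg K m). A * borel_basis K m = borel_basis K m * mat_diag m t"
proof (cases K)
  case SL
  then show ?thesis using sl_cartan[of t m] assms by simp
next
  case SP
  have "symp_form m \<in> carrier_mat m m" "borel_basis SP m \<in> carrier_mat m m"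
    by (simp_all add: symp_form_def)
  then show ?thesis
    using form_triangular(2)[OF _ _ symp_antidiagonal, of m t] assms
    unfolding SP classical_alg_form by blast
next
  case SO
  have "1\<^sub>m m \<in> carrier_mat m m" "borel_basis SO m \<in> carrier_mat m m" by simp_all
  then show ?thesis
    using form_triangular(2)[OF _ _ orth_antidiagonal, of m t] assms
    unfolding SO classical_alg_form by blast
qed

section \<open>Highest weights and labels\<close>

text \<open>The condition on the highest weight vector in \<^const>\<open>hw_module\<close>, restricted to the classical algebra.
In the case of \<open>sl\<close> the module carries an action of \<open>gl\<close>, of which homomorphisms of
\<open>sl\<close>-modules respect only this restriction.\<close>

definition hw_vector ::
    "classical \<Rightarrow> nat \<Rightarrow> (nat \<Rightarrow> int) \<Rightarrow> ('a::field, 'v, 'a mat) lie_mod \<Rightarrow> 'v \<Rightarrow> bool" where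
  "hw_vector K m wt M v \<longleftrightarrow> v \<in> carrier M \<and> v \<noteq> \<zero>\<^bsub>M\<^esub> \<and>
     (\<forall>A\<in>carrier (classical_alg K m). \<forall>T\<in>carrier_mat m m.
        A * borel_basis K m = borel_basis K m * T \<and> upper_triangular T \<longrightarrow>
          act M A v = (\<Sum>i<m. of_int (wt i) * T $$ (i, i)) \<odot>\<^bsub>M\<^esub> v)"

lemma is_V_hw_vector:
  fixes M :: "('a::field, 'v, 'a mat) lie_mod"
  assumes "is_V K m lam M"
  shows "\<exists>v. hw_vector K m (label_weight m lam) M v"
proof (cases "K = SL")
  case False
  then show ?thesis using assms by (auto simp: is_V_def hw_module_def hw_vector_def)
next
  case True
  then obtain \<rho> where rho: "hw_module (gl_alg m) m (borel_basis SL m) (label_weight m lam) (M\<lparr>act := \<rho>\<rparr>)"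
    "\<forall>A\<in>carrier (classical_alg SL m). \<forall>v\<in>carrier M. act M A v = \<rho> A v"
    using assms by (auto simp: is_V_def)
  then obtain v where v: "v \<in> carrier M" "v \<noteq> \<zero>\<^bsub>M\<^esub>"
    "\<forall>A\<in>carrier (gl_alg m). \<forall>T\<in>carrier_mat m m.
        A * borel_basis SL m = borel_basis SL m * T \<and> upper_triangular T \<longrightarrow>
          \<rho> A v = (\<Sum>i<m. of_int (label_weight m lam i) * T $$ (i, i)) \<odot>\<^bsub>M\<^esub> v"
    unfolding hw_module_def by (auto simp del: borel_basis.simps)
  have "carrier (classical_alg SL m) \<subseteq> carrier (gl_alg m :: ('a, 'a mat) lie_alg)"
    by (auto simp: gl_alg_def matrix_lie_def)
  then show ?thesis unfolding True hw_vector_def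
    using rho(2) v by (auto simp del: borel_basis.simps classical_alg.simps simp: subset_iff)
qed

lemma hw_vector_eigenvector:
  "hw_vector K m wt M v \<Longrightarrow> eigenvector_on (borel_upper K m) M v"
  unfolding hw_vector_def eigenvector_on_def borel_upper_def
  by (auto simp del: borel_basis.simps classical_alg.simps)

lemma hw_vector_image:
  fixes M :: "('a::field, 'v, 'a mat) lie_mod" and N :: "('a, 'w, 'a mat) lie_mod"
  assumes f: "f \<in> lie_hom (classical_alg K m) M N" and v: "hw_vector K m wt M v" and "f v \<noteq> \<zero>\<^bsub>N\<^esub>"
  shows "hw_vector K m wt N (f v)"
  unfolding hw_vector_def
proof (intro conjI ballI impI)
  note f' = lie_hom_facts[OF f]
  have v': "v \<in> carrier M" using v by (simp add: hw_vector_def)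
  show "f v \<in> carrier N" using v' by (rule f')
  fix A T :: "'a mat"
  assume A: "A \<in> carrier (classical_alg K m)" and "T \<in> carrier_mat m m"
    "A * borel_basis K m = borel_basis K m * T \<and> upper_triangular T"
  then have "act M A v = (\<Sum>i<m. of_int (wt i) * T $$ (i, i)) \<odot>\<^bsub>M\<^esub> v"
    using v by (simp add: hw_vector_def del: borel_basis.simps classical_alg.simps)
  then show "act N A (f v) = (\<Sum>i<m. of_int (wt i) * T $$ (i, i)) \<odot>\<^bsub>N\<^esub> f v"
    using f'(5)[OF v'] f'(6)[OF A v'] by simp
qed (fact assms(3))

text \<open>The two vectors are proportional, so a diagonal element acts on both by the same scalar.
Integer values of \<open>t\<close> suffice and allow the conclusion to be stated in \<open>int\<close>.\<close>

lemma hw_vector_weight_unique: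
  fixes M :: "('a::{alg_closed_field, field_char_0}, 'v, 'a mat) lie_mod"
  assumes even: "K = SP \<Longrightarrow> even m" and M: "lie_simple (classical_alg K m) M"
    and v: "hw_vector K m wt M v" and w: "hw_vector K m wt' M w"
    and t: "K = SL \<Longrightarrow> (\<Sum>i<m. t i) = 0" "\<And>i. K \<noteq> SL \<Longrightarrow> i < m \<Longrightarrow> t i + t (m - 1 - i) = 0"
  shows "(\<Sum>i<m. wt i * t i) = (\<Sum>i<m. wt' i * t i)"
proof -
  interpret M: simple_lie_rep "classical_alg K m" M using M by (rule simple_lie_repI)
  obtain D G where "triangular (classical_alg K m :: ('a, 'a mat) lie_alg) D (borel_upper K m) G"
    using classical_triangular[OF even] by blast
  then interpret T: triangular "classical_alg K m :: ('a, 'a mat) lie_alg" D "borel_upper K m" G .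
  interpret M: hw_rep "classical_alg K m" D "borel_upper K m" G M by intro_locales
  obtain c where c: "c \<noteq> 0" "w = c \<odot>\<^bsub>M\<^esub> v"
    using M.eigenvector_on_unique[OF hw_vector_eigenvector[OF v] hw_vector_eigenvector[OF w]] by blast
  let ?t = "\<lambda>i. of_int (t i) :: 'a"
  have "(\<Sum>i<m. ?t i) = of_int (\<Sum>i<m. t i)" by simp
  then have sum0: "K = SL \<Longrightarrow> (\<Sum>i<m. ?t i) = 0" using t(1) by simp
  have skew: "?t i + ?t (m - 1 - i) = 0" if "K \<noteq> SL" "i < m" for i
    using t(2)[OF that] by (simp flip: of_int_add)
  obtain A where A: "A \<in> carrier (classical_alg K m)"
    "A * borel_basis K m = borel_basis K m * mat_diag m ?t"
    using classical_cartan[OF even sum0 skew] by blast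
  let ?s = "\<lambda>wt. (of_int (\<Sum>i<m. wt i * t i) :: 'a)"
  have up: "upper_triangular (mat_diag m ?t)"
    by (intro upper_triangularI) (auto simp: mat_diag_def)
  have s: "(\<Sum>i<m. of_int (wt i) * mat_diag m ?t $$ (i, i)) = ?s wt" for wt
    by (simp add: mat_diag_def)
  have Av: "act M A v = ?s wt \<odot>\<^bsub>M\<^esub> v"
    using v A up mat_diag_dim[of m ?t] unfolding hw_vector_def s[symmetric] by blast
  have Aw: "act M A w = ?s wt' \<odot>\<^bsub>M\<^esub> w"
    using w A up mat_diag_dim[of m ?t] unfolding hw_vector_def s[symmetric] by blast
  have vM: "v \<in> carrier M" "v \<noteq> \<zero>\<^bsub>M\<^esub>" using v by (auto simp: hw_vector_def)
  have "(c * ?s wt) \<odot>\<^bsub>M\<^esub> v = act M A w"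
    unfolding c(2) using A(1) vM by (simp only: M.act_scale Av M.scale_scale)
  also have "\<dots> = (c * ?s wt') \<odot>\<^bsub>M\<^esub> v"
    unfolding Aw unfolding c(2) using vM by (simp only: M.scale_scale mult.commute)
  finally have "c * ?s wt = c * ?s wt'" using M.scale_cancel vM by blast
  then have "?s wt = ?s wt'" using c(1) by simp
  then show ?thesis by (simp only: of_int_eq_iff)
qed

lemma partition_eqI:
  assumes "is_partition p" "is_partition q"
    and "\<And>i. (if i < length p then p ! i else 0) = (if i < length q then q ! i else 0)"
  shows "p = q"
proof -
  have "length q \<le> length p" if "is_partition q"
    and eq: "\<And>i. (if i < length p then p ! i else 0) = (if i < length q then q ! i else 0)" for p q :: "nat list"
  proof (rule ccontr)
    assume "\<not> length q \<le> length p"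
    then have "q ! length p = 0" "length p < length q" using eq[of "length p"] by auto
    then have "0 \<in> set q" by (metis nth_mem)
    then show False using that(1) by (simp add: is_partition_def)
  qed
  from this[OF assms(2,3)] this[OF assms(1) assms(3)[symmetric]] have "length p = length q" by simp
  then show ?thesis
  proof (rule nth_equalityI)
    fix i assume "i < length p"
    then show "p ! i = q ! i" using assms(3)[of i] \<open>length p = length q\<close> by simp
  qed
qed

lemma sum_difference:
  fixes w :: "nat \<Rightarrow> int"
  assumes "i < m" "j < m" "i \<noteq> j"
  shows "(\<Sum>k<m. w k * (if k = i then 1 else if k = j then - 1 else 0)) = w i - w j"
proof -
  have "(\<Sum>k<m. w k * (if k = i then 1 else if k = j then - 1 else 0)) =
      (\<Sum>k<m. w k * (if k = i then 1 else 0) + w k * (if k = j then - 1 else 0))"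
    using assms by (intro sum.cong) auto
  also have "\<dots> = w i - w j"
    using sum_indicator(2)[OF assms(1), of w 1] sum_indicator(2)[OF assms(2), of w "- 1"]
    by (simp only: sum.distrib)
  finally show ?thesis .
qed

definition total_length :: "label \<Rightarrow> nat" where
  "total_length lam = length (fst lam) + length (snd lam)"

text \<open>For \<open>sp\<close> and \<open>so\<close> the diagonal matrix with entries \<open>1\<close> at \<open>i\<close> and \<open>-1\<close> at \<open>m - 1 - i\<close> isolates the \<open>i\<close>-th
part of the partition. For \<open>sl\<close> only differences of weight entries are visible; the bound on the
lengths provides a position \<open>j\<close> where both weights vanish, and differences with that entry give the
weights themselves.\<close>

lemma label_determined:
  assumes lab: "lam \<in> labels K" "mu \<in> labels K" and fit: "label_fits K m lam" "label_fits K m mu"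
    and len: "total_length lam + total_length mu < m"
    and eq: "\<And>t :: nat \<Rightarrow> int. (K = SL \<Longrightarrow> (\<Sum>i<m. t i) = 0) \<Longrightarrow>
        (\<And>i. K \<noteq> SL \<Longrightarrow> i < m \<Longrightarrow> t i + t (m - 1 - i) = 0) \<Longrightarrow>
        (\<Sum>i<m. label_weight m lam i * t i) = (\<Sum>i<m. label_weight m mu i * t i)"
  shows "lam = mu"
proof -
  obtain \<alpha> \<beta> \<alpha>' \<beta>' where ab: "lam = (\<alpha>, \<beta>)" "mu = (\<alpha>', \<beta>')" by (meson surj_pair)
  have len': "length \<alpha> + length \<beta> + length \<alpha>' + length \<beta>' < m" using len by (simp add: ab total_length_def)
  let ?t = "\<lambda>i j k. if k = i then 1 else if k = j then - 1 else (0::int)"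
  show ?thesis
  proof (cases "K = SL")
    case True
    \<comment> \<open>to the right of both \<open>\<alpha>\<close> and \<open>\<alpha>'\<close> and, by the bound on the lengths, to the left of both \<open>\<beta>\<close> and \<open>\<beta>'\<close>\<close>
    let ?j = "length \<alpha> + length \<alpha>'"
    have j: "?j < m" "label_weight m lam ?j = 0" "label_weight m mu ?j = 0"
      using len' by (auto simp: ab)
    have wt: "label_weight m lam i = label_weight m mu i" if "i < m" for i
    proof (cases "i = ?j")
      case False
      have "(\<Sum>k<m. ?t i ?j k) = 0" using sum_difference[OF that j(1) False, of "\<lambda>_. 1"] by simp
      then have "(\<Sum>k<m. label_weight m lam k * ?t i ?j k) = (\<Sum>k<m. label_weight m mu k * ?t i ?j k)"
        using True by (intro eq) auto
      then show ?thesis unfolding sum_difference[OF that j(1) False] using j by simp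
    qed (use j in simp)
    have "\<alpha> = \<alpha>'"
    proof (rule partition_eqI)
      show "is_partition \<alpha>" "is_partition \<alpha>'" using lab True ab by auto
      show "(if i < length \<alpha> then \<alpha> ! i else 0) = (if i < length \<alpha>' then \<alpha>' ! i else 0)" for i
      proof (cases "i < ?j")
        case True
        then show ?thesis using wt[of i] len' by (auto simp: ab split: if_splits)
      qed auto
    qed
    moreover have "\<beta> = \<beta>'"
    proof (rule partition_eqI)
      show "is_partition \<beta>" "is_partition \<beta>'" using lab True ab by auto
      show "(if i < length \<beta> then \<beta> ! i else 0) = (if i < length \<beta>' then \<beta>' ! i else 0)" for i
      proof (cases "i < length \<beta> + length \<beta>'")
        case True
        have "m - 1 - (m - 1 - i) = i" "\<not> m - 1 - i < length \<alpha>" "\<not> m - 1 - i < length \<alpha>'" "m - 1 - i < m"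
          using True len' by linarith+
        then show ?thesis using wt[of "m - 1 - i"] by (auto simp: ab split: if_splits)
      qed auto
    qed
    ultimately show ?thesis by (simp add: ab)
  next
    case False
    then have K: "is_partition \<alpha>" "is_partition \<alpha>'" "\<beta> = []" "\<beta>' = []" "2 * length \<alpha> \<le> m" "2 * length \<alpha>' \<le> m"
      using lab fit ab by (cases K; auto)+
    have "\<alpha> = \<alpha>'"
    proof (rule partition_eqI)
      show "is_partition \<alpha>" "is_partition \<alpha>'" using K by auto
      show "(if i < length \<alpha> then \<alpha> ! i else 0) = (if i < length \<alpha>' then \<alpha>' ! i else 0)" for i
      proof (cases "i < m div 2")
        case True
        then have i: "i < m" "m - 1 - i < m" "i \<noteq> m - 1 - i" by linarith+
        have "(\<Sum>k<m. label_weight m lam k * ?t i (m - 1 - i) k) =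
            (\<Sum>k<m. label_weight m mu k * ?t i (m - 1 - i) k)"
        proof (rule eq)
          show "?t i (m - 1 - i) k + ?t i (m - 1 - i) (m - 1 - k) = 0" if "k < m" for k
          proof -
            have "m - 1 - k = i \<longleftrightarrow> k = m - 1 - i" "m - 1 - k = m - 1 - i \<longleftrightarrow> k = i"
              using i that by linarith+
            then show ?thesis using i by simp
          qed
        qed (use False in simp)
        moreover have "\<not> m - 1 - i < length \<alpha>" "\<not> m - 1 - i < length \<alpha>'" using True K by linarith+
        ultimately show ?thesis
          unfolding sum_difference[OF i] by (auto simp: ab K split: if_splits)
      next
        case False
        then have "\<not> i < length \<alpha>" "\<not> i < length \<alpha>'" using K by linarith+
        then show ?thesis by simp
      qed
    qed
    then show ?thesis using ab K by simp
  qed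
qed

section \<open>Direct limits of sequences of sets\<close>

lemma dl_trans_self [simp]: "dl_trans f k k a = a"
  by (simp add: dl_trans_def)

lemma dl_trans_Suc: "k \<le> p \<Longrightarrow> dl_trans f k (Suc p) a = f p (dl_trans f k p a)"
  by (simp add: dl_trans_def Suc_diff_le)

lemma dl_trans_trans:
  assumes "k \<le> l" "l \<le> p"
  shows "dl_trans f l p (dl_trans f k l a) = dl_trans f k p a"
  using assms(2)
proof (induction rule: dec_induct)
  case (step p)
  then show ?case using assms(1) by (simp add: dl_trans_Suc)
qed simp

lemma dl_trans_eq_mono:
  assumes "dl_trans f k p a = dl_trans f l p b" "k \<le> p" "l \<le> p" "p \<le> r"
  shows "dl_trans f k r a = dl_trans f l r b"
  using dl_trans_trans[of k p r f a] dl_trans_trans[of l p r f b] assms by simp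

locale direct_system =
  fixes S :: "nat \<Rightarrow> 'b set" and f :: "nat \<Rightarrow> 'b \<Rightarrow> 'b"
  assumes step_in: "1 \<le> k \<Longrightarrow> a \<in> S k \<Longrightarrow> f k a \<in> S (k + 1)"
begin

lemma trans_in:
  assumes "1 \<le> k" "a \<in> S k" "k \<le> p"
  shows "dl_trans f k p a \<in> S p"
  using assms(3)
proof (induction rule: dec_induct)
  case (step p)
  then show ?case using assms(1) step_in[of p] by (simp add: dl_trans_Suc)
qed (use assms in simp)

lemma dl_rel_iff:
  "((k, a), (l, b)) \<in> dl_rel S f \<longleftrightarrow> 1 \<le> k \<and> a \<in> S k \<and> 1 \<le> l \<and> b \<in> S l \<and>
     (\<exists>p. k \<le> p \<and> l \<le> p \<and> dl_trans f k p a = dl_trans f l p b)"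
  by (simp add: dl_rel_def)

lemma dl_rel_trans:
  assumes "((k, a), (l, b)) \<in> dl_rel S f" "((l, b), (i, c)) \<in> dl_rel S f"
  shows "((k, a), (i, c)) \<in> dl_rel S f"
proof -
  obtain p where p: "k \<le> p" "l \<le> p" "dl_trans f k p a = dl_trans f l p b"
    using assms(1) unfolding dl_rel_iff by blast
  obtain q where q: "l \<le> q" "i \<le> q" "dl_trans f l q b = dl_trans f i q c"
    using assms(2) unfolding dl_rel_iff by blast
  let ?r = "max p q"
  have "dl_trans f k ?r a = dl_trans f l ?r b"
    by (rule dl_trans_eq_mono[OF p(3,1,2)]) simp
  also have "\<dots> = dl_trans f i ?r c"
    by (rule dl_trans_eq_mono[OF q(3,1,2)]) simp
  finally have "dl_trans f k ?r a = dl_trans f i ?r c" .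
  moreover have "k \<le> ?r" "i \<le> ?r" using p q by auto
  ultimately show ?thesis using assms unfolding dl_rel_iff by blast
qed

lemma equiv: "equiv (SIGMA k:{1..}. S k) (dl_rel S f)"
proof (rule equivI)
  show "dl_rel S f \<subseteq> (SIGMA k:{1..}. S k) \<times> (SIGMA k:{1..}. S k)"
    by (auto simp: dl_rel_def)
  show "refl_on (SIGMA k:{1..}. S k) (dl_rel S f)"
    by (auto simp: refl_on_def dl_rel_iff)
  show "sym (dl_rel S f)"
  proof (rule symI)
    fix u v assume "(u, v) \<in> dl_rel S f"
    then show "(v, u) \<in> dl_rel S f"
      by (cases u; cases v) (simp only: dl_rel_iff, metis)
  qed
  show "trans (dl_rel S f)"
  proof (rule transI)
    fix u v w assume "(u, v) \<in> dl_rel S f" "(v, w) \<in> dl_rel S f"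
    then show "(u, w) \<in> dl_rel S f"
      by (cases u; cases v; cases w) (simp only: dl_rel_trans)
  qed
qed

abbreviation cls where "cls \<equiv> dl_cls S f"

lemma cls_eq_iff:
  assumes "1 \<le> k" "a \<in> S k" "1 \<le> l" "b \<in> S l"
  shows "cls k a = cls l b \<longleftrightarrow> (\<exists>p. k \<le> p \<and> l \<le> p \<and> dl_trans f k p a = dl_trans f l p b)"
proof -
  have "cls k a = cls l b \<longleftrightarrow> ((k, a), (l, b)) \<in> dl_rel S f"
    unfolding dl_cls_def using assms by (intro eq_equiv_class_iff[OF equiv]) auto
  then show ?thesis using assms by (simp add: dl_rel_def)
qed

lemma mem_cls_iff:
  assumes "1 \<le> k" "a \<in> S k"
  shows "(l, b) \<in> cls k a \<longleftrightarrow> 1 \<le> l \<and> b \<in> S l \<and> cls k a = cls l b"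
  using cls_eq_iff[OF assms] assms unfolding dl_cls_def Image_singleton_iff dl_rel_iff by blast

lemma cls_trans:
  assumes "1 \<le> k" "a \<in> S k" "k \<le> p"
  shows "cls p (dl_trans f k p a) = cls k a"
  using assms trans_in[OF assms] by (subst cls_eq_iff) (auto intro!: exI[of _ p])

lemma cls_step:
  assumes "1 \<le> k" "a \<in> S k"
  shows "cls (k + 1) (f k a) = cls k a"
  using cls_trans[OF assms, of "Suc k"] by (simp add: dl_trans_Suc)

lemma cls_in [simp]: "1 \<le> k \<Longrightarrow> a \<in> S k \<Longrightarrow> cls k a \<in> dl_set S f"
  unfolding dl_cls_def dl_set_def by (intro quotientI) auto

text \<open>A representative exists at all sufficiently late stages, so any finite number of classes can be
represented at a common stage.\<close>

lemma representatives:
  assumes "P \<in> dl_set S f"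
  obtains k where "1 \<le> k" "\<And>p. k \<le> p \<Longrightarrow> \<exists>a\<in>S p. P = cls p a"
proof -
  obtain k a where ka: "1 \<le> k" "a \<in> S k" "P = cls k a"
    using assms unfolding dl_cls_def dl_set_def by (auto elim!: quotientE)
  have "\<exists>b\<in>S p. P = cls p b" if "k \<le> p" for p
    using cls_trans[OF ka(1,2) that] trans_in[OF ka(1,2) that] ka(3) by metis
  then show ?thesis using that ka by blast
qed

lemma cls_inj:
  assumes inj: "\<And>k. 1 \<le> k \<Longrightarrow> inj_on (f k) (S k)"
    and "1 \<le> k" "a \<in> S k" "b \<in> S k" "cls k a = cls k b"
  shows "a = b"
proof -
  obtain p where p: "k \<le> p" "dl_trans f k p a = dl_trans f k p b"
    using cls_eq_iff assms by blast
  from p show ?thesis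
  proof (induction rule: dec_induct)
    case (step q)
    then show ?case
      using inj[of q] trans_in[of k a q] trans_in[of k b q] assms(2-4)
      by (auto simp: dl_trans_Suc inj_on_def)
  qed simp
qed

end

lemma dl_op1_cls:
  assumes "direct_system S f" "direct_system R r"
    and h: "\<And>k a. 1 \<le> k \<Longrightarrow> a \<in> S k \<Longrightarrow> h k a \<in> R k"
    and step: "\<And>k a. 1 \<le> k \<Longrightarrow> a \<in> S k \<Longrightarrow> h (k + 1) (f k a) = r k (h k a)"
    and ka: "1 \<le> k" "a \<in> S k"
  shows "dl_op1 R r h (dl_cls S f k a) = dl_cls R r k (h k a)"
proof -
  interpret S: direct_system S f by fact
  interpret R: direct_system R r by fact
  have tr: "h p (dl_trans f k p a) = dl_trans r k p (h k a)" if "1 \<le> k" "a \<in> S k" "k \<le> p" for k p a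
    using that(3)
    by (induction rule: dec_induct)
       (use that(1,2) step[OF _ S.trans_in] in \<open>auto simp: dl_trans_Suc\<close>)
  have "R.cls l (h l b) = R.cls k (h k a)" if lb: "1 \<le> l" "b \<in> S l" "S.cls k a = S.cls l b" for l b
  proof -
    obtain p where p: "k \<le> p" "l \<le> p" "dl_trans f k p a = dl_trans f l p b"
      using lb S.cls_eq_iff[OF ka lb(1,2)] by blast
    then have "dl_trans r l p (h l b) = dl_trans r k p (h k a)"
      using tr[OF ka p(1)] tr[OF lb(1,2) p(2)] by simp
    then show ?thesis
      using R.cls_eq_iff[of l "h l b" k "h k a"] h ka lb p by blast
  qed
  then have "{R.cls p (h p a') | p a'. (p, a') \<in> S.cls k a} = {R.cls k (h k a)}"
    using ka unfolding S.mem_cls_iff[OF ka] by blast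
  then show ?thesis unfolding dl_op1_def by simp
qed

text \<open>Representatives of the two arguments are compared at a common later stage; as \<open>h\<close> commutes with the
transition maps, all of them lead to the same class, and the union in the definition of \<^const>\<open>dl_op2\<close>
is over a single set.\<close>

lemma dl_op2_cls:
  assumes "direct_system S f" "direct_system T g" "direct_system R r"
    and h: "\<And>k a b. 1 \<le> k \<Longrightarrow> a \<in> S k \<Longrightarrow> b \<in> T k \<Longrightarrow> h k a b \<in> R k"
    and step: "\<And>k a b. 1 \<le> k \<Longrightarrow> a \<in> S k \<Longrightarrow> b \<in> T k \<Longrightarrow>
          h (k + 1) (f k a) (g k b) = r k (h k a b)"
    and k: "1 \<le> k" and a: "a \<in> S k" and b: "b \<in> T k"
  shows "dl_op2 R r h (dl_cls S f k a) (dl_cls T g k b) = dl_cls R r k (h k a b)"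
proof -
  interpret S: direct_system S f by fact
  interpret T: direct_system T g by fact
  interpret R: direct_system R r by fact
  have tr: "h p (dl_trans f k p a) (dl_trans g k p b) = dl_trans r k p (h k a b)"
    if "1 \<le> k" "a \<in> S k" "b \<in> T k" "k \<le> p" for k p a b
    using that(4)
    by (induction rule: dec_induct)
       (use that(1-3) step[OF _ S.trans_in T.trans_in] in \<open>auto simp: dl_trans_Suc\<close>)
  have "R.cls l (h l a' b') = R.cls k (h k a b)"
    if l: "1 \<le> l" "a' \<in> S l" "S.cls k a = S.cls l a'" "b' \<in> T l" "T.cls k b = T.cls l b'" for l a' b'
  proof -
    obtain p where p: "k \<le> p" "l \<le> p" "dl_trans f k p a = dl_trans f l p a'"
      using l S.cls_eq_iff[OF k a l(1,2)] by blast
    obtain q where q: "k \<le> q" "l \<le> q" "dl_trans g k q b = dl_trans g l q b'"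
      using l T.cls_eq_iff[OF k b l(1,4)] by blast
    let ?s = "max p q"
    have sa: "dl_trans f k ?s a = dl_trans f l ?s a'"
      by (rule dl_trans_eq_mono[OF p(3,1,2)]) simp
    have sb: "dl_trans g k ?s b = dl_trans g l ?s b'"
      by (rule dl_trans_eq_mono[OF q(3,1,2)]) simp
    have s: "k \<le> ?s" "l \<le> ?s" using p by auto
    have "dl_trans r l ?s (h l a' b') = dl_trans r k ?s (h k a b)"
      using tr[OF k a b s(1)] tr[OF l(1,2,4) s(2)] sa sb by simp
    then show ?thesis
      using R.cls_eq_iff[of l "h l a' b'" k "h k a b"] h k a b l s by blast
  qed
  then have "{R.cls p (h p a' b') | p a' b'. (p, a') \<in> S.cls k a \<and> (p, b') \<in> T.cls k b} = {R.cls k (h k a b)}"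
    using k a b unfolding S.mem_cls_iff[OF k a] T.mem_cls_iff[OF k b] by blast
  then show ?thesis unfolding dl_op2_def by simp
qed

section \<open>Direct limits of modules\<close>

lemma class_vectorspaceI:
  fixes M :: "('a::field, 'v, 'b) module_scheme"
  assumes "\<And>u v. u \<in> carrier M \<Longrightarrow> v \<in> carrier M \<Longrightarrow> u \<oplus>\<^bsub>M\<^esub> v \<in> carrier M"
    and "\<zero>\<^bsub>M\<^esub> \<in> carrier M"
    and "\<And>u v w. u \<in> carrier M \<Longrightarrow> v \<in> carrier M \<Longrightarrow> w \<in> carrier M \<Longrightarrow>
          (u \<oplus>\<^bsub>M\<^esub> v) \<oplus>\<^bsub>M\<^esub> w = u \<oplus>\<^bsub>M\<^esub> (v \<oplus>\<^bsub>M\<^esub> w)"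
    and "\<And>u v. u \<in> carrier M \<Longrightarrow> v \<in> carrier M \<Longrightarrow> u \<oplus>\<^bsub>M\<^esub> v = v \<oplus>\<^bsub>M\<^esub> u"
    and "\<And>v. v \<in> carrier M \<Longrightarrow> \<zero>\<^bsub>M\<^esub> \<oplus>\<^bsub>M\<^esub> v = v"
    and "\<And>v. v \<in> carrier M \<Longrightarrow> (- 1) \<odot>\<^bsub>M\<^esub> v \<oplus>\<^bsub>M\<^esub> v = \<zero>\<^bsub>M\<^esub>"
    and "\<And>c v. v \<in> carrier M \<Longrightarrow> c \<odot>\<^bsub>M\<^esub> v \<in> carrier M"
    and "\<And>c d v. v \<in> carrier M \<Longrightarrow> (c + d) \<odot>\<^bsub>M\<^esub> v = c \<odot>\<^bsub>M\<^esub> v \<oplus>\<^bsub>M\<^esub> d \<odot>\<^bsub>M\<^esub> v"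
    and "\<And>c u v. u \<in> carrier M \<Longrightarrow> v \<in> carrier M \<Longrightarrow>
          c \<odot>\<^bsub>M\<^esub> (u \<oplus>\<^bsub>M\<^esub> v) = c \<odot>\<^bsub>M\<^esub> u \<oplus>\<^bsub>M\<^esub> c \<odot>\<^bsub>M\<^esub> v"
    and "\<And>c d v. v \<in> carrier M \<Longrightarrow> (c * d) \<odot>\<^bsub>M\<^esub> v = c \<odot>\<^bsub>M\<^esub> (d \<odot>\<^bsub>M\<^esub> v)"
    and "\<And>v. v \<in> carrier M \<Longrightarrow> 1 \<odot>\<^bsub>M\<^esub> v = v"
  shows "class_vectorspace M"
proof -
  have "abelian_group M"
  proof (rule abelian_groupI)
    fix v assume "v \<in> carrier M"
    then show "\<exists>w\<in>carrier M. w \<oplus>\<^bsub>M\<^esub> v = \<zero>\<^bsub>M\<^esub>"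
      using assms(6,7) by (intro bexI[of _ "(- 1) \<odot>\<^bsub>M\<^esub> v"]) auto
  qed (use assms in auto)
  moreover have "field (class_ring :: 'a ring)" by (rule class_field.field_axioms)
  ultimately have "vectorspace class_ring M"
    using assms(7-11)
    by (intro vectorspace.intro Module.module.intro Module.module_axioms.intro) (auto simp: field_def domain_def)
  then show ?thesis by (rule class_vectorspace.intro)
qed

text \<open>The action on the limit is well defined because each \<open>x k\<close> is equivariant along \<open>e k\<close>.\<close>

locale lie_system =
  fixes L :: "nat \<Rightarrow> ('a::field, 'g) lie_alg" and e :: "nat \<Rightarrow> 'g \<Rightarrow> 'g"
    and X :: "nat \<Rightarrow> ('a, 'v, 'g) lie_mod" and x :: "nat \<Rightarrow> 'v \<Rightarrow> 'v"
  assumes e_in: "1 \<le> k \<Longrightarrow> A \<in> carrier (L k) \<Longrightarrow> e k A \<in> carrier (L (k + 1))"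
    and stage: "1 \<le> k \<Longrightarrow> lie_module (L k) (X k)"
    and x_hom: "1 \<le> k \<Longrightarrow> x k \<in> lie_hom (L k) (X k) (lie_pullback (e k) (X (k + 1)))"
begin

lemma stage_rep: "1 \<le> k \<Longrightarrow> lie_rep (L k) (X k)"
  using stage by (rule lie_rep.intro)

lemma stage_vectorspace: "1 \<le> k \<Longrightarrow> class_vectorspace (X k)"
  using stage by (auto simp: class_vectorspace_def lie_module_def)

lemma x_facts:
  assumes k: "1 \<le> k"
  shows "u \<in> carrier (X k) \<Longrightarrow> x k u \<in> carrier (X (k + 1))"
    and "u \<in> carrier (X k) \<Longrightarrow> v \<in> carrier (X k) \<Longrightarrow>
      x k (u \<oplus>\<^bsub>X k\<^esub> v) = x k u \<oplus>\<^bsub>X (k + 1)\<^esub> x k v"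
    and "u \<in> carrier (X k) \<Longrightarrow> x k (c \<odot>\<^bsub>X k\<^esub> u) = c \<odot>\<^bsub>X (k + 1)\<^esub> x k u"
    and "A \<in> carrier (L k) \<Longrightarrow> u \<in> carrier (X k) \<Longrightarrow>
      x k (act (X k) A u) = act (X (k + 1)) (e k A) (x k u)"
    and "x k \<zero>\<^bsub>X k\<^esub> = \<zero>\<^bsub>X (k + 1)\<^esub>"
  using lie_hom_facts(3-7)[OF x_hom[OF k]] by (auto simp: lie_pullback_def)

sublocale M: direct_system "\<lambda>k. carrier (X k)" x
  by unfold_locales (rule x_facts(1))

sublocale A: direct_system "\<lambda>k. carrier (L k)" e
  by unfold_locales (rule e_in)

abbreviation "dlim \<equiv> lim_mod X x"

lemma carrier_lim: "carrier dlim = dl_set (\<lambda>k. carrier (X k)) x"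
  by (simp add: lim_mod_def Let_def)

lemma cls_in_lim [simp]: "1 \<le> k \<Longrightarrow> u \<in> carrier (X k) \<Longrightarrow> M.cls k u \<in> carrier dlim"
  by (simp add: carrier_lim)

lemma lim_cases:
  assumes "P \<in> carrier dlim"
  obtains k where "1 \<le> k" "\<And>p. k \<le> p \<Longrightarrow> \<exists>u\<in>carrier (X p). P = M.cls p u"
  using M.representatives[of P] assms unfolding carrier_lim by blast

lemma lim_cases2:
  assumes "P \<in> carrier dlim" "Q \<in> carrier dlim"
  obtains k u v where "1 \<le> k" "u \<in> carrier (X k)" "P = M.cls k u" "v \<in> carrier (X k)" "Q = M.cls k v"
proof -
  obtain k l where k: "1 \<le> k" "\<And>p. k \<le> p \<Longrightarrow> \<exists>u\<in>carrier (X p). P = M.cls p u"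
    and l: "1 \<le> l" "\<And>p. l \<le> p \<Longrightarrow> \<exists>u\<in>carrier (X p). Q = M.cls p u"
    using lim_cases[OF assms(1)] lim_cases[OF assms(2)] by metis
  have "1 \<le> max k l" using k by simp
  then show ?thesis using k(2)[of "max k l"] l(2)[of "max k l"] that by auto
qed

lemma lim_add:
  assumes "1 \<le> k" "u \<in> carrier (X k)" "v \<in> carrier (X k)"
  shows "M.cls k u \<oplus>\<^bsub>dlim\<^esub> M.cls k v = M.cls k (u \<oplus>\<^bsub>X k\<^esub> v)"
proof -
  have "u \<oplus>\<^bsub>X k\<^esub> v \<in> carrier (X k)" if "1 \<le> k" "u \<in> carrier (X k)" "v \<in> carrier (X k)" for k u v
  proof -
    interpret class_vectorspace "X k" using that(1) by (rule stage_vectorspace)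
    show ?thesis using that by simp
  qed
  then show ?thesis
    using dl_op2_cls[OF M.direct_system_axioms M.direct_system_axioms M.direct_system_axioms,
        of "\<lambda>k. add (X k)" k u v] x_facts(2) assms
    by (simp add: lim_mod_def Let_def)
qed

lemma lim_scale:
  assumes "1 \<le> k" "u \<in> carrier (X k)"
  shows "c \<odot>\<^bsub>dlim\<^esub> M.cls k u = M.cls k (c \<odot>\<^bsub>X k\<^esub> u)"
proof -
  have "c \<odot>\<^bsub>X k\<^esub> u \<in> carrier (X k)" if "1 \<le> k" "u \<in> carrier (X k)" for k u
  proof -
    interpret class_vectorspace "X k" using that(1) by (rule stage_vectorspace)
    show ?thesis using that by simp
  qed
  then show ?thesis
    using dl_op1_cls[OF M.direct_system_axioms M.direct_system_axioms,
        of "\<lambda>k. smult (X k) c" k u] x_facts(3) assms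
    by (simp add: lim_mod_def Let_def)
qed

lemma lim_act:
  assumes "1 \<le> k" "A \<in> carrier (L k)" "u \<in> carrier (X k)"
  shows "act dlim (A.cls k A) (M.cls k u) = M.cls k (act (X k) A u)"
proof -
  have "act (X k) A u \<in> carrier (X k)" if "1 \<le> k" "A \<in> carrier (L k)" "u \<in> carrier (X k)" for k A u
    using lie_rep.act_closed[OF stage_rep] that by blast
  then show ?thesis
    using dl_op2_cls[OF A.direct_system_axioms M.direct_system_axioms M.direct_system_axioms,
        of "\<lambda>k. act (X k)" k A u] x_facts(4) assms
    by (simp add: lim_mod_def Let_def)
qed

lemma lim_zero:
  assumes "1 \<le> k"
  shows "\<zero>\<^bsub>dlim\<^esub> = M.cls k \<zero>\<^bsub>X k\<^esub>"
  using assms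
proof (induction rule: dec_induct)
  case base
  then show ?case by (simp add: lim_mod_def Let_def)
next
  case (step k)
  interpret class_vectorspace "X k" using step(1) by (rule stage_vectorspace)
  show ?case using M.cls_step[OF step(1) zero_closed] x_facts(5)[OF step(1)] step.IH by simp
qed

lemma lim_vectorspace: "class_vectorspace dlim"
proof (rule class_vectorspaceI)
  fix P Q R assume P: "P \<in> carrier dlim"
  obtain k u where k: "1 \<le> k" "u \<in> carrier (X k)" "P = M.cls k u"
    using lim_cases2[OF P P] by blast
  interpret X: class_vectorspace "X k" using k(1) by (rule stage_vectorspace)
  show "\<zero>\<^bsub>dlim\<^esub> \<oplus>\<^bsub>dlim\<^esub> P = P"
    using k by (simp add: lim_zero[OF k(1)] lim_add)
  show "(- 1) \<odot>\<^bsub>dlim\<^esub> P \<oplus>\<^bsub>dlim\<^esub> P = \<zero>\<^bsub>dlim\<^esub>"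
    using k X.scale_add_left[of u "- 1" 1] by (simp add: lim_zero[OF k(1)] lim_add lim_scale)
  fix c d :: 'a
  show "c \<odot>\<^bsub>dlim\<^esub> P \<in> carrier dlim" using k by (simp add: lim_scale)
  show "(c + d) \<odot>\<^bsub>dlim\<^esub> P = c \<odot>\<^bsub>dlim\<^esub> P \<oplus>\<^bsub>dlim\<^esub> d \<odot>\<^bsub>dlim\<^esub> P"
    using k by (simp add: lim_scale lim_add X.scale_add_left)
  show "(c * d) \<odot>\<^bsub>dlim\<^esub> P = c \<odot>\<^bsub>dlim\<^esub> (d \<odot>\<^bsub>dlim\<^esub> P)"
    using k by (simp add: lim_scale)
  show "1 \<odot>\<^bsub>dlim\<^esub> P = P" using k by (simp add: lim_scale)
next
  fix P Q assume P: "P \<in> carrier dlim" and Q: "Q \<in> carrier dlim"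
  obtain k u v where k: "1 \<le> k" "u \<in> carrier (X k)" "P = M.cls k u" "v \<in> carrier (X k)" "Q = M.cls k v"
    using lim_cases2[OF P Q] by blast
  interpret X: class_vectorspace "X k" using k(1) by (rule stage_vectorspace)
  show "P \<oplus>\<^bsub>dlim\<^esub> Q \<in> carrier dlim" using k by (simp add: lim_add)
  show "P \<oplus>\<^bsub>dlim\<^esub> Q = Q \<oplus>\<^bsub>dlim\<^esub> P" using k by (simp add: lim_add X.a_comm)
  show "c \<odot>\<^bsub>dlim\<^esub> (P \<oplus>\<^bsub>dlim\<^esub> Q) = c \<odot>\<^bsub>dlim\<^esub> P \<oplus>\<^bsub>dlim\<^esub> c \<odot>\<^bsub>dlim\<^esub> Q" for c
    using k by (simp add: lim_add lim_scale X.scale_add_right)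
  fix R assume R: "R \<in> carrier dlim"
  obtain l where l: "1 \<le> l" "\<And>p. l \<le> p \<Longrightarrow> \<exists>u\<in>carrier (X p). R = M.cls p u"
    using lim_cases[OF R] by metis
  let ?p = "max k l"
  have p: "1 \<le> ?p" "k \<le> ?p" using k by auto
  obtain w where w: "w \<in> carrier (X ?p)" "R = M.cls ?p w" using l(2)[of ?p] by auto
  have u: "dl_trans x k ?p u \<in> carrier (X ?p)" "P = M.cls ?p (dl_trans x k ?p u)"
    and v: "dl_trans x k ?p v \<in> carrier (X ?p)" "Q = M.cls ?p (dl_trans x k ?p v)"
    using k M.trans_in[OF k(1) _ p(2)] M.cls_trans[OF k(1) _ p(2)] by simp_all
  interpret Xp: class_vectorspace "X ?p" using p(1) by (rule stage_vectorspace)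
  show "P \<oplus>\<^bsub>dlim\<^esub> Q \<oplus>\<^bsub>dlim\<^esub> R = P \<oplus>\<^bsub>dlim\<^esub> (Q \<oplus>\<^bsub>dlim\<^esub> R)"
    unfolding u(2) v(2) w(2) using u(1) v(1) w(1) p(1) by (simp add: lim_add Xp.a_assoc)
next
  interpret X: class_vectorspace "X 1" by (rule stage_vectorspace) simp
  have "M.cls 1 \<zero>\<^bsub>X 1\<^esub> \<in> carrier dlim" by (rule cls_in_lim[OF order_refl X.zero_closed])
  then show "\<zero>\<^bsub>dlim\<^esub> \<in> carrier dlim" by (simp only: lim_zero[OF order_refl])
qed

end

locale simple_lie_system = lie_system +
  assumes simple: "1 \<le> k \<Longrightarrow> lie_simple (L k) (X k)"
    and x_nonzero: "1 \<le> k \<Longrightarrow> \<exists>u\<in>carrier (X k). x k u \<noteq> \<zero>\<^bsub>X (k + 1)\<^esub>"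
begin

lemma x_inj:
  assumes k: "1 \<le> k"
  shows "inj_on (x k) (carrier (X k))"
proof -
  interpret X': lie_rep "L (k + 1)" "X (k + 1)" by (rule stage_rep) simp
  obtain u where "u \<in> carrier (X k)" "x k u \<noteq> \<zero>\<^bsub>X (k + 1)\<^esub>" using x_nonzero[OF k] by blast
  then show ?thesis
    using X'.act_zero[OF e_in[OF k]]
    by (intro lie_hom_inj_on[OF simple[OF k] x_hom[OF k]]) (auto simp: lie_pullback_def)
qed

lemma cls_eqD:
  "1 \<le> k \<Longrightarrow> u \<in> carrier (X k) \<Longrightarrow> v \<in> carrier (X k) \<Longrightarrow> M.cls k u = M.cls k v \<Longrightarrow> u = v"
  using M.cls_inj[OF x_inj] by blast

end

locale lie_system_pair = X: lie_system L e X x + Y: lie_system L e Y y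
  for L :: "nat \<Rightarrow> ('a::field, 'g) lie_alg" and e
    and X :: "nat \<Rightarrow> ('a, 'v, 'g) lie_mod" and x
    and Y :: "nat \<Rightarrow> ('a, 'w, 'g) lie_mod" and y
begin

lemma carrier_lim_alg: "carrier (lim_alg L e) = dl_set (\<lambda>k. carrier (L k)) e"
  by (simp add: lim_alg_def Let_def)

text \<open>The induced map sends the class of \<open>(p, u)\<close> to the class of \<open>(p, \<psi> p u)\<close> for any \<open>p \<ge> k0\<close>. That
\<open>\<psi>\<close> commutes with the transition maps makes this well defined, and injectivity of the \<open>\<psi> p\<close> makes it
injective.\<close>

lemma stages_iso_imp_lim_iso:
  assumes k0: "1 \<le> k0"
    and iso: "\<And>k. k0 \<le> k \<Longrightarrow> \<psi> k \<in> lie_iso (L k) (X k) (Y k)"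
    and comm: "\<And>k u. k0 \<le> k \<Longrightarrow> u \<in> carrier (X k) \<Longrightarrow> \<psi> (k + 1) (x k u) = y k (\<psi> k u)"
  shows "lie_isomorphic (lim_alg L e) (lim_mod X x) (lim_mod Y y)"
proof -
  note hom = iso[unfolded lie_iso_def, THEN CollectD, THEN conjunct1]
  have bij: "bij_betw (\<psi> k) (carrier (X k)) (carrier (Y k))" if "k0 \<le> k" for k
    using iso[OF that] by (simp add: lie_iso_def)
  have psi_in: "\<psi> k u \<in> carrier (Y k)" if "k0 \<le> k" "u \<in> carrier (X k)" for k u
    using lie_hom_facts(3)[OF hom[OF that(1)] that(2)] .
  have tr: "\<psi> p (dl_trans x k p u) = dl_trans y k p (\<psi> k u)" if "k0 \<le> k" "u \<in> carrier (X k)" "k \<le> p" for k p u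
    using that(3)
  proof (induction rule: dec_induct)
    case (step p)
    have "dl_trans x k p u \<in> carrier (X p)" using X.M.trans_in[of k u p] that k0 step by simp
    then show ?case using step that comm[of p "dl_trans x k p u"] by (simp add: dl_trans_Suc)
  qed simp
  have eq_iff: "Y.M.cls p (\<psi> p u) = Y.M.cls q (\<psi> q v) \<longleftrightarrow> X.M.cls p u = X.M.cls q v"
    if p: "k0 \<le> p" "u \<in> carrier (X p)" and q: "k0 \<le> q" "v \<in> carrier (X q)" for p q u v
  proof -
    have pq: "1 \<le> p" "1 \<le> q" using p q k0 by auto
    have "dl_trans y p r (\<psi> p u) = dl_trans y q r (\<psi> q v) \<longleftrightarrow> dl_trans x p r u = dl_trans x q r v"
      if r: "p \<le> r" "q \<le> r" for r
    proof -
      have "dl_trans x p r u \<in> carrier (X r)" "dl_trans x q r v \<in> carrier (X r)"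
        using X.M.trans_in[OF pq(1) p(2) r(1)] X.M.trans_in[OF pq(2) q(2) r(2)] .
      then show ?thesis
        unfolding tr[OF p r(1), symmetric] tr[OF q r(2), symmetric]
        using bij[of r] p r by (auto simp: bij_betw_def inj_on_def)
    qed
    then show ?thesis
      using Y.M.cls_eq_iff[OF pq(1) psi_in[OF p] pq(2) psi_in[OF q]] X.M.cls_eq_iff[OF pq(1) p(2) pq(2) q(2)]
      by blast
  qed
  define \<Phi> where "\<Phi> P = (THE Q. \<exists>p\<ge>k0. \<exists>u\<in>carrier (X p). P = X.M.cls p u \<and> Q = Y.M.cls p (\<psi> p u))" for P
  have Phi: "\<Phi> (X.M.cls p u) = Y.M.cls p (\<psi> p u)" if "k0 \<le> p" "u \<in> carrier (X p)" for p u
    unfolding \<Phi>_def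
  proof (rule the_equality)
    show "\<exists>q\<ge>k0. \<exists>v\<in>carrier (X q). X.M.cls p u = X.M.cls q v \<and> Y.M.cls p (\<psi> p u) = Y.M.cls q (\<psi> q v)"
      using that by blast
    show "Q = Y.M.cls p (\<psi> p u)"
      if ex: "\<exists>q\<ge>k0. \<exists>v\<in>carrier (X q). X.M.cls p u = X.M.cls q v \<and> Q = Y.M.cls q (\<psi> q v)" for Q
    proof -
      obtain q v where q: "k0 \<le> q" "v \<in> carrier (X q)" "X.M.cls p u = X.M.cls q v" "Q = Y.M.cls q (\<psi> q v)"
        using ex by blast
      then show ?thesis using eq_iff[OF \<open>k0 \<le> p\<close> \<open>u \<in> carrier (X p)\<close> q(1,2)] by simp
    qed
  qed
  have rep: "\<exists>p u v. k0 \<le> p \<and> 1 \<le> p \<and> u \<in> carrier (X p) \<and> v \<in> carrier (X p) \<and> P = X.M.cls p u \<and> Q = X.M.cls p v"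
    if "P \<in> carrier X.dlim" "Q \<in> carrier X.dlim" for P Q
  proof -
    obtain k u v where k: "1 \<le> k" "u \<in> carrier (X k)" "P = X.M.cls k u" "v \<in> carrier (X k)" "Q = X.M.cls k v"
      using X.lim_cases2[OF \<open>P \<in> carrier X.dlim\<close> \<open>Q \<in> carrier X.dlim\<close>] .
    let ?p = "max k k0"
    have p: "k \<le> ?p" "k0 \<le> ?p" "1 \<le> ?p" using k(1) by auto
    have "P = X.M.cls ?p (dl_trans x k ?p u)" "Q = X.M.cls ?p (dl_trans x k ?p v)"
      unfolding k(3,5) using X.M.cls_trans[OF k(1,2) p(1)] X.M.cls_trans[OF k(1,4) p(1)] by simp_all
    then show ?thesis
      using p X.M.trans_in[OF k(1,2) p(1)] X.M.trans_in[OF k(1,4) p(1)] by blast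
  qed
  have "\<Phi> \<in> lie_hom (lim_alg L e) X.dlim Y.dlim"
  proof (rule lie_homI[OF X.lim_vectorspace Y.lim_vectorspace])
    fix P Q assume PQ: "P \<in> carrier X.dlim" "Q \<in> carrier X.dlim"
    obtain p u v where p: "k0 \<le> p" "1 \<le> p" "u \<in> carrier (X p)" "v \<in> carrier (X p)" "P = X.M.cls p u" "Q = X.M.cls p v"
      using rep[OF PQ] by blast
    interpret Xp: class_vectorspace "X p" using p(2) by (rule X.stage_vectorspace)
    note h = lie_hom_facts(4)[OF hom[OF p(1)]]
    show "\<Phi> (P \<oplus>\<^bsub>X.dlim\<^esub> Q) = \<Phi> P \<oplus>\<^bsub>Y.dlim\<^esub> \<Phi> Q"
      using p by (simp add: X.lim_add Y.lim_add Phi psi_in h)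
  next
    fix P assume P: "P \<in> carrier X.dlim"
    obtain p u where p: "k0 \<le> p" "1 \<le> p" "u \<in> carrier (X p)" "P = X.M.cls p u"
      using rep[OF P P] by blast
    interpret Xp: class_vectorspace "X p" using p(2) by (rule X.stage_vectorspace)
    note h = lie_hom_facts(5)[OF hom[OF p(1)]]
    show "\<Phi> P \<in> carrier Y.dlim" using p by (simp add: Phi psi_in)
    show "\<Phi> (c \<odot>\<^bsub>X.dlim\<^esub> P) = c \<odot>\<^bsub>Y.dlim\<^esub> \<Phi> P" for c
      using p by (simp add: X.lim_scale Y.lim_scale Phi psi_in h)
  next
    fix A P assume "A \<in> carrier (lim_alg L e)" and P: "P \<in> carrier X.dlim"
    then obtain k where k: "1 \<le> k" "\<And>q. k \<le> q \<Longrightarrow> \<exists>B\<in>carrier (L q). A = X.A.cls q B"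
      using X.A.representatives[of A] unfolding carrier_lim_alg by metis
    obtain l where l: "1 \<le> l" "\<And>q. l \<le> q \<Longrightarrow> \<exists>u\<in>carrier (X q). P = X.M.cls q u"
      using X.lim_cases[OF P] by metis
    define q where "q = max k0 (max k l)"
    have q: "k0 \<le> q" "k \<le> q" "l \<le> q" "1 \<le> q" using k l by (auto simp: q_def)
    obtain B u where B: "B \<in> carrier (L q)" "A = X.A.cls q B" and u: "u \<in> carrier (X q)" "P = X.M.cls q u"
      using k(2)[OF q(2)] l(2)[OF q(3)] by blast
    have "act (X q) B u \<in> carrier (X q)"
      using lie_rep.act_closed[OF X.stage_rep[OF q(4)] B(1) u(1)] .
    then show "\<Phi> (act X.dlim A P) = act Y.dlim A (\<Phi> P)"
      using q B u lie_hom_facts(6)[OF hom[OF q(1)] B(1) u(1)]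
      by (simp add: X.lim_act Y.lim_act Phi psi_in)
  qed
  moreover have "bij_betw \<Phi> (carrier X.dlim) (carrier Y.dlim)"
  proof (rule bij_betwI')
    fix P Q assume PQ: "P \<in> carrier X.dlim" "Q \<in> carrier X.dlim"
    obtain p u v where p: "k0 \<le> p" "1 \<le> p" "u \<in> carrier (X p)" "v \<in> carrier (X p)" "P = X.M.cls p u" "Q = X.M.cls p v"
      using rep[OF PQ] by blast
    show "(\<Phi> P = \<Phi> Q) = (P = Q)" using p eq_iff by (simp add: Phi)
    show "\<Phi> P \<in> carrier Y.dlim" using p by (simp add: Phi psi_in)
  next
    fix Q assume "Q \<in> carrier Y.dlim"
    then obtain l where l: "1 \<le> l" "\<And>q. l \<le> q \<Longrightarrow> \<exists>v\<in>carrier (Y q). Q = Y.M.cls q v"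
      using Y.lim_cases by metis
    define q where "q = max k0 l"
    have q: "k0 \<le> q" "l \<le> q" "1 \<le> q" using l by (auto simp: q_def)
    obtain v where v: "v \<in> carrier (Y q)" "Q = Y.M.cls q v" using l(2)[OF q(2)] by blast
    obtain u where u: "u \<in> carrier (X q)" "v = \<psi> q u"
      using bij[OF q(1)] v(1) by (auto simp: bij_betw_def)
    show "\<exists>P\<in>carrier X.dlim. Q = \<Phi> P"
      using q u v by (intro bexI[of _ "X.M.cls q u"]) (simp_all add: Phi)
  qed
  ultimately show ?thesis by (auto simp: lie_isomorphic_def lie_iso_def)
qed

end

locale simple_lie_system_pair = X: simple_lie_system L e X x + Y: simple_lie_system L e Y y
  for L :: "nat \<Rightarrow> ('a::field, 'g) lie_alg" and e
    and X :: "nat \<Rightarrow> ('a, 'v, 'g) lie_mod" and x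
    and Y :: "nat \<Rightarrow> ('a, 'w, 'g) lie_mod" and y
begin

sublocale lie_system_pair L e X x Y y ..

text \<open>The decisive use of simplicity. The stage \<open>l\<close> is one where the image of a single nonzero vector of the
first module is represented; at each later stage \<open>k\<close> the elements of \<open>X k\<close> that are mapped to classes
represented in \<open>Y k\<close> form a submodule that contains the image of this vector.\<close>

lemma lim_iso_imp_stage_homs:
  assumes iso: "\<Phi> \<in> lie_iso (lim_alg L e) (lim_mod X x) (lim_mod Y y)"
  shows "\<exists>l\<ge>1. \<exists>\<phi>. \<forall>k\<ge>l. \<phi> k \<in> lie_hom (L k) (X k) (Y k) \<and> inj_on (\<phi> k) (carrier (X k)) \<and>
    (\<forall>u\<in>carrier (X k). \<phi> (k + 1) (x k u) = y k (\<phi> k u))"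
proof -
  have hom: "\<Phi> \<in> lie_hom (lim_alg L e) X.dlim Y.dlim" and bij: "bij_betw \<Phi> (carrier X.dlim) (carrier Y.dlim)"
    using iso by (auto simp: lie_iso_def)
  note h = lie_hom_facts[OF hom]
  interpret Xl: class_vectorspace X.dlim by (rule X.lim_vectorspace)
  interpret Yl: class_vectorspace Y.dlim by (rule Y.lim_vectorspace)
  interpret X1: class_vectorspace "X 1" by (rule X.stage_vectorspace) simp
  obtain v where v: "v \<in> carrier (X 1)" "x 1 v \<noteq> \<zero>\<^bsub>X (1 + 1)\<^esub>" using X.x_nonzero[of 1] by auto
  then have v0: "v \<noteq> \<zero>\<^bsub>X 1\<^esub>" using X.x_facts(5)[of 1] by auto
  have "\<Phi> (X.M.cls 1 v) \<in> carrier Y.dlim" using v by (intro h) simp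
  then obtain l where l: "1 \<le> l" "\<And>k. l \<le> k \<Longrightarrow> \<exists>w\<in>carrier (Y k). \<Phi> (X.M.cls 1 v) = Y.M.cls k w"
    using Y.lim_cases by metis
  have ex: "\<exists>w\<in>carrier (Y k). \<Phi> (X.M.cls k u) = Y.M.cls k w" if k: "l \<le> k" and u: "u \<in> carrier (X k)" for k u
  proof -
    have k1: "1 \<le> k" using k l by simp
    interpret Xk: simple_lie_rep "L k" "X k" using X.simple[OF k1] by (rule simple_lie_repI)
    interpret Yk: simple_lie_rep "L k" "Y k" using Y.simple[OF k1] by (rule simple_lie_repI)
    let ?W = "{u \<in> carrier (X k). \<exists>w\<in>carrier (Y k). \<Phi> (X.M.cls k u) = Y.M.cls k w}"
    have "lie_submodule (L k) ?W (X k)"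
    proof (rule Xk.lie_submoduleI)
      show "\<zero>\<^bsub>X k\<^esub> \<in> ?W"
        using h(7) X.lim_zero[OF k1] Y.lim_zero[OF k1] Yk.zero_closed by auto
      show "u \<oplus>\<^bsub>X k\<^esub> u' \<in> ?W" if uu: "u \<in> ?W" "u' \<in> ?W" for u u'
      proof -
        obtain w w' where w: "w \<in> carrier (Y k)" "\<Phi> (X.M.cls k u) = Y.M.cls k w"
          "w' \<in> carrier (Y k)" "\<Phi> (X.M.cls k u') = Y.M.cls k w'" using uu by blast
        have "\<Phi> (X.M.cls k (u \<oplus>\<^bsub>X k\<^esub> u')) = \<Phi> (X.M.cls k u) \<oplus>\<^bsub>Y.dlim\<^esub> \<Phi> (X.M.cls k u')"
          using uu k1 by (simp add: h(4) flip: X.lim_add)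
        also have "\<dots> = Y.M.cls k (w \<oplus>\<^bsub>Y k\<^esub> w')" using w k1 by (simp add: Y.lim_add)
        finally show ?thesis using uu w by blast
      qed
      show "c \<odot>\<^bsub>X k\<^esub> u \<in> ?W" if uu: "u \<in> ?W" for c u
      proof -
        obtain w where w: "w \<in> carrier (Y k)" "\<Phi> (X.M.cls k u) = Y.M.cls k w" using uu by blast
        have "\<Phi> (X.M.cls k (c \<odot>\<^bsub>X k\<^esub> u)) = c \<odot>\<^bsub>Y.dlim\<^esub> \<Phi> (X.M.cls k u)"
          using uu k1 by (simp add: h(5) flip: X.lim_scale)
        also have "\<dots> = Y.M.cls k (c \<odot>\<^bsub>Y k\<^esub> w)" using w k1 by (simp add: Y.lim_scale)
        finally show ?thesis using uu w by blast
      qed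
      show "act (X k) A u \<in> ?W" if A: "A \<in> carrier (L k)" and uu: "u \<in> ?W" for A u
      proof -
        obtain w where w: "w \<in> carrier (Y k)" "\<Phi> (X.M.cls k u) = Y.M.cls k w" using uu by blast
        have "X.A.cls k A \<in> carrier (lim_alg L e)" using A k1 by (simp add: carrier_lim_alg)
        then have "\<Phi> (X.M.cls k (act (X k) A u)) = act Y.dlim (X.A.cls k A) (\<Phi> (X.M.cls k u))"
          using uu k1 A by (simp add: h(6) flip: X.lim_act)
        also have "\<dots> = Y.M.cls k (act (Y k) A w)" using w k1 A by (simp add: Y.lim_act)
        finally show ?thesis using uu w A by blast
      qed
    qed auto
    moreover have "dl_trans x 1 k v \<in> ?W"
      using X.M.trans_in[of 1 v k] X.M.cls_trans[of 1 v k] v k1 l(2)[OF k] by simp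
    moreover have "dl_trans x 1 k v \<noteq> \<zero>\<^bsub>X k\<^esub>"
    proof
      assume "dl_trans x 1 k v = \<zero>\<^bsub>X k\<^esub>"
      then have "X.M.cls 1 v = X.M.cls 1 \<zero>\<^bsub>X 1\<^esub>"
        using X.M.cls_trans[of 1 v k] v k1 X.lim_zero[OF k1] X.lim_zero[of 1] by simp
      moreover have "\<zero>\<^bsub>X 1\<^esub> \<in> carrier (X 1)" by (rule X1.zero_closed)
      ultimately show False using X.cls_eqD[of 1 v] v v0 by simp
    qed
    ultimately have "?W = carrier (X k)" by (rule Xk.simple_eqI)
    then show ?thesis using u by blast
  qed
  define \<phi> where "\<phi> k u = (SOME w. w \<in> carrier (Y k) \<and> \<Phi> (X.M.cls k u) = Y.M.cls k w)" for k u
  have phi: "\<phi> k u \<in> carrier (Y k)" "\<Phi> (X.M.cls k u) = Y.M.cls k (\<phi> k u)"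
    if "l \<le> k" "u \<in> carrier (X k)" for k u
    using someI_ex[of "\<lambda>w. w \<in> carrier (Y k) \<and> \<Phi> (X.M.cls k u) = Y.M.cls k w"] ex[OF that]
    unfolding \<phi>_def by blast+
  have phi_eq: "\<phi> k u = w" if "l \<le> k" "u \<in> carrier (X k)" "w \<in> carrier (Y k)" "\<Phi> (X.M.cls k u) = Y.M.cls k w" for k u w
    using phi[OF that(1,2)] that(3,4) l(1) that(1) by (intro Y.cls_eqD[of k]) auto
  have "\<phi> k \<in> lie_hom (L k) (X k) (Y k)" if k: "l \<le> k" for k
  proof -
    have k1: "1 \<le> k" using k l by simp
    interpret Xk: lie_rep "L k" "X k" using k1 by (rule X.stage_rep)
    interpret Yk: lie_rep "L k" "Y k" using k1 by (rule Y.stage_rep)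
    show ?thesis
    proof (rule lie_homI)
      show "class_vectorspace (X k)" "class_vectorspace (Y k)"
        using X.stage_vectorspace[OF k1] Y.stage_vectorspace[OF k1] .
      fix u assume u: "u \<in> carrier (X k)"
      note pu = phi[OF k u]
      show "\<phi> k u \<in> carrier (Y k)" by (rule pu)
      have "\<Phi> (X.M.cls k (c \<odot>\<^bsub>X k\<^esub> u)) = Y.M.cls k (c \<odot>\<^bsub>Y k\<^esub> \<phi> k u)" for c
        using u k1 pu h(5)[of "X.M.cls k u" c] by (simp add: X.lim_scale Y.lim_scale)
      then show "\<phi> k (c \<odot>\<^bsub>X k\<^esub> u) = c \<odot>\<^bsub>Y k\<^esub> \<phi> k u" for c
        using u pu k by (intro phi_eq) auto
      show "\<phi> k (act (X k) A u) = act (Y k) A (\<phi> k u)" if A: "A \<in> carrier (L k)" for A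
      proof -
        have "X.A.cls k A \<in> carrier (lim_alg L e)" using A k1 by (simp add: carrier_lim_alg)
        then have "\<Phi> (X.M.cls k (act (X k) A u)) = Y.M.cls k (act (Y k) A (\<phi> k u))"
          using u k1 pu A h(6)[of "X.A.cls k A" "X.M.cls k u"] by (simp add: X.lim_act Y.lim_act)
        then show ?thesis using u pu k A by (intro phi_eq) auto
      qed
      fix u' assume u': "u' \<in> carrier (X k)"
      note pu' = phi[OF k u']
      have "\<Phi> (X.M.cls k (u \<oplus>\<^bsub>X k\<^esub> u')) = Y.M.cls k (\<phi> k u \<oplus>\<^bsub>Y k\<^esub> \<phi> k u')"
        using u u' k1 pu pu' h(4)[of "X.M.cls k u" "X.M.cls k u'"] by (simp add: X.lim_add Y.lim_add)
      then show "\<phi> k (u \<oplus>\<^bsub>X k\<^esub> u') = \<phi> k u \<oplus>\<^bsub>Y k\<^esub> \<phi> k u'"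
        using u u' pu pu' k by (intro phi_eq) auto
    qed
  qed
  moreover have "inj_on (\<phi> k) (carrier (X k))" if k: "l \<le> k" for k
  proof (rule inj_onI)
    fix u u' assume u: "u \<in> carrier (X k)" "u' \<in> carrier (X k)" "\<phi> k u = \<phi> k u'"
    have k1: "1 \<le> k" using k l by simp
    have "\<Phi> (X.M.cls k u) = \<Phi> (X.M.cls k u')" using phi(2)[OF k] u by simp
    then have "X.M.cls k u = X.M.cls k u'"
      using bij u k1 by (auto simp: bij_betw_def dest: inj_onD)
    then show "u = u'" using X.cls_eqD k1 u by blast
  qed
  moreover have "\<phi> (k + 1) (x k u) = y k (\<phi> k u)" if k: "l \<le> k" and u: "u \<in> carrier (X k)" for k u
  proof (rule phi_eq)
    have k1: "1 \<le> k" using k l by simp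
    show "l \<le> k + 1" using k by simp
    show "x k u \<in> carrier (X (k + 1))" "y k (\<phi> k u) \<in> carrier (Y (k + 1))"
      using X.x_facts(1)[OF k1 u] Y.x_facts(1)[OF k1 phi(1)[OF k u]] .
    show "\<Phi> (X.M.cls (k + 1) (x k u)) = Y.M.cls (k + 1) (y k (\<phi> k u))"
      unfolding X.M.cls_step[OF k1 u] Y.M.cls_step[OF k1 phi(1)[OF k u]] by (rule phi(2)[OF k u])
  qed
  ultimately show ?thesis using l(1) by blast
qed

end

section \<open>The diagonal embeddings\<close>

lemma diag_emb_0 [simp]: "diag_emb 0 A = 0\<^sub>m 0 0"
  by (simp add: diag_emb_def)

lemma diag_emb_carrier:
  assumes "A \<in> carrier_mat m m"
  shows "diag_emb n A \<in> carrier_mat (n * m) (n * m)"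
proof (induction n)
  case (Suc n)
  have "diag_emb (Suc n) A \<in> carrier_mat (m + n * m) (m + n * m)"
    using four_block_carrier_mat[OF assms Suc.IH] by (simp add: diag_emb_def Let_def)
  then show ?case by simp
qed simp

lemma diag_emb_Suc:
  assumes "A \<in> carrier_mat m m"
  shows "diag_emb (Suc n) A = four_block_mat A (0\<^sub>m m (n * m)) (0\<^sub>m (n * m) m) (diag_emb n A)"
proof -
  have "dim_row A = m" "dim_col A = m" "dim_row (diag_emb n A) = n * m" "dim_col (diag_emb n A) = n * m"
    using assms carrier_matD[OF diag_emb_carrier[OF assms, of n]] by auto
  then show ?thesis by (simp add: diag_emb_def Let_def)
qed

lemma diag_emb_add:
  assumes "A \<in> carrier_mat m m" "C \<in> carrier_mat m m"
  shows "diag_emb n (A + C) = diag_emb n A + diag_emb n C"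
proof (induction n)
  case (Suc n)
  have AC: "A + C \<in> carrier_mat m m" using assms by simp
  note c = diag_emb_carrier[OF assms(1), of n] diag_emb_carrier[OF assms(2), of n]
  show ?case
    unfolding diag_emb_Suc[OF AC] diag_emb_Suc[OF assms(1)] diag_emb_Suc[OF assms(2)] Suc.IH
    using assms c by (subst add_four_block_mat[of _ m m _ "n * m" _ "n * m"]) auto
qed simp

lemma diag_emb_mult:
  assumes "A \<in> carrier_mat m m" "C \<in> carrier_mat m m"
  shows "diag_emb n (A * C) = diag_emb n A * diag_emb n C"
proof (induction n)
  case (Suc n)
  have AC: "A * C \<in> carrier_mat m m" using assms by simp
  note c = diag_emb_carrier[OF assms(1), of n] diag_emb_carrier[OF assms(2), of n]
  show ?case
    unfolding diag_emb_Suc[OF AC] diag_emb_Suc[OF assms(1)] diag_emb_Suc[OF assms(2)] Suc.IH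
    using assms c by (subst mult_four_block_mat[of _ m m _ "n * m" _ "n * m"]) auto
qed auto

lemma diag_emb_transpose:
  assumes "A \<in> carrier_mat m m"
  shows "diag_emb n (transpose_mat A) = transpose_mat (diag_emb n A)"
proof (induction n)
  case (Suc n)
  have At: "transpose_mat A \<in> carrier_mat m m" using assms by simp
  show ?case
    unfolding diag_emb_Suc[OF At] diag_emb_Suc[OF assms] Suc.IH
    using assms diag_emb_carrier[OF assms, of n]
    by (subst transpose_four_block_mat[of _ m m _ "n * m" _ "n * m"]) auto
qed auto

lemma diag_emb_zero: "diag_emb n (0\<^sub>m m m) = 0\<^sub>m (n * m) (n * m)"
proof (induction n)
  case (Suc n)
  show ?case unfolding diag_emb_Suc[OF zero_carrier_mat] Suc.IH by (intro eq_matI) auto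
qed simp

lemma diag_emb_form_matrices:
  assumes "F \<in> carrier_mat m m" "A \<in> form_matrices m F"
  shows "diag_emb n A \<in> form_matrices (n * m) (diag_emb n F)"
proof -
  have A: "A \<in> carrier_mat m m" "transpose_mat A * F + F * A = 0\<^sub>m m m"
    using assms(2) by (auto simp: form_matrices_def)
  have At: "transpose_mat A \<in> carrier_mat m m" using A by simp
  have "transpose_mat (diag_emb n A) * diag_emb n F + diag_emb n F * diag_emb n A
      = diag_emb n (transpose_mat A * F + F * A)"
    using A(1) At assms(1) diag_emb_add[of "transpose_mat A * F" m "F * A" n]
    by (simp add: diag_emb_mult[of _ m] diag_emb_transpose[of _ m])
  then show ?thesis using A diag_emb_carrier[OF A(1), of n] by (simp add: form_matrices_def diag_emb_zero)
qed

lemma diag_emb_one: "diag_emb n (1\<^sub>m m) = 1\<^sub>m (n * m)"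
proof (induction n)
  case (Suc n)
  show ?case unfolding diag_emb_Suc[OF one_carrier_mat] Suc.IH by (intro eq_matI) auto
qed auto

lemma symp_form_carrier [simp]: "symp_form m \<in> carrier_mat m m"
  by (simp add: symp_form_def)

text \<open>For even \<open>m\<close> no pair \<open>{2i, 2i + 1}\<close> is cut by the boundary between the blocks.\<close>

lemma symp_form_block:
  assumes "even m"
  shows "four_block_mat (symp_form m) (0\<^sub>m m k) (0\<^sub>m k m) (symp_form k) = (symp_form (m + k) :: 'a::field mat)"
proof (rule eq_matI)
  define s :: "nat \<Rightarrow> nat \<Rightarrow> 'a" where
    "s i j = (if even i \<and> j = i + 1 then 1 else if odd i \<and> i = j + 1 then - 1 else 0)" for i j
  have s: "(symp_form r :: 'a mat) $$ (i, j) = s i j" if "i < r" "j < r" for r i j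
    using that by (simp add: symp_form_def s_def)
  have dim: "dim_row (symp_form r :: 'a mat) = r" "dim_col (symp_form r :: 'a mat) = r" for r
    by (auto simp: symp_form_def)
  fix i j assume "i < dim_row (symp_form (m + k) :: 'a mat)" "j < dim_col (symp_form (m + k) :: 'a mat)"
  then have ij: "i < m + k" "j < m + k" by (auto simp: dim)
  have even_step: "i + 1 < m" if "even i" "i < m" for i
  proof -
    have "i + 1 \<noteq> m" using that(1) assms by auto
    then show ?thesis using that(2) by simp
  qed
  have block: "four_block_mat (symp_form m) (0\<^sub>m m k) (0\<^sub>m k m) (symp_form k) $$ (i, j) =
      (if i < m then if j < m then s i j else 0 else if j < m then 0 else s (i - m) (j - m))"
    using ij by (simp add: dim s)
  have "s i j = (if i < m then if j < m then s i j else 0 else if j < m then 0 else s (i - m) (j - m))"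
  proof (cases "i < m")
    case True
    then show ?thesis using even_step[of i] by (auto simp: s_def)
  next
    case i: False
    show ?thesis
    proof (cases "j < m")
      case True
      have "i \<noteq> j + 1" if "odd i"
      proof
        assume "i = j + 1"
        with that have "even j" by simp
        then show False using even_step[of j] True i \<open>i = j + 1\<close> by simp
      qed
      moreover have "j \<noteq> i + 1" using i True by simp
      ultimately show ?thesis using i True by (auto simp: s_def)
    next
      case False
      obtain i' j' where "i = m + i'" "j = m + j'"
        using i False by (metis le_add_diff_inverse not_less)
      then show ?thesis using assms by (auto simp: s_def)
    qed
  qed
  then show "four_block_mat (symp_form m) (0\<^sub>m m k) (0\<^sub>m k m) (symp_form k) $$ (i, j) =
      (symp_form (m + k) :: 'a mat) $$ (i, j)"
    unfolding block s[OF ij] by simp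
qed (auto simp: symp_form_def)

lemma diag_emb_symp_form:
  assumes "even m"
  shows "diag_emb n (symp_form m) = symp_form (n * m)"
proof (induction n)
  case 0
  show ?case by (rule eq_matI) (auto simp: symp_form_def)
next
  case (Suc n)
  show ?case
    unfolding diag_emb_Suc[OF symp_form_carrier] Suc.IH symp_form_block[OF assms] by simp
qed

lemma diag_emb_trace:
  assumes "A \<in> carrier_mat m m"
  shows "(\<Sum>i<n * m. diag_emb n A $$ (i, i)) = of_nat n * (\<Sum>i<m. A $$ (i, i))"
proof (induction n)
  case (Suc n)
  have split: "(\<Sum>i<m + k. f i) = (\<Sum>i<m. f i) + (\<Sum>i<k. f (m + i))" for f :: "nat \<Rightarrow> 'a" and k
    by (induction k) (auto simp: add.assoc)
  have "(\<Sum>i<m. diag_emb (Suc n) A $$ (i, i)) = (\<Sum>i<m. A $$ (i, i))"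
    unfolding diag_emb_Suc[OF assms] using assms diag_emb_carrier[OF assms, of n]
    by (intro sum.cong) auto
  moreover have "(\<Sum>i<n * m. diag_emb (Suc n) A $$ (m + i, m + i)) = (\<Sum>i<n * m. diag_emb n A $$ (i, i))"
    unfolding diag_emb_Suc[OF assms] using assms diag_emb_carrier[OF assms, of n]
    by (intro sum.cong) auto
  ultimately show ?case using Suc.IH by (simp add: split algebra_simps)
qed simp

text \<open>The trace of a block diagonal matrix is the sum of the traces, and the forms of size \<open>n * m\<close> are
orthogonal sums of \<open>n\<close> copies of the forms of size \<open>m\<close>.\<close>

lemma diag_emb_in_classical:
  fixes A :: "'a::field mat"
  assumes "K = SP \<Longrightarrow> even m" "A \<in> carrier (classical_alg K m)"
  shows "diag_emb n A \<in> carrier (classical_alg K (n * m))"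
proof (cases K)
  case SL
  then have "A \<in> carrier_mat m m" "(\<Sum>i<m. A $$ (i, i)) = 0" using assms(2) by (auto simp: matrix_lie_def)
  then show ?thesis using SL by (simp add: matrix_lie_def diag_emb_trace diag_emb_carrier)
next
  case SP
  have "A \<in> form_matrices m (symp_form m)"
    using assms(2) unfolding SP classical_alg_form by (simp add: matrix_lie_def)
  from diag_emb_form_matrices[OF symp_form_carrier this, of n] show ?thesis
    unfolding SP classical_alg_form using diag_emb_symp_form[OF assms(1)[OF SP], of n, where 'a='a]
    by (simp add: matrix_lie_def)
next
  case SO
  have "A \<in> form_matrices m (1\<^sub>m m)"
    using assms(2) unfolding SO classical_alg_form by (simp add: matrix_lie_def)
  from diag_emb_form_matrices[OF one_carrier_mat this, of n] show ?thesis
    unfolding SO classical_alg_form by (simp add: matrix_lie_def diag_emb_one)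
qed

section \<open>Comparison of simple modules at one stage\<close>

text \<open>The map \<open>h\<close> is \<open>g\<^sup>-\<^sup>1 \<circ> f\<close>; its compatibility with the operations can be checked after applying the injective
map \<open>g\<close>.\<close>

lemma lie_iso_lift:
  assumes M: "lie_module L M" and N: "lie_module L N" and f: "f \<in> lie_iso L M V" and g: "g \<in> lie_iso L N V"
  shows "\<exists>h\<in>lie_iso L M N. \<forall>u\<in>carrier M. g (h u) = f u"
proof -
  interpret M: lie_rep L M using M by (rule lie_rep.intro)
  interpret N: lie_rep L N using N by (rule lie_rep.intro)
  have bij: "bij_betw f (carrier M) (carrier V)" "bij_betw g (carrier N) (carrier V)"
    and hom: "f \<in> lie_hom L M V" "g \<in> lie_hom L N V"
    using f g by (auto simp: lie_iso_def)
  note f' = lie_hom_facts[OF hom(1)] and g' = lie_hom_facts[OF hom(2)]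
  define h where "h = inv_into (carrier N) g \<circ> f"
  have bij_h: "bij_betw h (carrier M) (carrier N)"
    unfolding h_def using bij bij_betw_inv_into bij_betw_trans by blast
  have h: "h u \<in> carrier N" "g (h u) = f u" if "u \<in> carrier M" for u
    using bij_betwE[OF bij_h] that bij_betw_inv_into_right[OF bij(2)] f'(3)[OF that] by (auto simp: h_def)
  have eqI: "h u = w" if "u \<in> carrier M" "w \<in> carrier N" "g w = f u" for u w
    using h[OF that(1)] that bij(2) by (auto simp: bij_betw_def inj_on_def)
  have "h \<in> lie_hom L M N"
  proof (rule lie_homI[OF f'(1) g'(1)])
    fix u assume u: "u \<in> carrier M"
    show "h u \<in> carrier N" by (rule h(1)[OF u])
    show "h (c \<odot>\<^bsub>M\<^esub> u) = c \<odot>\<^bsub>N\<^esub> h u" for c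
      using u h[OF u] by (intro eqI) (auto simp: f' g')
    show "h (act M x u) = act N x (h u)" if "x \<in> carrier L" for x
      using u h[OF u] that by (intro eqI) (auto simp: f' g')
    fix v assume v: "v \<in> carrier M"
    show "h (u \<oplus>\<^bsub>M\<^esub> v) = h u \<oplus>\<^bsub>N\<^esub> h v"
      using u v h[OF u] h[OF v] by (intro eqI) (auto simp: f' g')
  qed
  then show ?thesis using bij_h h by (auto simp: lie_iso_def)
qed

lemma lie_iso_scale:
  assumes N: "lie_module L N" and f: "f \<in> lie_iso L M N" and d: "d \<noteq> 0"
  shows "(\<lambda>u. d \<odot>\<^bsub>N\<^esub> f u) \<in> lie_iso L M N"
proof -
  interpret N: lie_rep L N using N by (rule lie_rep.intro)
  have bij: "bij_betw f (carrier M) (carrier N)" and hom: "f \<in> lie_hom L M N"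
    using f by (auto simp: lie_iso_def)
  note f' = lie_hom_facts[OF hom]
  have "bij_betw (\<lambda>w. d \<odot>\<^bsub>N\<^esub> w) (carrier N) (carrier N)"
    using d by (intro bij_betwI[where g = "\<lambda>w. inverse d \<odot>\<^bsub>N\<^esub> w"]) auto
  from bij_betw_trans[OF bij this] have "bij_betw (\<lambda>u. d \<odot>\<^bsub>N\<^esub> f u) (carrier M) (carrier N)"
    by (simp add: comp_def)
  moreover have "(\<lambda>u. d \<odot>\<^bsub>N\<^esub> f u) \<in> lie_hom L M N"
    by (rule lie_homI[OF f'(1,2)]) (auto simp: f' N.scale_add_right N.act_scale mult.commute)
  ultimately show ?thesis by (simp add: lie_iso_def)
qed

lemma proj_point_eq_iff:
  assumes N: "class_vectorspace N"
    and f: "\<And>v. v \<in> carrier M \<Longrightarrow> f v \<in> carrier N" and g: "\<And>v. v \<in> carrier M \<Longrightarrow> g v \<in> carrier N"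
  shows "proj_point M N f = proj_point M N g \<longleftrightarrow> (\<exists>c. c \<noteq> 0 \<and> (\<forall>v\<in>carrier M. f v = c \<odot>\<^bsub>N\<^esub> g v))"
proof -
  interpret N: class_vectorspace N by (rule N)
  let ?r = "\<lambda>f c. restrict (\<lambda>v. c \<odot>\<^bsub>N\<^esub> f v) (carrier M)"
  show ?thesis
  proof
    assume "proj_point M N f = proj_point M N g"
    moreover have "?r f 1 \<in> proj_point M N f" unfolding proj_point_def by force
    ultimately obtain c where c: "c \<noteq> 0" "?r f 1 = ?r g c" unfolding proj_point_def by auto
    have "f v = c \<odot>\<^bsub>N\<^esub> g v" if "v \<in> carrier M" for v
      using fun_cong[OF c(2), of v] that f[OF that] by simp
    then show "\<exists>c. c \<noteq> 0 \<and> (\<forall>v\<in>carrier M. f v = c \<odot>\<^bsub>N\<^esub> g v)" using c by blast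
  next
    assume "\<exists>c. c \<noteq> 0 \<and> (\<forall>v\<in>carrier M. f v = c \<odot>\<^bsub>N\<^esub> g v)"
    then obtain c where c: "c \<noteq> 0" "\<And>v. v \<in> carrier M \<Longrightarrow> f v = c \<odot>\<^bsub>N\<^esub> g v" by blast
    have fg: "?r f a = ?r g (a * c)" for a using c g by (auto simp: restrict_def)
    have gf: "?r g a = ?r f (a / c)" for a using fg[of "a / c"] c(1) by simp
    show "proj_point M N f = proj_point M N g"
      unfolding proj_point_def
    proof (intro equalityI subsetI)
      fix h assume "h \<in> {?r f a |a. a \<noteq> 0}"
      then obtain a where "a \<noteq> 0" "h = ?r f a" by blast
      then have "a * c \<noteq> 0" "h = ?r g (a * c)" using fg c(1) by auto
      then show "h \<in> {?r g a |a. a \<noteq> 0}" by blast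
    next
      fix h assume "h \<in> {?r g a |a. a \<noteq> 0}"
      then obtain a where "a \<noteq> 0" "h = ?r g a" by blast
      then have "a / c \<noteq> 0" "h = ?r f (a / c)" using gf c(1) by auto
      then show "h \<in> {?r f a |a. a \<noteq> 0}" by blast
    qed
  qed
qed

text \<open>The homomorphism transports the highest weight vector of \<open>M\<close> into \<open>N\<close>, where it meets that of \<open>N\<close>.\<close>

lemma stage_hom_labels_eq:
  fixes M :: "('a::{alg_closed_field, field_char_0}, 'v, 'a mat) lie_mod"
    and N :: "('a, 'w, 'a mat) lie_mod"
  assumes even: "K = SP \<Longrightarrow> even m" and N: "lie_simple (classical_alg K m) N"
    and f: "f \<in> lie_hom (classical_alg K m) M N" "inj_on f (carrier M)"
    and V: "is_V K m lam M" "is_V K m mu N"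
    and len: "total_length lam + total_length mu < m"
  shows "lam = mu"
proof -
  obtain v where v: "hw_vector K m (label_weight m lam) M v" using is_V_hw_vector[OF V(1)] by blast
  obtain w where w: "hw_vector K m (label_weight m mu) N w" using is_V_hw_vector[OF V(2)] by blast
  interpret M: class_vectorspace M by (rule lie_hom_facts(1)[OF f(1)])
  have "v \<in> carrier M" "v \<noteq> \<zero>\<^bsub>M\<^esub>" using v by (auto simp: hw_vector_def)
  then have "f v \<noteq> \<zero>\<^bsub>N\<^esub>"
    using inj_onD[OF f(2), of v "\<zero>\<^bsub>M\<^esub>"] lie_hom_facts(7)[OF f(1)] by auto
  from hw_vector_image[OF f(1) v this]
  have fv: "hw_vector K m (label_weight m lam) N (f v)" .
  show ?thesis
  proof (rule label_determined[OF _ _ _ _ len])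
    show "lam \<in> labels K" "mu \<in> labels K" "label_fits K m lam" "label_fits K m mu"
      using V by (auto simp: is_V_def)
  qed (rule hw_vector_weight_unique[OF even N fv w])
qed

lemma iso_unique_up_to_scalar:
  fixes M :: "('a::{alg_closed_field, field_char_0}, 'v, 'a mat) lie_mod"
    and N :: "('a, 'w, 'a mat) lie_mod"
  assumes even: "K = SP \<Longrightarrow> even m"
    and M: "lie_simple (classical_alg K m) M" and N: "lie_simple (classical_alg K m) N"
    and f: "f \<in> lie_iso (classical_alg K m) M N"
    and g: "g \<in> lie_hom (classical_alg K m) M N" "inj_on g (carrier M)"
    and V: "is_V K m lam M"
  shows "\<exists>c. c \<noteq> 0 \<and> (\<forall>u\<in>carrier M. g u = c \<odot>\<^bsub>N\<^esub> f u)"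
proof -
  have f': "f \<in> lie_hom (classical_alg K m) M N" "inj_on f (carrier M)"
    using f by (auto simp: lie_iso_def bij_betw_def)
  obtain v where hv: "hw_vector K m (label_weight m lam) M v" using is_V_hw_vector[OF V] by blast
  interpret M: class_vectorspace M by (rule lie_hom_facts(1)[OF g(1)])
  interpret N: class_vectorspace N by (rule lie_hom_facts(2)[OF g(1)])
  have v: "v \<in> carrier M" "v \<noteq> \<zero>\<^bsub>M\<^esub>" using hv by (auto simp: hw_vector_def)
  have fv: "f v \<noteq> \<zero>\<^bsub>N\<^esub>" and gv: "g v \<noteq> \<zero>\<^bsub>N\<^esub>"
    using v inj_onD[OF f'(2), of v "\<zero>\<^bsub>M\<^esub>"] lie_hom_facts(7)[OF f'(1)]
      inj_onD[OF g(2), of v "\<zero>\<^bsub>M\<^esub>"] lie_hom_facts(7)[OF g(1)] by auto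
  obtain D G where "triangular (classical_alg K m :: ('a, 'a mat) lie_alg) D (borel_upper K m) G"
    using classical_triangular[OF even] by blast
  then interpret T: triangular "classical_alg K m :: ('a, 'a mat) lie_alg" D "borel_upper K m" G .
  obtain c where c: "\<forall>u\<in>carrier M. g u = c \<odot>\<^bsub>N\<^esub> f u"
    using T.lie_hom_proportional[OF M N f'(1) g(1) hw_vector_eigenvector[OF hv] fv] by blast
  have "c \<noteq> 0" using c v gv lie_hom_facts(3)[OF f'(1) v(1)] by auto
  then show ?thesis using c by blast
qed

text \<open>The maps \<open>\<xi>\<close> and \<open>\<eta>\<close> between the fixed modules are \<open>x\<close> and \<open>y\<close> seen through the identifications \<open>f\<close>, \<open>g\<close>,
\<open>f'\<close>, \<open>g'\<close>; their comparison becomes one of \<open>x\<close> and \<open>y\<close> once \<open>M\<close> and \<open>N\<close>, and \<open>M'\<close> and \<open>N'\<close>, are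
identified by \<open>h\<close> and \<open>h'\<close>.\<close>

lemma transition_scalar_iff:
  assumes f: "f \<in> lie_iso L M V" and g: "g \<in> lie_iso L N V"
    and h: "h \<in> lie_iso L M N" "\<And>u. u \<in> carrier M \<Longrightarrow> g (h u) = f u"
    and f': "f' \<in> lie_iso L' M' V'" and g': "g' \<in> lie_iso L' N' V'"
    and h': "h' \<in> lie_iso L' M' N'" "\<And>u. u \<in> carrier M' \<Longrightarrow> g' (h' u) = f' u"
    and x: "\<And>u. u \<in> carrier M \<Longrightarrow> x u \<in> carrier M'" and y: "\<And>w. w \<in> carrier N \<Longrightarrow> y w \<in> carrier N'"
    and \<xi>: "\<And>u. u \<in> carrier M \<Longrightarrow> \<xi> (f u) = f' (x u)"
    and \<eta>: "\<And>w. w \<in> carrier N \<Longrightarrow> \<eta> (g w) = g' (y w)"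
  shows "(\<forall>v\<in>carrier V. \<xi> v = c \<odot>\<^bsub>V'\<^esub> \<eta> v) \<longleftrightarrow> (\<forall>u\<in>carrier M. h' (x u) = c \<odot>\<^bsub>N'\<^esub> y (h u))"
proof -
  have hom: "g' \<in> lie_hom L' N' V'" "h \<in> lie_hom L M N" "h' \<in> lie_hom L' M' N'"
    and inj: "inj_on g' (carrier N')" and img: "carrier V = f ` carrier M"
    using f g' h h' by (auto simp: lie_iso_def bij_betw_def)
  interpret N': class_vectorspace N' by (rule lie_hom_facts(1)[OF hom(1)])
  have "\<xi> (f u) = c \<odot>\<^bsub>V'\<^esub> \<eta> (f u) \<longleftrightarrow> h' (x u) = c \<odot>\<^bsub>N'\<^esub> y (h u)" if u: "u \<in> carrier M" for u
  proof -
    have hu: "h u \<in> carrier N" and hx: "h' (x u) \<in> carrier N'"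
      using lie_hom_facts(3)[OF hom(2) u] lie_hom_facts(3)[OF hom(3) x[OF u]] .
    have "\<xi> (f u) = g' (h' (x u))" using \<xi>[OF u] h'(2)[OF x[OF u]] by simp
    moreover have "c \<odot>\<^bsub>V'\<^esub> \<eta> (f u) = g' (c \<odot>\<^bsub>N'\<^esub> y (h u))"
      using \<eta>[OF hu] h(2)[OF u] lie_hom_facts(5)[OF hom(1) y[OF hu]] by simp
    ultimately show ?thesis
      using inj_on_eq_iff[OF inj hx, of "c \<odot>\<^bsub>N'\<^esub> y (h u)"] y[OF hu] by auto
  qed
  then show ?thesis unfolding img by simp
qed

section \<open>Isomorphism of locally simple modules\<close>

lemma locally_simple_simple_lie_system:
  fixes X :: "nat \<Rightarrow> ('a::{alg_closed_field, field_char_0}, 'v, 'a mat) lie_mod"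
  assumes even: "K = SP \<Longrightarrow> even n" and X: "locally_simple_system K n X x"
  shows "simple_lie_system (g_fin K n) (\<lambda>_. diag_emb n) X x"
proof
  fix k :: nat assume k: "1 \<le> k"
  show "diag_emb n A \<in> carrier (g_fin K n (k + 1))" if "A \<in> carrier (g_fin K n k)" for A :: "'a mat"
    using diag_emb_in_classical[of K "n ^ k" A n] that even k by simp
  show "lie_simple (g_fin K n k) (X k)"
    and "x k \<in> lie_hom (g_fin K n k) (X k) (lie_pullback (diag_emb n) (X (k + 1)))"
    and "\<exists>u\<in>carrier (X k). x k u \<noteq> \<zero>\<^bsub>X (k + 1)\<^esub>"
    using X k unfolding locally_simple_system_def by blast+
  then show "lie_module (g_fin K n k) (X k)" by (simp only: lie_simple_def)
qed

theorem proposition8p4: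
  fixes K :: classical and n :: nat
    and X :: "nat \<Rightarrow> ('a::{alg_closed_field, field_char_0}, 'v, 'a mat) lie_mod"
    and x :: "nat \<Rightarrow> 'v \<Rightarrow> 'v"
    and Y :: "nat \<Rightarrow> ('a, 'w, 'a mat) lie_mod"
    and y :: "nat \<Rightarrow> 'w \<Rightarrow> 'w"
    and lam mu  :: "nat \<Rightarrow> label"
    and \<xi> \<eta> :: "nat \<Rightarrow> 'a vec \<Rightarrow> 'a vec"
  assumes "n \<ge> 2" and "K = SP \<Longrightarrow> even n"
    and "locally_simple_system K n X x" and "locally_simple_system K n Y y"
    and "annihilator (g_inf K n) (lim_mod X x) \<noteq> {\<zero>\<^bsub>uea (g_inf K n :: ('a, (nat \<times> 'a mat) set) lie_alg)\<^esub>}"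
    and "annihilator (g_inf K n) (lim_mod Y y) \<noteq> {\<zero>\<^bsub>uea (g_inf K n :: ('a, (nat \<times> 'a mat) set) lie_alg)\<^esub>}"
    and "point_data K n X x lam \<xi>" and "point_data K n Y y mu \<eta>"
  shows "lie_isomorphic (g_inf K n) (lim_mod X x) (lim_mod Y y) \<longleftrightarrow>
         point_data_equiv K n (lam, \<xi>) (mu, \<eta>)"
proof -
  let ?L = "g_fin K n :: nat \<Rightarrow> ('a, 'a mat) lie_alg" and ?V = "\<lambda>k. V_mod K (n ^ k) (lam k)"
  interpret X: simple_lie_system ?L "\<lambda>_. diag_emb n" X x
    by (rule locally_simple_simple_lie_system[OF assms(2,3)])
  interpret Y: simple_lie_system ?L "\<lambda>_. diag_emb n" Y y
    by (rule locally_simple_simple_lie_system[OF assms(2,4)])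
  interpret P: simple_lie_system_pair ?L "\<lambda>_. diag_emb n" X x Y y ..
  have g: "g_inf K n = lim_alg ?L (\<lambda>_. diag_emb n)" by (simp add: g_inf_def)
  have even: "even (n ^ k)" if "K = SP" "1 \<le> k" for k using assms(2) that by simp
  obtain \<theta> where theta: "\<forall>\<^sub>F k in sequentially. \<theta> k \<in> lie_iso (?L k) (X k) (?V k) \<and>
      (\<forall>v\<in>carrier (X k). \<xi> k (\<theta> k v) = \<theta> (k + 1) (x k v))"
    using assms(7) unfolding point_data_def by blast
  obtain \<theta>' where theta': "\<forall>\<^sub>F k in sequentially.
      \<theta>' k \<in> lie_iso (?L k) (Y k) (V_mod K (n ^ k) (mu k)) \<and>
      (\<forall>v\<in>carrier (Y k). \<eta> k (\<theta>' k v) = \<theta>' (k + 1) (y k v))"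
    using assms(8) unfolding point_data_def by blast
  obtain \<Lambda> where Lam: "finite \<Lambda>" "\<forall>\<^sub>F k in sequentially. lam k \<in> \<Lambda> \<and> is_V K (n ^ k) (lam k) (X k)"
    using assms(7) unfolding point_data_def Lambda_sequence_def by blast
  obtain \<Lambda>' where Lam': "finite \<Lambda>'" "\<forall>\<^sub>F k in sequentially. mu k \<in> \<Lambda>' \<and> is_V K (n ^ k) (mu k) (Y k)"
    using assms(8) unfolding point_data_def Lambda_sequence_def by blast
  \<comment> \<open>a bound for the total length of two labels that is uniform in \<open>k\<close>\<close>
  define b where "b = sum total_length \<Lambda> + sum total_length \<Lambda>'"
  have b: "total_length l + total_length l' \<le> b" if "l \<in> \<Lambda>" "l' \<in> \<Lambda>'" for l l'
    using that Lam(1) Lam'(1) unfolding b_def by (intro add_mono member_le_sum) auto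
  have "k < n ^ k" for k using assms(1) by (intro power_gt_expt) simp
  then have "b < n ^ k" if "b < k" for k using that less_trans by blast
  then have big: "\<forall>\<^sub>F k in sequentially. b < n ^ k"
    by (rule eventually_mono[OF eventually_gt_at_top[of b]])
  have "\<forall>\<^sub>F k in sequentially. 1 \<le> k \<and> \<theta> k \<in> lie_iso (?L k) (X k) (?V k) \<and>
      (\<forall>v\<in>carrier (X k). \<xi> k (\<theta> k v) = \<theta> (k + 1) (x k v)) \<and>
      \<theta>' k \<in> lie_iso (?L k) (Y k) (V_mod K (n ^ k) (mu k)) \<and>
      (\<forall>v\<in>carrier (Y k). \<eta> k (\<theta>' k v) = \<theta>' (k + 1) (y k v)) \<and>
      is_V K (n ^ k) (lam k) (X k) \<and> is_V K (n ^ k) (mu k) (Y k) \<and>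
      total_length (lam k) + total_length (mu k) < n ^ k"
    using theta theta' Lam(2) Lam'(2) big eventually_ge_at_top[of 1]
  proof eventually_elim
    case (elim k)
    then show ?case using b[of "lam k" "mu k"] by auto
  qed
  then obtain N where N: "\<And>k. N \<le> k \<Longrightarrow> 1 \<le> k \<and> \<theta> k \<in> lie_iso (?L k) (X k) (?V k) \<and>
      (\<forall>v\<in>carrier (X k). \<xi> k (\<theta> k v) = \<theta> (k + 1) (x k v)) \<and>
      \<theta>' k \<in> lie_iso (?L k) (Y k) (V_mod K (n ^ k) (mu k)) \<and>
      (\<forall>v\<in>carrier (Y k). \<eta> k (\<theta>' k v) = \<theta>' (k + 1) (y k v)) \<and>
      is_V K (n ^ k) (lam k) (X k) \<and> is_V K (n ^ k) (mu k) (Y k) \<and>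
      total_length (lam k) + total_length (mu k) < n ^ k"
    unfolding eventually_sequentially by blast
  note N1 = N[THEN conjunct1]
    and theta_iso = N[THEN conjunct2, THEN conjunct1]
    and theta_step = N[THEN conjunct2, THEN conjunct2, THEN conjunct1, rule_format]
    and theta'_iso = N[THEN conjunct2, THEN conjunct2, THEN conjunct2, THEN conjunct1]
    and theta'_step = N[THEN conjunct2, THEN conjunct2, THEN conjunct2, THEN conjunct2, THEN conjunct1, rule_format]
    and VX = N[THEN conjunct2, THEN conjunct2, THEN conjunct2, THEN conjunct2, THEN conjunct2, THEN conjunct1]
    and VY = N[THEN conjunct2, THEN conjunct2, THEN conjunct2, THEN conjunct2, THEN conjunct2, THEN conjunct2, THEN conjunct1]
    and len = N[THEN conjunct2, THEN conjunct2, THEN conjunct2, THEN conjunct2, THEN conjunct2, THEN conjunct2, THEN conjunct2]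
  have "\<exists>h. \<forall>k\<ge>N. lam k = mu k \<longrightarrow>
      h k \<in> lie_iso (?L k) (X k) (Y k) \<and> (\<forall>u\<in>carrier (X k). \<theta>' k (h k u) = \<theta> k u)"
  proof (intro choice allI)
    fix k
    show "\<exists>h. N \<le> k \<longrightarrow> lam k = mu k \<longrightarrow>
        h \<in> lie_iso (?L k) (X k) (Y k) \<and> (\<forall>u\<in>carrier (X k). \<theta>' k (h u) = \<theta> k u)"
    proof (cases "N \<le> k \<and> lam k = mu k")
      case True
      then have "\<theta>' k \<in> lie_iso (?L k) (Y k) (?V k)" using theta'_iso[of k] by simp
      then show ?thesis
        using lie_iso_lift[OF X.stage Y.stage theta_iso] N1 True by blast
    qed auto
  qed
  then obtain h where h: "\<And>k. N \<le> k \<Longrightarrow> lam k = mu k \<Longrightarrow> h k \<in> lie_iso (?L k) (X k) (Y k)"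
    "\<And>k u. N \<le> k \<Longrightarrow> lam k = mu k \<Longrightarrow> u \<in> carrier (X k) \<Longrightarrow> \<theta>' k (h k u) = \<theta> k u"
    by blast
  have transition: "(\<forall>v\<in>carrier (?V k). \<xi> k v = c \<odot>\<^bsub>?V (k + 1)\<^esub> \<eta> k v) \<longleftrightarrow>
      (\<forall>u\<in>carrier (X k). h (k + 1) (x k u) = c \<odot>\<^bsub>Y (k + 1)\<^esub> y k (h k u))"
    if k: "N \<le> k" and eq: "lam k = mu k" "lam (k + 1) = mu (k + 1)" for k c
  proof -
    have k': "N \<le> k + 1" using k by simp
    show ?thesis
    proof (rule transition_scalar_iff[OF theta_iso[OF k] _ h(1)[OF k eq(1)] h(2)[OF k eq(1)]
          theta_iso[OF k'] _ h(1)[OF k' eq(2)] h(2)[OF k' eq(2)]])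
      show "\<theta>' k \<in> lie_iso (?L k) (Y k) (?V k)" using theta'_iso[OF k] eq by simp
      show "\<theta>' (k + 1) \<in> lie_iso (?L (k + 1)) (Y (k + 1)) (?V (k + 1))" using theta'_iso[OF k'] eq by simp
    qed (use X.x_facts(1)[OF N1[OF k]] Y.x_facts(1)[OF N1[OF k]] theta_step[OF k] theta'_step[OF k] in auto)
  qed
  have H_point: "H_point K n lam k (\<xi> k) = H_point K n mu k (\<eta> k) \<longleftrightarrow>
      (\<exists>c. c \<noteq> 0 \<and> (\<forall>u\<in>carrier (X k). h (k + 1) (x k u) = c \<odot>\<^bsub>Y (k + 1)\<^esub> y k (h k u)))"
    if k: "N \<le> k" and eq: "lam k = mu k" "lam (k + 1) = mu (k + 1)" for k
  proof -
    have k': "N \<le> k + 1" using k by simp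
    have hom: "\<theta> (k + 1) \<in> lie_hom (?L (k + 1)) (X (k + 1)) (?V (k + 1))"
      "\<theta>' (k + 1) \<in> lie_hom (?L (k + 1)) (Y (k + 1)) (?V (k + 1))"
      using theta_iso[OF k'] theta'_iso[OF k'] eq by (auto simp: lie_iso_def)
    have img: "carrier (?V k) = \<theta> k ` carrier (X k)" "carrier (?V k) = \<theta>' k ` carrier (Y k)"
      using theta_iso[OF k] theta'_iso[OF k] eq by (auto simp: lie_iso_def bij_betw_def)
    have xi: "\<xi> k v \<in> carrier (?V (k + 1))" if "v \<in> carrier (?V k)" for v
      using that X.x_facts(1)[OF N1[OF k]] theta_step[OF k] lie_hom_facts(3)[OF hom(1)]
      unfolding img(1) by auto
    have eta: "\<eta> k v \<in> carrier (?V (k + 1))" if "v \<in> carrier (?V k)" for v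
      using that Y.x_facts(1)[OF N1[OF k]] theta'_step[OF k] lie_hom_facts(3)[OF hom(2)]
      unfolding img(2) by auto
    have "H_point K n lam k (\<xi> k) = H_point K n mu k (\<eta> k) \<longleftrightarrow>
        (\<exists>c. c \<noteq> 0 \<and> (\<forall>v\<in>carrier (?V k). \<xi> k v = c \<odot>\<^bsub>?V (k + 1)\<^esub> \<eta> k v))"
      unfolding H_point_def eq[symmetric]
      by (rule proj_point_eq_iff[OF lie_hom_facts(2)[OF hom(1)] xi eta])
    then show ?thesis by (simp only: transition[OF k eq])
  qed
  show ?thesis
  proof
    assume "lie_isomorphic (g_inf K n) (lim_mod X x) (lim_mod Y y)"
    then obtain \<Phi> where "\<Phi> \<in> lie_iso (lim_alg ?L (\<lambda>_. diag_emb n)) (lim_mod X x) (lim_mod Y y)"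
      unfolding lie_isomorphic_def g by blast
    from P.lim_iso_imp_stage_homs[OF this]
    obtain l \<phi> where "\<forall>k\<ge>l. \<phi> k \<in> lie_hom (?L k) (X k) (Y k) \<and> inj_on (\<phi> k) (carrier (X k)) \<and>
        (\<forall>u\<in>carrier (X k). \<phi> (k + 1) (x k u) = y k (\<phi> k u))"
      by blast
    then have phi: "\<And>k. l \<le> k \<Longrightarrow> \<phi> k \<in> lie_hom (?L k) (X k) (Y k)"
      "\<And>k. l \<le> k \<Longrightarrow> inj_on (\<phi> k) (carrier (X k))"
      "\<And>k u. l \<le> k \<Longrightarrow> u \<in> carrier (X k) \<Longrightarrow> \<phi> (k + 1) (x k u) = y k (\<phi> k u)"
      by blast+
    have eq: "lam k = mu k" if k: "N \<le> k" "l \<le> k" for k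
      using stage_hom_labels_eq[OF even[OF _ N1[OF k(1)]] Y.simple[OF N1[OF k(1)]] phi(1,2)[OF k(2)]
          VX[OF k(1)] VY[OF k(1)] len[OF k(1)]] .
    have scalar: "\<exists>c. c \<noteq> 0 \<and> (\<forall>u\<in>carrier (X k). \<phi> k u = c \<odot>\<^bsub>Y k\<^esub> h k u)" if k: "N \<le> k" "l \<le> k" for k
      using iso_unique_up_to_scalar[OF even[OF _ N1[OF k(1)]] X.simple[OF N1[OF k(1)]]
          Y.simple[OF N1[OF k(1)]] h(1)[OF k(1) eq[OF k]] phi(1,2)[OF k(2)] VX[OF k(1)]] .
    have "lam k = mu k \<and> H_point K n lam k (\<xi> k) = H_point K n mu k (\<eta> k)" if k: "max N l \<le> k" for k
    proof -
      have k': "N \<le> k" "l \<le> k" "N \<le> k + 1" "l \<le> k + 1" using k by auto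
      obtain c where c: "c \<noteq> 0" "\<And>u. u \<in> carrier (X k) \<Longrightarrow> \<phi> k u = c \<odot>\<^bsub>Y k\<^esub> h k u"
        using scalar[OF k'(1,2)] by blast
      obtain d where d: "d \<noteq> 0" "\<And>u. u \<in> carrier (X (k + 1)) \<Longrightarrow> \<phi> (k + 1) u = d \<odot>\<^bsub>Y (k + 1)\<^esub> h (k + 1) u"
        using scalar[OF k'(3,4)] by blast
      interpret Y': class_vectorspace "Y (k + 1)" by (rule Y.stage_vectorspace) simp
      have hom: "h k \<in> lie_hom (?L k) (X k) (Y k)"
        "h (k + 1) \<in> lie_hom (?L (k + 1)) (X (k + 1)) (Y (k + 1))"
        using h(1)[OF k'(1) eq[OF k'(1,2)]] h(1)[OF k'(3) eq[OF k'(3,4)]] by (auto simp: lie_iso_def)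
      have "h (k + 1) (x k u) = (c / d) \<odot>\<^bsub>Y (k + 1)\<^esub> y k (h k u)" if u: "u \<in> carrier (X k)" for u
      proof -
        have xu: "x k u \<in> carrier (X (k + 1))" by (rule X.x_facts(1)[OF N1[OF k'(1)] u])
        have hu: "h k u \<in> carrier (Y k)" by (rule lie_hom_facts(3)[OF hom(1) u])
        have hxu: "h (k + 1) (x k u) \<in> carrier (Y (k + 1))" by (rule lie_hom_facts(3)[OF hom(2) xu])
        have yhu: "y k (h k u) \<in> carrier (Y (k + 1))" by (rule Y.x_facts(1)[OF N1[OF k'(1)] hu])
        have "d \<odot>\<^bsub>Y (k + 1)\<^esub> h (k + 1) (x k u) = c \<odot>\<^bsub>Y (k + 1)\<^esub> y k (h k u)"
          using phi(3)[OF k'(2) u] d(2)[OF xu] c(2)[OF u] Y.x_facts(3)[OF N1[OF k'(1)] hu] by simp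
        then have "inverse d \<odot>\<^bsub>Y (k + 1)\<^esub> (d \<odot>\<^bsub>Y (k + 1)\<^esub> h (k + 1) (x k u)) =
            inverse d \<odot>\<^bsub>Y (k + 1)\<^esub> (c \<odot>\<^bsub>Y (k + 1)\<^esub> y k (h k u))" by simp
        then have "(inverse d * d) \<odot>\<^bsub>Y (k + 1)\<^esub> h (k + 1) (x k u) =
            (inverse d * c) \<odot>\<^bsub>Y (k + 1)\<^esub> y k (h k u)"
          by (simp only: Y'.scale_scale[OF hxu] Y'.scale_scale[OF yhu])
        moreover have "inverse d * d = 1" "inverse d * c = c / d"
          using d(1) by (simp_all add: field_simps)
        ultimately show ?thesis by (simp only: Y'.scale_one[OF hxu])
      qed
      moreover have "c / d \<noteq> 0" using c(1) d(1) by simp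
      ultimately show ?thesis
        using H_point[OF k'(1) eq[OF k'(1,2)] eq[OF k'(3,4)]] eq[OF k'(1,2)] by blast
    qed
    then show "point_data_equiv K n (lam, \<xi>) (mu, \<eta>)"
      unfolding point_data_equiv_def prod.case eventually_sequentially by blast
  next
    assume "point_data_equiv K n (lam, \<xi>) (mu, \<eta>)"
    then obtain l where l: "\<And>k. l \<le> k \<Longrightarrow> lam k = mu k"
      "\<And>k. l \<le> k \<Longrightarrow> H_point K n lam k (\<xi> k) = H_point K n mu k (\<eta> k)"
      unfolding point_data_equiv_def prod.case eventually_sequentially by blast
    define k0 where "k0 = max N l"
    have k0: "N \<le> k" "l \<le> k" "N \<le> k + 1" "l \<le> k + 1" if "k0 \<le> k" for k
      using that by (auto simp: k0_def)
    have "\<exists>c. \<forall>k\<ge>k0. c k \<noteq> 0 \<and>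
        (\<forall>u\<in>carrier (X k). h (k + 1) (x k u) = c k \<odot>\<^bsub>Y (k + 1)\<^esub> y k (h k u))"
    proof (intro choice allI)
      fix k
      show "\<exists>c. k0 \<le> k \<longrightarrow> c \<noteq> 0 \<and>
          (\<forall>u\<in>carrier (X k). h (k + 1) (x k u) = c \<odot>\<^bsub>Y (k + 1)\<^esub> y k (h k u))"
      proof (cases "k0 \<le> k")
        case True
        then show ?thesis
          using H_point[OF k0(1) l(1)[OF k0(2)] l(1)[OF k0(4)]] l(2)[OF k0(2)] by blast
      qed simp
    qed
    then obtain c where c: "\<And>k. k0 \<le> k \<Longrightarrow> c k \<noteq> 0"
      "\<And>k u. k0 \<le> k \<Longrightarrow> u \<in> carrier (X k) \<Longrightarrow> h (k + 1) (x k u) = c k \<odot>\<^bsub>Y (k + 1)\<^esub> y k (h k u)"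
      by blast
    \<comment> \<open>solves \<open>d (k + 1) * c k = d k\<close>, so that the maps \<open>d k * h k\<close> commute with the transition maps\<close>
    define d where "d k = (\<Prod>i\<in>{k0..<k}. inverse (c i))" for k
    have d: "d k \<noteq> 0" for k using c(1) by (simp add: d_def)
    have d_Suc: "d (k + 1) * c k = d k" if "k0 \<le> k" for k using that c(1)[OF that] by (simp add: d_def)
    have "lie_isomorphic (lim_alg ?L (\<lambda>_. diag_emb n)) (lim_mod X x) (lim_mod Y y)"
    proof (rule P.stages_iso_imp_lim_iso)
      show "1 \<le> k0" using N1[of k0] by (simp add: k0_def)
      fix k assume k: "k0 \<le> k"
      have hk: "h k \<in> lie_iso (?L k) (X k) (Y k)" by (rule h(1)[OF k0(1)[OF k] l(1)[OF k0(2)[OF k]]])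
      show "(\<lambda>u. d k \<odot>\<^bsub>Y k\<^esub> h k u) \<in> lie_iso (?L k) (X k) (Y k)"
        by (rule lie_iso_scale[OF Y.stage[OF N1[OF k0(1)[OF k]]] hk d])
      fix u assume u: "u \<in> carrier (X k)"
      have hu: "h k u \<in> carrier (Y k)" using hk u lie_hom_facts(3) by (auto simp: lie_iso_def)
      interpret Y': class_vectorspace "Y (k + 1)" by (rule Y.stage_vectorspace) simp
      have "d (k + 1) \<odot>\<^bsub>Y (k + 1)\<^esub> h (k + 1) (x k u) = d k \<odot>\<^bsub>Y (k + 1)\<^esub> y k (h k u)"
        by (simp only: c(2)[OF k u] Y'.scale_scale[OF Y.x_facts(1)[OF N1[OF k0(1)[OF k]] hu]] d_Suc[OF k])
      also have "\<dots> = y k (d k \<odot>\<^bsub>Y k\<^esub> h k u)"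
        using Y.x_facts(3)[OF N1[OF k0(1)[OF k]] hu] by simp
      finally show "d (k + 1) \<odot>\<^bsub>Y (k + 1)\<^esub> h (k + 1) (x k u) = y k (d k \<odot>\<^bsub>Y k\<^esub> h k u)" .
    qed
    then show "lie_isomorphic (g_inf K n) (lim_mod X x) (lim_mod Y y)" unfolding g .
  qed
qed

end
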